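(* There exists a universal constant $C>0$ such that the following holds. Let $\mathcal{H}=(H_m)_{m\in\mathcal{M}}$ be an at most countable family of compact subsets $H_m$ of $(\mathbb{H},\|\cdot\|)$ and let $\pi$ be a sub-probability on $\mathcal{M}$. There exists a density estimator $\widehat\Pi$, based on $N_1,\ldots,N_n$, such that, whatever the density $\Pi$ on $(\mathbb{X},\mathcal{B}(\mathbb{X}),L)$ of the independent copies $N_1,\ldots,N_n$, $$C\,\mathbb{E}\left[h^2(\Pi,\widehat\Pi)\right]\le \inf_{\Phi\in\mathbb{U},\,\lambda\in\Lambda}\left[h^2(\Pi,\Pi^{\Phi,\lambda})+\inf_{j\ge 1}\left(\sum_{j'=1}^{j}O(\mathcal{H},\pi,\phi_{j'})+\sum_{j'>j}\lambda_{j'}^2\right)\right],$$ where $\Phi=(\phi_j)_{j\ge1}$, $\lambda=(\lambda_j)_{j\ge 1}$ and, for all $j\ge 1$, $$O(\mathcal{H},\pi,\phi_j)=\inf_{m\in\mathcal{M}}\left[\inf_{\psi\in H_m}\|\phi_j-\psi\|^2+\frac1n\log\left(\frac{|H_m[1/\sqrt n]|\,n}{\pi(m)}\right)\right].$$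
   Context: Setting. $(\mathcal{X},d)$ is a metric space with Borel $\sigma$-field $\mathcal{B}(\mathcal{X})$ and a $\sigma$-finite measure $\mu$. When $\mathcal{X}$ is not finite, $\mathbb{H}$ is the Hilbert space of complex-valued measurable functions $\phi$ on $\mathcal{X}$ with $\|\phi\|^2=\int_{\mathcal{X}}|\phi|^2d\mu<\infty$, with inner product $\langle\phi,\psi\rangle=\int_{\mathcal{X}}\overline\phi\,\psi\,d\mu$. When $\mathcal{X}$ is finite, say $\mathcal{X}=\{1,\ldots,p\}$, $\mathcal{X}$ is embedded into $\mathbb{N}^*=\mathbb{N}\setminus\{0\}$ and one uses $\mathbb{H}=\ell_2(\mathbb{N}^* )$ (complex square-summable sequences): a mapping $\phi$ on $\mathcal{X}$ with values in $\mathbb{C}$ is viewed as the sequence $(\phi(i))_{i\ge1}$ with $\phi(i)=0$ for all $i>p$. $\mathbb{U}$ is the set of all orthonormal sequences $\Phi=(\phi_j)_{j\ge 1}$ in $\mathbb{H}$. Point processes. $\mathbb{X}$ is the set of all finite subsets of $\mathcal{X}$ and $\mathbb{X}_k$ the set of those of cardinality $k$. $\mathcal{B}(\mathbb{X})$ is the smallest $\sigma$-field making $\alpha\mapsto|\alpha\cap B|$ measurable for every $B\in\mathcal{B}(\mathcal{X})$. $L$ is the measure on $\mathbb{X}$ defined for measurable $f:\mathbb{X}\to\mathbb{R}_+$ by $$\int_{\mathbb{X}}f\,dL=f(\varnothing)+\sum_{k\ge1}\frac1{k!}\int_{\mathcal{X}^{\vee k}}f(\{x_1,\ldots,x_k\})\,d\mu(x_1)\cdots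 d\mu(x_k),$$ where $\mathcal{X}^{\vee k}$ is the set of $k$-tuples in $\mathcal{X}^k$ with distinct coordinates. A point process is a random variable with values in $\mathbb{X}$; densities are with respect to $L$. One observes $n$ independent copies $N_1,\ldots,N_n$ of a point process with density $\Pi$. Determinantal densities. $\mathcal{P}$ is the set of finite subsets of $\mathbb{N}^*$. For $\alpha\in\mathbb{X}$, $J\in\mathcal{P}\setminus\{\varnothing\}$ and $\Phi\in\mathbb{U}$, let $\Phi_{\alpha,J}=(\phi_j(x))_{x\in\alpha,j\in J}$ and $\Pi^\Phi_J(\alpha)=|\det[\Phi_{\alpha,J}]|^2\mathbf{1}_{\mathbb{X}_{|J|}}(\alpha)$; by convention $\Pi^\Phi_\varnothing=\delta_\varnothing$. Let $\Lambda=\{\lambda\in[0,1]^{\mathbb{N}^*}:\sum_{j\ge1}\lambda_j^2<\infty\}$. For $\lambda\in\Lambda$, $\Pi^{\Phi,\lambda}=\sum_{J\in\mathcal{P}}p_J^\lambda\,\Pi^\Phi_J$ with $p_J^\lambda=\prod_{j\in J}\lambda_j^2\prod_{j\notin J}(1-\lambda_j^2)$. Other notation. The Hellinger distance $h$ between densities $p,q$ with respect to a measure $\nu$ is given by $h^2(p,q)=\frac12\int(\sqrt p-\sqrt q)^2d\nu$. A sub-probability $\pi$ on $\mathcal{M}$ satisfies $\pi(m)\ge0$ for all $m$ and $\sum_{m\in\mathcal{M}}\pi(m)\le1$. For a compact $H\subset\mathbb{H}$ and $\eta>0$, $H[\eta]$ is a maximal $\eta$-separated subset of $H$, that is, a subset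 of $H$ of maximal cardinality among those whose distinct elements $\phi\ne\phi'$ satisfy $\|\phi-\phi'\|>\eta$. $|A|$ denotes the cardinality of a finite set $A$.
   Formalization: The sample size is required to satisfy n ≥ 2 (the claim fails for n = 1), for finite 𝒳 the measure μ is counting measure (it fails for arbitrary μ there), and C is stated for all spaces 𝒳 inside one arbitrary ambient set. *)

theory Defs
  imports "HOL-Probability.Probability" "Jordan_Normal_Form.Determinant"
begin

section \<open>The Hilbert space\<close>

text \<open>
  Elements of the space $L^2(\nu)$ are represented by functions, not by equivalence classes, so
  \<open>l2_norm\<close> is a seminorm, and compactness refers to the corresponding (non-Hausdorff) topology.
  This is the same as compactness of the image in the quotient by equality almost everywhere.
  The space $\ell_2$ of square-summable sequences indexed from 1 is \<open>l2_space (count_space {1..})\<close>.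
\<close>

definition l2_space :: "'b measure \<Rightarrow> ('b \<Rightarrow> complex) set" where
  "l2_space \<nu> = {\<phi>. \<phi> \<in> borel_measurable \<nu> \<and> integrable \<nu> (\<lambda>x. (cmod (\<phi> x))\<^sup>2)}"

definition l2_norm :: "'b measure \<Rightarrow> ('b \<Rightarrow> complex) \<Rightarrow> real" where
  "l2_norm \<nu> \<phi> = sqrt (\<integral>x. (cmod (\<phi> x))\<^sup>2 \<partial>\<nu>)"

definition l2_inner :: "'b measure \<Rightarrow> ('b \<Rightarrow> complex) \<Rightarrow> ('b \<Rightarrow> complex) \<Rightarrow> complex" where
  "l2_inner \<nu> \<phi> \<psi> = (\<integral>x. cnj (\<phi> x) * \<psi> x \<partial>\<nu>)"

definition l2_topology :: "'b measure \<Rightarrow> ('b \<Rightarrow> complex) topology" where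
  "l2_topology \<nu> = topology_generated_by
     {{\<psi> \<in> l2_space \<nu>. l2_norm \<nu> (\<lambda>x. \<phi> x - \<psi> x) < r} | \<phi> r. \<phi> \<in> l2_space \<nu> \<and> r > 0}"

text \<open>
  Sequences are indexed by the positive integers; the value at index 0 is irrelevant throughout.
\<close>

definition orthonormal_seqs :: "'b measure \<Rightarrow> (nat \<Rightarrow> 'b \<Rightarrow> complex) set" where
  "orthonormal_seqs \<nu> = {\<Phi>. (\<forall>j\<ge>1. \<Phi> j \<in> l2_space \<nu>) \<and>
     (\<forall>i\<ge>1. \<forall>j\<ge>1. l2_inner \<nu> (\<Phi> i) (\<Phi> j) = (if i = j then 1 else 0))}"

definition separated :: "'b measure \<Rightarrow> real \<Rightarrow> ('b \<Rightarrow> complex) set \<Rightarrow> bool" where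
  "separated \<nu> \<eta> S \<longleftrightarrow>
     (\<forall>\<phi>\<in>S. \<forall>\<phi>'\<in>S. \<phi> \<noteq> \<phi>' \<longrightarrow> l2_norm \<nu> (\<lambda>x. \<phi> x - \<phi>' x) > \<eta>)"

text \<open>For $\eta > 0$, every $\eta$-separated subset of a compact set is finite.\<close>

definition max_separated :: "'b measure \<Rightarrow> ('b \<Rightarrow> complex) set \<Rightarrow> real \<Rightarrow> ('b \<Rightarrow> complex) set" where
  "max_separated \<nu> H \<eta> = arg_max card (\<lambda>S. finite S \<and> S \<subseteq> H \<and> separated \<nu> \<eta> S)"


section \<open>Point processes\<close>

definition metric_borel :: "'a set \<Rightarrow> ('a \<Rightarrow> 'a \<Rightarrow> real) \<Rightarrow> 'a measure" where
  "metric_borel X d = sigma X {U. openin (Metric_space.mtopology X d) U}"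

definition configs :: "'a measure \<Rightarrow> 'a set set" where
  "configs \<mu> = {\<alpha>. finite \<alpha> \<and> \<alpha> \<subseteq> space \<mu>}"

definition config_algebra :: "'a measure \<Rightarrow> 'a set measure" where
  "config_algebra \<mu> = sigma (configs \<mu>)
     {(\<lambda>\<alpha>. card (\<alpha> \<inter> B)) -` A \<inter> configs \<mu> | A B. B \<in> sets \<mu>}"

text \<open>
  The reference measure, given through the integrals of indicator functions: the first summand is the
  value at the empty configuration, the others range over tuples with distinct coordinates.
\<close>

definition config_measure :: "'a measure \<Rightarrow> 'a set measure" where
  "config_measure \<mu> = measure_of (configs \<mu>) (sets (config_algebra \<mu>))
     (\<lambda>A. indicator A {} +
        (\<Sum>i. let k = Suc i in ennreal (1 / fact k) *
           (\<integral>\<^sup>+ x. indicator {x. inj_on x {1..k}} x * indicator A (x ` {1..k})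
              \<partial>(\<Pi>\<^sub>M _\<in>{1..k}. \<mu>))))"

definition is_density :: "'c measure \<Rightarrow> ('c \<Rightarrow> real) \<Rightarrow> bool" where
  "is_density \<nu> p \<longleftrightarrow> p \<in> borel_measurable \<nu> \<and> (\<forall>x\<in>space \<nu>. p x \<ge> 0) \<and>
     (\<integral>\<^sup>+ x. ennreal (p x) \<partial>\<nu>) = 1"

text \<open>The square $h^2$ of the Hellinger distance.\<close>

definition hellinger2 :: "'c measure \<Rightarrow> ('c \<Rightarrow> real) \<Rightarrow> ('c \<Rightarrow> real) \<Rightarrow> ennreal" where
  "hellinger2 \<nu> p q = ennreal (1 / 2) * (\<integral>\<^sup>+ x. ennreal ((sqrt (p x) - sqrt (q x))\<^sup>2) \<partial>\<nu>)"


section \<open>Determinantal densities\<close>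

text \<open>
  The functions $\phi_j$ are evaluated at a point \<open>x\<close> of the state space through a map
  \<open>\<iota>\<close> into the space on which they are defined. The map is the identity, except for a finite state
  space, where it is the embedding into the positive integers. The choice of the
  enumeration of \<open>\<alpha>\<close> only changes the sign of the determinant.
\<close>

definition det_matrix ::
    "('a \<Rightarrow> 'b) \<Rightarrow> (nat \<Rightarrow> 'b \<Rightarrow> complex) \<Rightarrow> 'a set \<Rightarrow> nat set \<Rightarrow> complex mat" where
  "det_matrix \<iota> \<Phi> \<alpha> J =
     (let xs = (SOME xs. set xs = \<alpha> \<and> distinct xs); js = sorted_list_of_set J
      in mat (card \<alpha>) (card J) (\<lambda>(r, c). \<Phi> (js ! c) (\<iota> (xs ! r))))"

definition det_density :: "('a \<Rightarrow> 'b) \<Rightarrow> (nat \<Rightarrow> 'b \<Rightarrow> complex) \<Rightarrow> nat set \<Rightarrow> 'a set \<Rightarrow> real" where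
  "det_density \<iota> \<Phi> J \<alpha> =
     (if J = {} then (if \<alpha> = {} then 1 else 0)
      else if card \<alpha> = card J then (cmod (Determinant.det (det_matrix \<iota> \<Phi> \<alpha> J)))\<^sup>2 else 0)"

definition Lambda :: "(nat \<Rightarrow> real) set" where
  "Lambda = {lam. (\<forall>j\<ge>1. 0 \<le> lam j \<and> lam j \<le> 1) \<and> (\<lambda>j. (lam j)\<^sup>2) summable_on {1..}}"

definition index_weight :: "(nat \<Rightarrow> real) \<Rightarrow> nat set \<Rightarrow> real" where
  "index_weight lam J = (\<Prod>j\<in>J. (lam j)\<^sup>2) * (\<Prod>j. if j = 0 \<or> j \<in> J then 1 else 1 - (lam j)\<^sup>2)"

text \<open>
  For \<open>\<Phi>\<close> orthonormal the series below converges for almost all \<open>\<alpha>\<close>; where it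
  diverges, \<open>infsum\<close> returns 0.
\<close>

definition mixed_det_density ::
    "('a \<Rightarrow> 'b) \<Rightarrow> (nat \<Rightarrow> 'b \<Rightarrow> complex) \<Rightarrow> (nat \<Rightarrow> real) \<Rightarrow> 'a set \<Rightarrow> real" where
  "mixed_det_density \<iota> \<Phi> lam \<alpha> =
     (\<Sum>\<^sub>\<infinity>J\<in>{J. finite J \<and> J \<subseteq> {1..}}. index_weight lam J * det_density \<iota> \<Phi> J \<alpha>)"


section \<open>Estimation\<close>

definition subprobability :: "'i set \<Rightarrow> ('i \<Rightarrow> real) \<Rightarrow> bool" where
  "subprobability M p \<longleftrightarrow> (\<forall>m\<in>M. p m \<ge> 0) \<and> p summable_on M \<and> (\<Sum>\<^sub>\<infinity>m\<in>M. p m) \<le> 1"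

text \<open>
  In the logarithm, $\log(c/0) = +\infty$. An empty \<open>H m\<close> contributes \<open>\<infinity>\<close> through the
  infimum over the empty set.
\<close>

definition approx_cost :: "'b measure \<Rightarrow> nat \<Rightarrow> 'i set \<Rightarrow> ('i \<Rightarrow> ('b \<Rightarrow> complex) set) \<Rightarrow>
    ('i \<Rightarrow> real) \<Rightarrow> ('b \<Rightarrow> complex) \<Rightarrow> ereal" where
  "approx_cost \<nu> n M H p \<phi> =
     (INF m\<in>M. (INF \<psi>\<in>H m. ereal ((l2_norm \<nu> (\<lambda>x. \<phi> x - \<psi> x))\<^sup>2)) +
        (if p m = 0 then \<infinity>
         else ereal (1 / real n *
           ln (real (card (max_separated \<nu> (H m) (1 / sqrt (real n)))) * real n / p m))))"

text \<open>
  An estimator maps a sample \<open>(\<omega> 1, \<dots>, \<omega> n)\<close> of configurations to a density. Joint measurability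
  makes its Hellinger loss a random variable.
\<close>

definition density_estimator ::
    "'a measure \<Rightarrow> nat \<Rightarrow> ((nat \<Rightarrow> 'a set) \<Rightarrow> 'a set \<Rightarrow> real) \<Rightarrow> bool" where
  "density_estimator \<mu> n est \<longleftrightarrow>
     (\<lambda>(\<omega>, \<alpha>). est \<omega> \<alpha>) \<in> borel_measurable
        ((\<Pi>\<^sub>M _\<in>{1..n}. config_measure \<mu>) \<Otimes>\<^sub>M config_measure \<mu>) \<and>
     (\<forall>\<omega>\<in>space (\<Pi>\<^sub>M _\<in>{1..n}. config_measure \<mu>). is_density (config_measure \<mu>) (est \<omega>))"

definition hellinger_risk ::
    "'a measure \<Rightarrow> nat \<Rightarrow> ('a set \<Rightarrow> real) \<Rightarrow> ((nat \<Rightarrow> 'a set) \<Rightarrow> 'a set \<Rightarrow> real) \<Rightarrow> ennreal" where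
  "hellinger_risk \<mu> n P est =
     (\<integral>\<^sup>+ \<omega>. hellinger2 (config_measure \<mu>) P (est \<omega>)
        \<partial>(\<Pi>\<^sub>M _\<in>{1..n}. density (config_measure \<mu>) (\<lambda>\<alpha>. ennreal (P \<alpha>))))"

definition oracle_bound :: "'a measure \<Rightarrow> 'b measure \<Rightarrow> ('a \<Rightarrow> 'b) \<Rightarrow> nat \<Rightarrow> 'i set \<Rightarrow>
    ('i \<Rightarrow> ('b \<Rightarrow> complex) set) \<Rightarrow> ('i \<Rightarrow> real) \<Rightarrow> ('a set \<Rightarrow> real) \<Rightarrow> ereal" where
  "oracle_bound \<mu> \<nu> \<iota> n M H p P =
     (INF \<Phi>\<in>orthonormal_seqs \<nu>. INF lam\<in>Lambda.
        enn2ereal (hellinger2 (config_measure \<mu>) P (mixed_det_density \<iota> \<Phi> lam)) +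
        (INF j\<in>{1..}. (\<Sum>j'=1..j. approx_cost \<nu> n M H p (\<Phi> j')) +
           ereal (\<Sum>\<^sub>\<infinity>j'\<in>{j<..}. (lam j')\<^sup>2)))"

end

theory Submission imports Defs
begin

text \<open>
  The estimator selects one density out of a countable family. The proof has two halves: a selection
  theorem for countable families of densities, and the construction of a family that approximates every
  determinantal density at the price announced by the bound.

  Selection (\<open>selection_risk\<close>). Two candidates $p$, $q$ are compared through the bounded ratio
  $r(p,q) = (2\sqrt q + \sqrt p)/(2\sqrt p + \sqrt q)$ instead of the likelihood ratio. Its expectation under
  an arbitrary density $P$ is at most $\exp(10\,h^2(P,p) - h^2(P,q)/12)$, whether or not $P$ is one of the
  candidates; hence the robustness to misspecification. The products of these ratios over the sample,
  weighted by a sub-probability and summed over all $q$, have expectation at most 1 after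
  normalisation, and a penalised comparison of each candidate with all others selects an index whose
  risk is controlled by $h^2(P,t_i) + n^{-1}\log(1/w_i)$ for every $i$.

  Approximation (\<open>mixture_distance\<close>). The density $\Pi^{\Phi,\lambda}$ is a mixture, over random index sets
  $J$, of squared moduli of Slater determinants of $(\phi_j)_{j\in J}$. The point is that replacing
  $\Phi$ by $\Psi$ in one component costs $\sum_{j\in J}\|\phi_j-\psi_j\|^2$, and not the square of the sum
  of the norms, which is what a replacement of the columns one at a time would give. By the Andreief
  identity the inner product of the two Slater determinants is the determinant of the cross Gram matrix
  $G = (\langle\phi_i,\psi_j\rangle)$; since $G$ is a contraction, $I-G^*G$ is positive semidefinite, and
  $\det(I-E)\ge 1-\mathrm{tr}\,E$ for positive semidefinite $E$ (\<open>det_one_minus_psd\<close>) gives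
  $|\det G| \ge 1-\sum_j\|\phi_j-\psi_j\|^2$. The costs are averaged over $J$. The law of $J$ is a product of
  Bernoulli laws, so its affinities multiply: approximating $\lambda_j$ by $\kappa_j$ costs
  $|\lambda_j-\kappa_j|$ and cutting off $\lambda_j$ costs $\lambda_j^2$ (\<open>weight_affinity\<close>).

  The family. A candidate is coded by a nonempty list of triples: a model $m$, a point of its net
  $H_m[1/\sqrt n]$, and a point of the grid $\{0,1/n,\dots,1\}$ for the coefficient. The points of the nets
  are not orthonormal, so the coded functions are replaced by an orthonormal sequence that is almost
  nearest to them; by the triangle inequality this loses only a constant factor. The weight of a list is the
  product of the weights $\pi(m)/(2(n+1)|H_m[1/\sqrt n]|)$ of its entries, whose logarithms are, up to
  constants, the terms of the bound; since $n \ge 2$, the additional constants are absorbed by these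
  logarithms.

  Two features of the setting have to be respected. For a non-separable state space the set of tuples with
  distinct entries may fail to be measurable in the product $\sigma$-algebra; the reference measure is then
  described through a measurable kernel of this set (\<open>measurable_kernel\<close>). For a finite state space the
  functions live on the positive integers, so that a determinantal density may have mass less than 1;
  the locale \<open>embedding\<close> treats both cases at once, and the candidates are normalised.
\<close>

section \<open>Determinants of contractions\<close>

definition psd :: "nat \<Rightarrow> (nat \<Rightarrow> nat \<Rightarrow> complex) \<Rightarrow> bool" where
  "psd k E \<longleftrightarrow> (\<forall>x::nat \<Rightarrow> complex.
     (\<Sum>i<k. \<Sum>j<k. cnj (x i) * E i j * x j) \<in> \<real>\<^sub>\<ge>\<^sub>0)"

abbreviation fdet :: "nat \<Rightarrow> (nat \<Rightarrow> nat \<Rightarrow> complex) \<Rightarrow> complex" where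
  "fdet k A \<equiv> Determinant.det (mat k k (\<lambda>(i, j). A i j))"

text \<open>
  Restricting the quadratic form to one or two coordinates yields everything used about a positive semidefinite
  matrix: real nonnegative diagonal, symmetry, and the bound on the off-diagonal entries.
\<close>

lemma psd_two_points:
  assumes "psd k E" "i < k" "j < k" "i \<noteq> j"
  shows "cnj a * E i i * a + cnj a * E i j * b + cnj b * E j i * a + cnj b * E j j * b \<in> \<real>\<^sub>\<ge>\<^sub>0"
proof -
  define x where "x = (\<lambda>l. if l = i then a else if l = j then b else 0)"
  have S: "(\<Sum>l<k. g l) = g i + g j" if "\<And>l. l \<noteq> i \<Longrightarrow> l \<noteq> j \<Longrightarrow> g l = 0" for g :: "nat \<Rightarrow> complex"
  proof -
    have "(\<Sum>l<k. g l) = (\<Sum>l\<in>{i,j}. g l)"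
      using assms that by (intro sum.mono_neutral_right) auto
    then show ?thesis using assms by simp
  qed
  have "(\<Sum>l<k. \<Sum>m<k. cnj (x l) * E l m * x m)
      = (\<Sum>l<k. cnj (x l) * E l i * a + cnj (x l) * E l j * b)"
    using assms(4) by (intro sum.cong refl, subst S) (auto simp: x_def)
  also have "\<dots> = cnj a * E i i * a + cnj a * E i j * b + (cnj b * E j i * a + cnj b * E j j * b)"
    using assms(4) by (subst S) (auto simp: x_def)
  finally have eq: "(\<Sum>l<k. \<Sum>m<k. cnj (x l) * E l m * x m) = \<dots>" .
  have "(\<Sum>l<k. \<Sum>m<k. cnj (x l) * E l m * x m) \<in> \<real>\<^sub>\<ge>\<^sub>0"
    using assms(1) unfolding psd_def by blast
  then show ?thesis unfolding eq by (simp only: add.assoc)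
qed

lemma psd_diagonal:
  assumes "psd k E" "i < k"
  shows "Re (E i i) \<ge> 0" "Im (E i i) = 0"
proof -
  define x where "x = (\<lambda>l. if l = i then 1 else 0 :: complex)"
  have "(\<Sum>l<k. \<Sum>m<k. cnj (x l) * E l m * x m) = (\<Sum>l<k. if l = i then E i i else 0)"
  proof (intro sum.cong refl)
    fix l
    have "(\<Sum>m<k. cnj (x l) * E l m * x m) = (\<Sum>m<k. if m = i then cnj (x l) * E l i else 0)"
      by (intro sum.cong) (auto simp: x_def)
    also have "\<dots> = cnj (x l) * E l i" using assms by simp
    finally show "(\<Sum>m<k. cnj (x l) * E l m * x m) = (if l = i then E i i else 0)"
      by (auto simp: x_def)
  qed
  also have "\<dots> = E i i" using assms by simp
  finally have eq: "(\<Sum>l<k. \<Sum>m<k. cnj (x l) * E l m * x m) = E i i" .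
  have "E i i \<in> \<real>\<^sub>\<ge>\<^sub>0" using assms(1) unfolding psd_def eq[symmetric] by blast
  then show "Re (E i i) \<ge> 0" "Im (E i i) = 0" by (auto simp: complex_nonneg_Reals_iff)
qed

lemma psd_hermitian:
  assumes "psd k E" "i < k" "j < k"
  shows "E j i = cnj (E i j)"
proof (cases "i = j")
  case True
  then show ?thesis using psd_diagonal[OF assms(1,2)] by (simp add: complex_eq_iff)
next
  case False
  from psd_two_points[OF assms False, of 1 1] psd_two_points[OF assms False, of 1 \<i>]
    psd_diagonal[OF assms(1,2)] psd_diagonal[OF assms(1,3)]
  show ?thesis by (auto simp: complex_nonneg_Reals_iff complex_eq_iff)
qed

lemma psd_entry_bound:
  assumes "psd k E" "i < k" "j < k"
  shows "(cmod (E i j))\<^sup>2 \<le> Re (E i i) * Re (E j j)"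
proof (cases "i = j")
  case True
  then show ?thesis using psd_diagonal[OF assms(1,2)] by (simp add: cmod_power2) (simp add: power2_eq_square)
next
  case False
  define e d w where "e = Re (E i i)" and "d = Re (E j j)" and "w = (cmod (E i j))\<^sup>2"
  have e: "E i i = of_real e" and d: "E j j = of_real d"
    using psd_diagonal[OF assms(1,2)] psd_diagonal[OF assms(1,3)]
    by (auto simp: e_def d_def complex_eq_iff)
  have e0: "e \<ge> 0" and d0: "d \<ge> 0"
    using psd_diagonal[OF assms(1,2)] psd_diagonal[OF assms(1,3)] by (auto simp: e_def d_def)
  \<comment> \<open>The quadratic form at the vector with entries \<open>s\<close> and \<open>- t * cnj (E i j)\<close>.\<close>
  have q: "s\<^sup>2 * e + t\<^sup>2 * w * d - 2 * s * t * w \<ge> 0" for s t :: real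
  proof -
    have zz: "E i j * cnj (E i j) = of_real w" "cnj (E i j) * E i j = of_real w"
      using complex_norm_square[of "E i j"] unfolding w_def by (simp_all only: mult.commute)
    have "cnj (of_real s) * E i i * of_real s + cnj (of_real s) * E i j * (- of_real t * cnj (E i j))
        + cnj (- of_real t * cnj (E i j)) * E j i * of_real s
        + cnj (- of_real t * cnj (E i j)) * E j j * (- of_real t * cnj (E i j))
        = of_real (s\<^sup>2) * E i i - of_real (2 * s * t) * (E i j * cnj (E i j)) + of_real (t\<^sup>2) * E j j * (E i j * cnj (E i j))"
      by (simp add: psd_hermitian[OF assms] power2_eq_square algebra_simps)
    also have "\<dots> = of_real (s\<^sup>2 * e + t\<^sup>2 * w * d - 2 * s * t * w)"
      unfolding zz e d by (simp add: algebra_simps)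
    finally have "of_real (s\<^sup>2 * e + t\<^sup>2 * w * d - 2 * s * t * w) \<in> (\<real>\<^sub>\<ge>\<^sub>0 :: complex set)"
      using psd_two_points[OF assms False, of "of_real s" "- of_real t * cnj (E i j)"] by (simp only:)
    then show ?thesis by (simp only: nonneg_Reals_of_real_iff)
  qed
  have "w \<le> e * d"
  proof (cases "d = 0")
    case True
    have "w = 0"
    proof (rule ccontr)
      assume "w \<noteq> 0"
      then show False using q[of 1 "(e + 1) / w"] True e0 by simp
    qed
    then show ?thesis using True by simp
  next
    case False
    have "d\<^sup>2 * e + w * d - 2 * d * w = d * (e * d - w)" by (simp add: power2_eq_square algebra_simps)
    with q[of d 1] have "d * (e * d - w) \<ge> 0" by simp
    with False d0 show ?thesis by (simp add: zero_le_mult_iff)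
  qed
  then show ?thesis by (simp add: e_def d_def w_def)
qed

text \<open>
  Gaussian elimination with the first entry as pivot, written as a block LU factorisation.
\<close>

lemma fdet_schur_complement:
  fixes M :: "nat \<Rightarrow> nat \<Rightarrow> complex"
  assumes "M 0 0 \<noteq> 0"
  shows "fdet (Suc k) M = M 0 0 * fdet k (\<lambda>i j. M (Suc i) (Suc j) - M (Suc i) 0 * M 0 (Suc j) / M 0 0)"
proof -
  \<comment> \<open>The factors of the block LU factorisation: \<open>L\<close> is block lower triangular, and \<open>R\<close> is block upper triangular with
    the Schur complement \<open>S\<close> as its last block.\<close>
  define S where "S = mat k k (\<lambda>(i, j). M (Suc i) (Suc j) - M (Suc i) 0 * M 0 (Suc j) / M 0 0)"
  define L where "L = four_block_mat (mat 1 1 (\<lambda>_. M 0 0)) (0\<^sub>m 1 k) (mat k 1 (\<lambda>(i, j). M (Suc i) 0)) (1\<^sub>m k)"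
  define R where "R = four_block_mat (1\<^sub>m 1) (mat 1 k (\<lambda>(i, j). M 0 (Suc j) / M 0 0)) (0\<^sub>m k 1) S"
  have "L * R = mat (Suc k) (Suc k) (\<lambda>(i, j). M i j)"
    unfolding L_def R_def
    by (subst mult_four_block_mat[of _ 1 1 _ k _ k _ _ 1 _ k])
      (use assms in \<open>auto simp: S_def scalar_prod_def four_block_mat_def Let_def intro!: eq_matI\<close>)
  moreover have "L \<in> carrier_mat (Suc k) (Suc k)" "R \<in> carrier_mat (Suc k) (Suc k)"
    by (auto simp: L_def R_def S_def)
  ultimately have "fdet (Suc k) M = Determinant.det L * Determinant.det R"
    by (metis Determinant.det_mult)
  moreover have "Determinant.det L = M 0 0"
    unfolding L_def by (subst Determinant.det_four_block_mat_upper_right_zero[of _ 1 _ k])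
      (auto simp: det_single)
  moreover have "Determinant.det R = Determinant.det S"
    unfolding R_def by (subst Determinant.det_four_block_mat_lower_left_zero[of _ 1 _ k])
      (auto simp: S_def)
  ultimately show ?thesis by (simp add: S_def)
qed

text \<open>
  For a diagonal $E$ this is Bernoulli's inequality $\prod_i(1-e_i) \ge 1-\sum_i e_i$. In general, eliminate the
  first coordinate: the Schur complement of $1-e$ in $I-E$ is $I-E'$ with $E' = E_1 + bb^*/(1-e)$, where $E_1$ is
  the remaining block and $b$ the first column. $E'$ is again positive semidefinite, and as
  $|b_i|^2 \le e\,E_{ii}$, its trace is at most $\tau/(1-e)$, where $\tau$ is the trace of $E_1$. Hence the
  induction closes without any loss: $(1-e)(1-\tau/(1-e)) = 1-e-\tau$.
\<close>

lemma det_one_minus_psd: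
  assumes "psd k E" "(\<Sum>i<k. Re (E i i)) < 1"
  shows "fdet k (\<lambda>i j. (if i = j then 1 else 0) - E i j) \<in> \<real> \<and>
    Re (fdet k (\<lambda>i j. (if i = j then 1 else 0) - E i j)) \<ge> 1 - (\<Sum>i<k. Re (E i i))"
  using assms
proof (induction k arbitrary: E)
  case 0
  then show ?case by (simp add: det_dim_zero)
next
  case (Suc k)
  define e where "e = Re (E 0 0)"
  define \<tau> where "\<tau> = (\<Sum>i<k. Re (E (Suc i) (Suc i)))"
  have tr: "(\<Sum>i<Suc k. Re (E i i)) = e + \<tau>"
    unfolding e_def \<tau>_def by (rule sum.lessThan_Suc_shift)
  have E00: "E 0 0 = of_real e"
    using psd_diagonal[OF Suc.prems(1), of 0] by (simp add: e_def complex_eq_iff)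
  have e0: "e \<ge> 0" using psd_diagonal[OF Suc.prems(1), of 0] by (simp add: e_def)
  have tau0: "\<tau> \<ge> 0"
    unfolding \<tau>_def using psd_diagonal(1)[OF Suc.prems(1)] by (intro sum_nonneg) auto
  have e1: "e + \<tau> < 1" using Suc.prems(2) tr by simp
  then have e2: "1 - e > 0" using tau0 by simp
  define b where "b i = E (Suc i) 0" for i
  have row: "E 0 (Suc j) = cnj (b j)" if "j < k" for j
    using psd_hermitian[OF Suc.prems(1), of "Suc j" 0] that by (simp add: b_def)
  define E' where "E' = (\<lambda>i j. E (Suc i) (Suc j) + b i * cnj (b j) / of_real (1 - e))"
  \<comment> \<open>A vector is extended by 0 in the eliminated coordinate.\<close>
  have psd': "psd k E'"
    unfolding psd_def
  proof
    fix x :: "nat \<Rightarrow> complex"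
    define y where "y i = (case i of 0 \<Rightarrow> 0 | Suc l \<Rightarrow> x l)" for i
    have "(\<Sum>i<Suc k. \<Sum>j<Suc k. cnj (y i) * E i j * y j) \<in> \<real>\<^sub>\<ge>\<^sub>0"
      using Suc.prems(1) unfolding psd_def by blast
    then have 1: "(\<Sum>i<k. \<Sum>j<k. cnj (x i) * E (Suc i) (Suc j) * x j) \<in> \<real>\<^sub>\<ge>\<^sub>0"
      by (simp add: sum.lessThan_Suc_shift y_def del: sum.lessThan_Suc)
    define c where "c = (\<Sum>i<k. cnj (x i) * b i)"
    have "(\<Sum>i<k. \<Sum>j<k. cnj (x i) * E' i j * x j)
       = (\<Sum>i<k. \<Sum>j<k. cnj (x i) * E (Suc i) (Suc j) * x j)
       + (\<Sum>i<k. \<Sum>j<k. (cnj (x i) * b i) * (cnj (b j) * x j)) / of_real (1 - e)"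
      unfolding E'_def sum_divide_distrib sum.distrib[symmetric]
      by (intro sum.cong refl) (simp add: algebra_simps)
    also have "(\<Sum>i<k. \<Sum>j<k. (cnj (x i) * b i) * (cnj (b j) * x j)) = c * cnj c"
      unfolding c_def by (simp add: sum_product cnj_sum mult.commute)
    also have "\<dots> = of_real ((cmod c)\<^sup>2)" by (rule complex_norm_square[symmetric])
    finally have "(\<Sum>i<k. \<Sum>j<k. cnj (x i) * E' i j * x j)
       = (\<Sum>i<k. \<Sum>j<k. cnj (x i) * E (Suc i) (Suc j) * x j) + of_real ((cmod c)\<^sup>2 / (1 - e))"
      by simp
    moreover have "of_real ((cmod c)\<^sup>2 / (1 - e)) \<in> (\<real>\<^sub>\<ge>\<^sub>0 :: complex set)"
      using e2 by (simp only: nonneg_Reals_of_real_iff) simp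
    ultimately show "(\<Sum>i<k. \<Sum>j<k. cnj (x i) * E' i j * x j) \<in> \<real>\<^sub>\<ge>\<^sub>0"
      using 1 by (simp only: nonneg_Reals_add_I)
  qed
  have tr': "(\<Sum>i<k. Re (E' i i)) \<le> \<tau> / (1 - e)"
  proof -
    have "Re (E' i i) \<le> Re (E (Suc i) (Suc i)) + e * Re (E (Suc i) (Suc i)) / (1 - e)" if "i < k" for i
    proof -
      have "b i * cnj (b i) / of_real (1 - e) = of_real ((cmod (b i))\<^sup>2 / (1 - e))"
        using complex_norm_square[of "b i"] by simp
      then have "Re (E' i i) = Re (E (Suc i) (Suc i)) + (cmod (b i))\<^sup>2 / (1 - e)"
        unfolding E'_def by (simp only: plus_complex.sel Re_complex_of_real)
      moreover have "(cmod (b i))\<^sup>2 \<le> e * Re (E (Suc i) (Suc i))"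
        using psd_entry_bound[OF Suc.prems(1), of "Suc i" 0] that by (simp add: b_def e_def mult.commute)
      ultimately show ?thesis using e2 by (simp add: divide_right_mono)
    qed
    then have "(\<Sum>i<k. Re (E' i i)) \<le> (\<Sum>i<k. Re (E (Suc i) (Suc i)) + e * Re (E (Suc i) (Suc i)) / (1 - e))"
      by (intro sum_mono) auto
    also have "\<dots> = \<tau> + e * \<tau> / (1 - e)"
      unfolding \<tau>_def by (simp add: sum.distrib sum_distrib_left sum_divide_distrib)
    also have "\<dots> = \<tau> / (1 - e)" using e2 by (simp add: field_simps)
    finally show ?thesis .
  qed
  also have "\<tau> / (1 - e) < 1" using e1 e2 by (simp add: field_simps)
  finally have "(\<Sum>i<k. Re (E' i i)) < 1" .
  note IH = Suc.IH[OF psd' this]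
  define M where "M = (\<lambda>i j. (if i = j then 1 else 0) - E i j)"
  have M00: "M 0 0 = of_real (1 - e)" by (simp add: M_def E00)
  have "fdet (Suc k) M = M 0 0 * fdet k (\<lambda>i j. M (Suc i) (Suc j) - M (Suc i) 0 * M 0 (Suc j) / M 0 0)"
    by (rule fdet_schur_complement) (use e2 in \<open>simp add: M00\<close>)
  also have "mat k k (\<lambda>(i, j). M (Suc i) (Suc j) - M (Suc i) 0 * M 0 (Suc j) / M 0 0)
     = mat k k (\<lambda>(i, j). (if i = j then 1 else 0) - E' i j)"
    unfolding M00 by (rule eq_matI) (auto simp: M_def E'_def row b_def)
  finally have D: "fdet (Suc k) M = of_real (1 - e) * fdet k (\<lambda>i j. (if i = j then 1 else 0) - E' i j)"
    by (simp only: M00)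
  have "Re (fdet (Suc k) M) = (1 - e) * Re (fdet k (\<lambda>i j. (if i = j then 1 else 0) - E' i j))"
    unfolding D by simp
  also have "\<dots> \<ge> (1 - e) * (1 - \<tau> / (1 - e))"
    using IH tr' e2 by (intro mult_left_mono) auto
  also have "(1 - e) * (1 - \<tau> / (1 - e)) = 1 - (e + \<tau>)" using e2 by (simp add: field_simps)
  finally have "Re (fdet (Suc k) M) \<ge> 1 - (e + \<tau>)" .
  moreover have "fdet (Suc k) M \<in> \<real>" unfolding D using IH by (intro Reals_mult) auto
  ultimately show ?case unfolding tr M_def by simp
qed

text \<open>
  For a configuration this Gram form is a polynomial in sums over its points. It shows
  both that the density does not depend on the enumeration of the points and that it is measurable.
\<close>

lemma cmod_det_squared:
  "complex_of_real ((cmod (fdet k A))\<^sup>2) = fdet k (\<lambda>i j. \<Sum>l<k. cnj (A l i) * A l j)"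
proof -
  interpret cnj: comm_ring_hom cnj by unfold_locales auto
  define B where "B = mat k k (\<lambda>(i, j). A i j)"
  have B: "B \<in> carrier_mat k k" by (simp add: B_def)
  have "mat k k (\<lambda>(i, j). \<Sum>l<k. cnj (A l i) * A l j) = transpose_mat (map_mat cnj B) * B"
    by (rule eq_matI) (auto simp: B_def scalar_prod_def lessThan_atLeast0)
  then have "fdet k (\<lambda>i j. \<Sum>l<k. cnj (A l i) * A l j) = cnj (Determinant.det B) * Determinant.det B"
    using B by (simp add: Determinant.det_mult[of _ k] Determinant.det_transpose[of _ k])
  moreover have "fdet k A = Determinant.det B" by (simp add: B_def)
  ultimately have "fdet k (\<lambda>i j. \<Sum>l<k. cnj (A l i) * A l j) = fdet k A * cnj (fdet k A)"
    by (metis mult.commute)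
  then show ?thesis by (simp only: complex_norm_square)
qed

text \<open>
  $|\det G|^2 = \det(G^*G) = \det(I-E)$ for $E = I-G^*G$, and the trace of $E$ is at most the sum on the left because
  each column of $G$ has at least the norm of its diagonal entry. If $|\det G| > 1$ the bound is trivial, otherwise
  $|\det G| \ge |\det G|^2$.
\<close>

lemma contraction_det_bound:
  assumes "psd k (\<lambda>i j. (if i = j then 1 else 0) - (\<Sum>l<k. cnj (G l i) * G l j))"
  shows "1 - (\<Sum>j<k. 1 - (cmod (G j j))\<^sup>2) \<le> cmod (fdet k G)"
proof -
  define E where "E = (\<lambda>i j. (if i = j then 1 else 0) - (\<Sum>l<k. cnj (G l i) * G l j))"
  have psd: "psd k E" using assms by (simp add: E_def)
  have Ed: "Re (E j j) = 1 - (\<Sum>l<k. (cmod (G l j))\<^sup>2)" for j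
    by (simp add: E_def cmod_power2) (simp add: power2_eq_square)
  have le: "Re (E j j) \<le> 1 - (cmod (G j j))\<^sup>2" if "j < k" for j
    unfolding Ed using that member_le_sum[of j "{..<k}" "\<lambda>l. (cmod (G l j))\<^sup>2"] by auto
  have tr: "(\<Sum>j<k. Re (E j j)) \<le> (\<Sum>j<k. 1 - (cmod (G j j))\<^sup>2)"
    by (intro sum_mono) (use le in auto)
  have tr0: "(\<Sum>j<k. Re (E j j)) \<ge> 0"
    using psd_diagonal(1)[OF psd] by (intro sum_nonneg) auto
  consider "(\<Sum>j<k. Re (E j j)) \<ge> 1" | "cmod (fdet k G) > 1" 
    | "(\<Sum>j<k. Re (E j j)) < 1" "cmod (fdet k G) \<le> 1" by linarith
  then show ?thesis
  proof cases
    case 1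
    then show ?thesis using tr norm_ge_zero[of "fdet k G"] by linarith
  next
    case 2
    then show ?thesis using tr tr0 by linarith
  next
    case 3
    have "(\<lambda>i j. (if i = j then 1 else 0) - E i j) = (\<lambda>i j. \<Sum>l<k. cnj (G l i) * G l j)"
      by (auto simp: E_def)
    then have "1 - (\<Sum>j<k. Re (E j j)) \<le> Re (of_real ((cmod (fdet k G))\<^sup>2))"
      using det_one_minus_psd[OF psd 3(1)] unfolding cmod_det_squared by simp
    also have "\<dots> \<le> cmod (fdet k G)"
      using 3(2) by (simp add: power2_eq_square mult_left_le)
    finally show ?thesis using tr by linarith
  qed
qed

lemma l2_spaceD [dest]:
  assumes "\<phi> \<in> l2_space \<nu>"
  shows "\<phi> \<in> borel_measurable \<nu>" "integrable \<nu> (\<lambda>x. (cmod (\<phi> x))\<^sup>2)"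
  using assms by (auto simp: l2_space_def)

section \<open>Square-integrable functions and Slater determinants\<close>

lemma borel_measurable_cnj' [measurable (raw)]:
  "f \<in> borel_measurable M \<Longrightarrow> (\<lambda>x. cnj (f x)) \<in> borel_measurable M"
  by (rule measurable_compose[OF _ borel_measurable_continuous_onI[OF continuous_on_cnj[OF continuous_on_id]]])

lemma integrable_l2_product:
  assumes "\<phi> \<in> l2_space \<nu>" "\<psi> \<in> l2_space \<nu>"
  shows "integrable \<nu> (\<lambda>x. cnj (\<phi> x) * \<psi> x)"
proof (rule Bochner_Integration.integrable_bound)
  show "integrable \<nu> (\<lambda>x. (cmod (\<phi> x))\<^sup>2 + (cmod (\<psi> x))\<^sup>2)"
    using assms by (auto simp: l2_space_def)
  show "(\<lambda>x. cnj (\<phi> x) * \<psi> x) \<in> borel_measurable \<nu>"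
    using assms by (intro borel_measurable_times borel_measurable_cnj') auto
  have "a * b \<le> a\<^sup>2 + b\<^sup>2" if "a \<ge> 0" "b \<ge> 0" for a b :: real
    using that sum_squares_bound[of a b] mult_nonneg_nonneg[of a b] by linarith
  then show "AE x in \<nu>. norm (cnj (\<phi> x) * \<psi> x) \<le> norm ((cmod (\<phi> x))\<^sup>2 + (cmod (\<psi> x))\<^sup>2)"
    by (auto simp: norm_mult)
qed

lemma l2_space_sum:
  assumes "\<And>j. j \<in> S \<Longrightarrow> \<phi> j \<in> l2_space \<nu>"
  shows "(\<lambda>x. \<Sum>j\<in>S. c j * \<phi> j x) \<in> l2_space \<nu>"
  using assms
proof (induction S rule: infinite_finite_induct)
  case (insert a S)
  define f where "f = (\<lambda>x. \<Sum>j\<in>S. c j * \<phi> j x)"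
  have f: "f \<in> l2_space \<nu>" using insert by (simp add: f_def)
  have a: "\<phi> a \<in> l2_space \<nu>" using insert by simp
  note [measurable] = l2_spaceD(1)[OF f] l2_spaceD(1)[OF a]
  have "integrable \<nu> (\<lambda>x. (cmod (c a * \<phi> a x + f x))\<^sup>2)"
  proof (rule Bochner_Integration.integrable_bound)
    show "integrable \<nu> (\<lambda>x. 2 * (cmod (c a))\<^sup>2 * (cmod (\<phi> a x))\<^sup>2 + 2 * (cmod (f x))\<^sup>2)"
      using f a by (auto simp: l2_space_def)
    show "(\<lambda>x. (cmod (c a * \<phi> a x + f x))\<^sup>2) \<in> borel_measurable \<nu>" by measurable
    have "(cmod (u + v))\<^sup>2 \<le> 2 * (cmod u)\<^sup>2 + 2 * (cmod v)\<^sup>2" for u v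
    proof -
      have "(cmod (u + v))\<^sup>2 \<le> (cmod u + cmod v)\<^sup>2"
        by (intro power_mono norm_triangle_ineq) auto
      also have "\<dots> \<le> 2 * (cmod u)\<^sup>2 + 2 * (cmod v)\<^sup>2"
        using sum_squares_bound[of "cmod u" "cmod v"] by (simp add: power2_eq_square algebra_simps)
      finally show ?thesis .
    qed
    from this[of "c a * \<phi> a _"] 
    show "AE x in \<nu>. norm ((cmod (c a * \<phi> a x + f x))\<^sup>2)
        \<le> norm (2 * (cmod (c a))\<^sup>2 * (cmod (\<phi> a x))\<^sup>2 + 2 * (cmod (f x))\<^sup>2)"
      by (simp add: norm_mult power_mult_distrib mult.assoc)
  qed
  moreover have "(\<lambda>x. c a * \<phi> a x + f x) \<in> borel_measurable \<nu>" by measurable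
  ultimately have "(\<lambda>x. c a * \<phi> a x + f x) \<in> l2_space \<nu>" by (simp add: l2_space_def)
  then show ?case using insert(1,2) by (simp add: f_def)
qed (auto simp: l2_space_def)

lemma l2_space_diff:
  assumes "\<phi> \<in> l2_space \<nu>" "\<psi> \<in> l2_space \<nu>"
  shows "(\<lambda>x. \<phi> x - \<psi> x) \<in> l2_space \<nu>"
proof -
  have "(\<lambda>x. \<Sum>j\<in>{0,1::nat}. (if j = 0 then 1 else -1) * (if j = 0 then \<phi> else \<psi>) x) \<in> l2_space \<nu>"
    by (rule l2_space_sum) (use assms in auto)
  then show ?thesis by simp
qed

lemma l2_norm_squared: "(l2_norm \<nu> \<phi>)\<^sup>2 = (\<integral>x. (cmod (\<phi> x))\<^sup>2 \<partial>\<nu>)"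
  unfolding l2_norm_def by (rule real_sqrt_pow2) (simp add: integral_nonneg_AE)

lemma l2_norm_nonneg [simp]: "l2_norm \<nu> \<phi> \<ge> 0"
  unfolding l2_norm_def by (simp add: integral_nonneg_AE)

abbreviation l2_dist2 :: "'b measure \<Rightarrow> ('b \<Rightarrow> complex) \<Rightarrow> ('b \<Rightarrow> complex) \<Rightarrow> real" where
  "l2_dist2 \<nu> \<phi> \<psi> \<equiv> (l2_norm \<nu> (\<lambda>x. \<phi> x - \<psi> x))\<^sup>2"

lemma l2_inner_self: "l2_inner \<nu> \<phi> \<phi> = of_real ((l2_norm \<nu> \<phi>)\<^sup>2)"
proof -
  have "cnj z * z = of_real ((cmod z)\<^sup>2)" for z
    using complex_norm_square[of z] by (simp only: mult.commute)
  then show ?thesis unfolding l2_inner_def l2_norm_squared by (simp only: integral_complex_of_real)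
qed

lemma l2_inner_commute: "l2_inner \<nu> \<psi> \<phi> = cnj (l2_inner \<nu> \<phi> \<psi>)"
proof -
  have "l2_inner \<nu> \<psi> \<phi> = (\<integral>x. cnj (cnj (\<phi> x) * \<psi> x) \<partial>\<nu>)"
    unfolding l2_inner_def by (intro Bochner_Integration.integral_cong refl) simp
  also have "\<dots> = cnj (l2_inner \<nu> \<phi> \<psi>)" unfolding l2_inner_def by (simp del: complex_cnj_mult)
  finally show ?thesis .
qed

lemma l2_inner_sum_right:
  assumes "\<phi> \<in> l2_space \<nu>" "\<And>j. j \<in> S \<Longrightarrow> \<psi> j \<in> l2_space \<nu>"
  shows "l2_inner \<nu> \<phi> (\<lambda>x. \<Sum>j\<in>S. c j * \<psi> j x) = (\<Sum>j\<in>S. c j * l2_inner \<nu> \<phi> (\<psi> j))"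
proof -
  have "l2_inner \<nu> \<phi> (\<lambda>x. \<Sum>j\<in>S. c j * \<psi> j x) = (\<integral>x. (\<Sum>j\<in>S. c j * (cnj (\<phi> x) * \<psi> j x)) \<partial>\<nu>)"
    unfolding l2_inner_def by (simp add: sum_distrib_left algebra_simps)
  also have "\<dots> = (\<Sum>j\<in>S. \<integral>x. c j * (cnj (\<phi> x) * \<psi> j x) \<partial>\<nu>)"
    using assms by (intro Bochner_Integration.integral_sum) (auto intro!: integrable_l2_product)
  finally show ?thesis unfolding l2_inner_def by simp
qed

lemma l2_inner_sum_left:
  assumes "\<phi> \<in> l2_space \<nu>" "\<And>j. j \<in> S \<Longrightarrow> \<psi> j \<in> l2_space \<nu>"
  shows "l2_inner \<nu> (\<lambda>x. \<Sum>j\<in>S. c j * \<psi> j x) \<phi> = (\<Sum>j\<in>S. cnj (c j) * l2_inner \<nu> (\<psi> j) \<phi>)"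
  by (subst l2_inner_commute, subst l2_inner_sum_right[OF assms], simp,
      simp add: cnj_sum l2_inner_commute[of \<nu> _ \<phi>])

lemma l2_inner_diff_diff:
  assumes "u \<in> l2_space \<nu>" "v \<in> l2_space \<nu>"
  shows "l2_inner \<nu> (\<lambda>x. u x - v x) (\<lambda>x. u x - v x)
    = l2_inner \<nu> u u - l2_inner \<nu> u v - l2_inner \<nu> v u + l2_inner \<nu> v v"
proof -
  have "l2_inner \<nu> (\<lambda>x. u x - v x) (\<lambda>x. u x - v x)
    = (\<integral>x. (cnj (u x) * u x - cnj (u x) * v x - cnj (v x) * u x) + cnj (v x) * v x \<partial>\<nu>)"
    unfolding l2_inner_def by (intro Bochner_Integration.integral_cong) (auto simp: algebra_simps)
  also have "\<dots> = l2_inner \<nu> u u - l2_inner \<nu> u v - l2_inner \<nu> v u + l2_inner \<nu> v v"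
    unfolding l2_inner_def using integrable_l2_product[OF assms(1,1)] integrable_l2_product[OF assms(1,2)]
      integrable_l2_product[OF assms(2,1)] integrable_l2_product[OF assms(2,2)]
    by simp
  finally show ?thesis .
qed

lemma l2_norm_diff_squared_le:
  assumes "\<phi> \<in> l2_space \<nu>" "\<psi> \<in> l2_space \<nu>" "\<theta> \<in> l2_space \<nu>"
  shows "l2_dist2 \<nu> \<phi> \<theta>
    \<le> 2 * l2_dist2 \<nu> \<phi> \<psi> + 2 * l2_dist2 \<nu> \<psi> \<theta>"
proof -
  have "(cmod (u - w))\<^sup>2 \<le> 2 * (cmod (u - v))\<^sup>2 + 2 * (cmod (v - w))\<^sup>2" for u v w
  proof -
    have "(cmod (u - w))\<^sup>2 \<le> (cmod (u - v) + cmod (v - w))\<^sup>2"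
      by (intro power_mono norm_diff_triangle_le[of u v]) auto
    also have "\<dots> \<le> 2 * (cmod (u - v))\<^sup>2 + 2 * (cmod (v - w))\<^sup>2"
      using sum_squares_bound[of "cmod (u - v)" "cmod (v - w)"] by (simp add: power2_eq_square algebra_simps)
    finally show ?thesis .
  qed
  then have "(\<integral>x. (cmod (\<phi> x - \<theta> x))\<^sup>2 \<partial>\<nu>)
     \<le> (\<integral>x. 2 * (cmod (\<phi> x - \<psi> x))\<^sup>2 + 2 * (cmod (\<psi> x - \<theta> x))\<^sup>2 \<partial>\<nu>)"
    using l2_space_diff[OF assms(1,3)] l2_space_diff[OF assms(1,2)] l2_space_diff[OF assms(2,3)]
    by (intro integral_mono) (auto simp: l2_space_def)
  also have "\<dots> = 2 * (\<integral>x. (cmod (\<phi> x - \<psi> x))\<^sup>2 \<partial>\<nu>) + 2 * (\<integral>x. (cmod (\<psi> x - \<theta> x))\<^sup>2 \<partial>\<nu>)"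
    using l2_space_diff[OF assms(1,2)] l2_space_diff[OF assms(2,3)]
    by (subst Bochner_Integration.integral_add) (auto simp: l2_space_def)
  finally show ?thesis unfolding l2_norm_squared .
qed

lemma l2_norm_diff_commute: "l2_norm \<nu> (\<lambda>x. \<phi> x - \<psi> x) = l2_norm \<nu> (\<lambda>x. \<psi> x - \<phi> x)"
  unfolding l2_norm_def by (simp add: norm_minus_commute)

definition orthonormal_family :: "'b measure \<Rightarrow> nat \<Rightarrow> (nat \<Rightarrow> 'b \<Rightarrow> complex) \<Rightarrow> bool" where
  "orthonormal_family \<nu> k a \<longleftrightarrow> (\<forall>i<k. a i \<in> l2_space \<nu>) \<and>
     (\<forall>i<k. \<forall>j<k. l2_inner \<nu> (a i) (a j) = (if i = j then 1 else 0))"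

text \<open>
  The quadratic form at $x$ is the squared norm of $u-v$, where $u = \sum_j x_j b_j$ and $v$ is the projection of
  $u$ onto the span of the $a_l$.
\<close>

lemma psd_cross_gram_defect:
  assumes a: "orthonormal_family \<nu> k a" and b: "orthonormal_family \<nu> k b"
  defines "G \<equiv> \<lambda>i j. l2_inner \<nu> (a i) (b j)"
  shows "psd k (\<lambda>i j. (if i = j then 1 else 0) - (\<Sum>l<k. cnj (G l i) * G l j))"
  unfolding psd_def
proof
  fix x :: "nat \<Rightarrow> complex"
  have al: "\<And>l. l \<in> {..<k} \<Longrightarrow> a l \<in> l2_space \<nu>" and bl: "\<And>l. l \<in> {..<k} \<Longrightarrow> b l \<in> l2_space \<nu>"
    using a b by (auto simp: orthonormal_family_def)
  define u where "u = (\<lambda>y. \<Sum>j<k. x j * b j y)"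
  define c where "c l = (\<Sum>j<k. x j * G l j)" for l
  define v where "v = (\<lambda>y. \<Sum>l<k. c l * a l y)"
  have u: "u \<in> l2_space \<nu>" and v: "v \<in> l2_space \<nu>"
    unfolding u_def v_def by (intro l2_space_sum al bl; assumption)+
  have au: "l2_inner \<nu> (a l) u = c l" if "l < k" for l
    unfolding u_def c_def G_def by (rule l2_inner_sum_right) (use al bl that in auto)
  have bu: "l2_inner \<nu> (b j) u = x j" if "j < k" for j
  proof -
    have "l2_inner \<nu> (b j) u = (\<Sum>i<k. x i * l2_inner \<nu> (b j) (b i))"
      unfolding u_def by (rule l2_inner_sum_right) (use bl that in auto)
    also have "\<dots> = (\<Sum>i<k. if i = j then x i else 0)"
      using b that by (intro sum.cong) (auto simp: orthonormal_family_def)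
    finally show ?thesis using that by simp
  qed
  have av: "l2_inner \<nu> (a l) v = c l" if "l < k" for l
  proof -
    have "l2_inner \<nu> (a l) v = (\<Sum>i<k. c i * l2_inner \<nu> (a l) (a i))"
      unfolding v_def by (rule l2_inner_sum_right) (use al that in auto)
    also have "\<dots> = (\<Sum>i<k. if i = l then c i else 0)"
      using a that by (intro sum.cong) (auto simp: orthonormal_family_def)
    finally show ?thesis using that by simp
  qed
  have uu: "l2_inner \<nu> u u = (\<Sum>j<k. cnj (x j) * x j)"
  proof -
    have "l2_inner \<nu> (\<lambda>y. \<Sum>j<k. x j * b j y) u = (\<Sum>j<k. cnj (x j) * l2_inner \<nu> (b j) u)"
      by (rule l2_inner_sum_left) (use u bl in auto)
    then show ?thesis using bu by (simp add: u_def[symmetric])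
  qed
  have vw: "l2_inner \<nu> v w = (\<Sum>l<k. cnj (c l) * l2_inner \<nu> (a l) w)" if "w \<in> l2_space \<nu>" for w
    unfolding v_def by (rule l2_inner_sum_left) (use that al in auto)
  have vv: "l2_inner \<nu> v v = (\<Sum>l<k. cnj (c l) * c l)"
    using vw[OF v] av by simp
  have vu: "l2_inner \<nu> v u = (\<Sum>l<k. cnj (c l) * c l)"
    using vw[OF u] au by simp
  have uv: "l2_inner \<nu> u v = (\<Sum>l<k. cnj (c l) * c l)"
    by (subst l2_inner_commute) (simp add: vu cnj_sum mult.commute)
  have "of_real (l2_dist2 \<nu> u v) = (\<Sum>j<k. cnj (x j) * x j) - (\<Sum>l<k. cnj (c l) * c l)"
    unfolding l2_inner_self[symmetric] l2_inner_diff_diff[OF u v] uu vv vu uv by simp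
  moreover have "(\<Sum>i<k. \<Sum>j<k. cnj (x i) * ((if i = j then 1 else 0) - (\<Sum>l<k. cnj (G l i) * G l j)) * x j)
    = (\<Sum>j<k. cnj (x j) * x j) - (\<Sum>l<k. cnj (c l) * c l)"
  proof -
    have "(\<Sum>i<k. \<Sum>j<k. cnj (x i) * ((if i = j then 1 else 0) - (\<Sum>l<k. cnj (G l i) * G l j)) * x j)
      = (\<Sum>i<k. \<Sum>j<k. (if j = i then cnj (x i) * x j else 0)
          - (\<Sum>l<k. cnj (x i * G l i) * (x j * G l j)))"
      by (intro sum.cong refl) (simp add: algebra_simps sum_distrib_left sum_distrib_right)
    also have "\<dots> = (\<Sum>j<k. cnj (x j) * x j) - (\<Sum>i<k. \<Sum>j<k. \<Sum>l<k. cnj (x i * G l i) * (x j * G l j))"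
      by (simp add: sum_subtractf)
    also have "(\<Sum>i<k. \<Sum>j<k. \<Sum>l<k. cnj (x i * G l i) * (x j * G l j))
        = (\<Sum>i<k. \<Sum>l<k. \<Sum>j<k. cnj (x i * G l i) * (x j * G l j))"
      by (intro sum.cong refl sum.swap)
    also have "\<dots> = (\<Sum>l<k. \<Sum>i<k. \<Sum>j<k. cnj (x i * G l i) * (x j * G l j))"
      by (rule sum.swap)
    also have "\<dots> = (\<Sum>l<k. cnj (c l) * c l)"
      unfolding c_def by (simp only: sum_product cnj_sum)
    finally show ?thesis .
  qed
  ultimately have "(\<Sum>i<k. \<Sum>j<k. cnj (x i) * ((if i = j then 1 else 0) - (\<Sum>l<k. cnj (G l i) * G l j)) * x j)
    = of_real (l2_dist2 \<nu> u v)" by simp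
  then show "(\<Sum>i<k. \<Sum>j<k. cnj (x i) * ((if i = j then 1 else 0) - (\<Sum>l<k. cnj (G l i) * G l j)) * x j) \<in> \<real>\<^sub>\<ge>\<^sub>0"
    by (simp only: nonneg_Reals_of_real_iff zero_le_power2)
qed

text \<open>
  $\|a-b\|^2 = 2-2\,\mathrm{Re}\langle a,b\rangle$ for unit vectors, so $1-|\langle a,b\rangle|^2 \le \|a-b\|^2$; this
  is inserted into the bound for contractions.
\<close>

lemma det_cross_gram_bound:
  assumes a: "orthonormal_family \<nu> k a" and b: "orthonormal_family \<nu> k b"
  shows "1 - cmod (fdet k (\<lambda>i j. l2_inner \<nu> (a i) (b j)))
    \<le> (\<Sum>j<k. l2_dist2 \<nu> (a j) (b j))"
proof -
  define G where "G = (\<lambda>i j. l2_inner \<nu> (a i) (b j))"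
  have "1 - (cmod (G j j))\<^sup>2 \<le> l2_dist2 \<nu> (a j) (b j)" if "j < k" for j
  proof -
    define d where "d = l2_dist2 \<nu> (a j) (b j)"
    have l: "a j \<in> l2_space \<nu>" "b j \<in> l2_space \<nu>" "l2_inner \<nu> (a j) (a j) = 1" "l2_inner \<nu> (b j) (b j) = 1"
      using a b that by (auto simp: orthonormal_family_def)
    have "of_real d = l2_inner \<nu> (\<lambda>x. a j x - b j x) (\<lambda>x. a j x - b j x)"
      by (simp add: l2_inner_self d_def)
    also have "\<dots> = 2 - G j j - cnj (G j j)"
      unfolding l2_inner_diff_diff[OF l(1,2)] l l2_inner_commute[of \<nu> "b j" "a j"] G_def by simp
    finally have "Re (of_real d) = Re (2 - G j j - cnj (G j j))" by simp
    then have "d = 2 - 2 * Re (G j j)" by simp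
    then have r: "Re (G j j) = 1 - d / 2" by linarith
    have "(Re (G j j))\<^sup>2 \<le> (cmod (G j j))\<^sup>2" by (simp add: cmod_power2)
    then have "(1 - d / 2)\<^sup>2 \<le> (cmod (G j j))\<^sup>2" by (simp only: r)
    moreover have "(1 - d / 2)\<^sup>2 = 1 - d + d\<^sup>2 / 4" by (simp add: power2_eq_square algebra_simps)
    ultimately show ?thesis 
      using zero_le_power2[of d] unfolding d_def[symmetric] by linarith
  qed
  then have "(\<Sum>j<k. 1 - (cmod (G j j))\<^sup>2) \<le> (\<Sum>j<k. l2_dist2 \<nu> (a j) (b j))"
    by (intro sum_mono) auto
  moreover have "1 - (\<Sum>j<k. 1 - (cmod (G j j))\<^sup>2) \<le> cmod (fdet k G)"
    by (rule contraction_det_bound) (use psd_cross_gram_defect[OF a b] in \<open>simp add: G_def\<close>)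
  ultimately show ?thesis unfolding G_def by linarith
qed

text \<open>
  The matrix indices start at 0 and the tuples at 1, hence the shift.
\<close>

definition slater :: "nat \<Rightarrow> (nat \<Rightarrow> 'b \<Rightarrow> complex) \<Rightarrow> (nat \<Rightarrow> 'b) \<Rightarrow> complex" where
  "slater k a x = fdet k (\<lambda>r c. a c (x (Suc r)))"

lemma slater_leibniz:
  "slater k a x = (\<Sum>p | p permutes {0..<k}. of_int (sign p) * (\<Prod>i\<in>{1..k}. a (p (i - 1)) (x i)))"
proof -
  have "(\<Prod>i=0..<k. a (p i) (x (Suc i))) = (\<Prod>i\<in>{1..k}. a (p (i - 1)) (x i))" for p
    by (rule prod.reindex_bij_witness[of _ "\<lambda>i. i - 1" Suc]) auto
  then show ?thesis unfolding slater_def 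
    by (subst Determinant.det_def'[of _ k]) (auto simp: intro!: sum.cong prod.cong)
qed

lemma slater_measurable [measurable (raw)]:
  assumes "\<And>j. j < k \<Longrightarrow> a j \<in> borel_measurable \<nu>"
  shows "slater k a \<in> borel_measurable (\<Pi>\<^sub>M i\<in>{1..k}. \<nu>)"
proof -
  have "(\<lambda>x. \<Sum>p | p permutes {0..<k}. of_int (sign p) * (\<Prod>i\<in>{1..k}. a (p (i - 1)) (x i)))
      \<in> borel_measurable (\<Pi>\<^sub>M i\<in>{1..k}. \<nu>)"
  proof (intro borel_measurable_sum borel_measurable_times borel_measurable_prod borel_measurable_const)
    fix p i assume "p \<in> {p. p permutes {0..<k}}" "i \<in> {1..k}"
    then have "p (i - 1) < k" using permutes_in_image[of p "{0..<k}" "i - 1"] by auto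
    from assms[OF this] \<open>i \<in> {1..k}\<close> show "(\<lambda>x. a (p (i - 1)) (x i)) \<in> borel_measurable (\<Pi>\<^sub>M i\<in>{1..k}. \<nu>)"
      by (intro measurable_compose[OF measurable_component_singleton]) auto
  qed
  then show ?thesis by (simp add: slater_leibniz[abs_def])
qed

text \<open>
  Both determinants are expanded by Leibniz' formula, and the integral of each product of functions of the separate
  coordinates factorises. For each fixed permutation $p$ of the first expansion, the sum over the second one is the
  determinant of $G$ with its rows permuted by $p$, which is $\mathrm{sgn}(p)\det G$.
\<close>

lemma andreief:
  assumes "sigma_finite_measure \<nu>"
    and a: "\<And>j. j < k \<Longrightarrow> a j \<in> l2_space \<nu>" and b: "\<And>j. j < k \<Longrightarrow> b j \<in> l2_space \<nu>"
  shows "integrable (\<Pi>\<^sub>M i\<in>{1..k}. \<nu>) (\<lambda>x. cnj (slater k a x) * slater k b x)" (is ?I)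
    and "(\<integral>x. cnj (slater k a x) * slater k b x \<partial>(\<Pi>\<^sub>M i\<in>{1..k}. \<nu>))
       = fact k * fdet k (\<lambda>i j. l2_inner \<nu> (a i) (b j))" (is ?E)
proof -
  interpret product_sigma_finite "\<lambda>_::nat. \<nu>"
    using assms(1) by (simp add: product_sigma_finite_def)
  let ?P = "{p. p permutes {0..<k}}"
  define G where "G = (\<lambda>i j. l2_inner \<nu> (a i) (b j))"
  define t where "t p q x = (\<Prod>i\<in>{1..k}. cnj (a (p (i - 1)) (x i)) * b (q (i - 1)) (x i))" for p q and x :: "nat \<Rightarrow> _"
  have lt: "p (i - 1) < k" if "p \<in> ?P" "i \<in> {1..k}" for p i
    using permutes_in_image[of p "{0..<k}" "i - 1"] that by auto
  have prod: "cnj (slater k a x) * slater k b x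
     = (\<Sum>p\<in>?P. \<Sum>q\<in>?P. of_int (sign p) * of_int (sign q) * t p q x)" for x
    unfolding slater_leibniz cnj_sum sum_product t_def prod.distrib
    by (intro sum.cong refl) (simp add: cnj_prod)
  have int: "integrable (\<Pi>\<^sub>M i\<in>{1..k}. \<nu>) (t p q)" if "p \<in> ?P" "q \<in> ?P" for p q
    unfolding t_def
    by (rule product_integrable_prod[where f = "\<lambda>i y. cnj (a (p (i - 1)) y) * b (q (i - 1)) y"])
      (use lt that in \<open>auto intro!: integrable_l2_product a b\<close>)
  have val: "(\<integral>x. t p q x \<partial>(\<Pi>\<^sub>M i\<in>{1..k}. \<nu>)) = (\<Prod>i=0..<k. G (p i) (q i))"
    if "p \<in> ?P" "q \<in> ?P" for p q
  proof -
    have "(\<integral>x. t p q x \<partial>(\<Pi>\<^sub>M i\<in>{1..k}. \<nu>)) = (\<Prod>i\<in>{1..k}. \<integral>y. cnj (a (p (i - 1)) y) * b (q (i - 1)) y \<partial>\<nu>)"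
      unfolding t_def
      by (rule product_integral_prod[where f = "\<lambda>i y. cnj (a (p (i - 1)) y) * b (q (i - 1)) y"])
        (use lt that in \<open>auto intro!: integrable_l2_product a b\<close>)
    also have "\<dots> = (\<Prod>i=0..<k. G (p i) (q i))"
      unfolding G_def l2_inner_def by (rule prod.reindex_bij_witness[of _ Suc "\<lambda>i. i - 1"]) auto
    finally show ?thesis .
  qed
  show ?I unfolding prod using int by (intro Bochner_Integration.integrable_sum integrable_mult_right) auto
  have row: "(\<Sum>q\<in>?P. of_int (sign p) * of_int (sign q) * (\<Prod>i=0..<k. G (p i) (q i))) = fdet k G"
    if p: "p \<in> ?P" for p
  proof -
    have e: "mat k k (\<lambda>(i, j). mat k k (\<lambda>(i, j). G i j) $$ (p i, j)) = mat k k (\<lambda>(i, j). G (p i) j)"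
      by (rule eq_matI) (use p in auto)
    have "of_int (sign p) * fdet k G = fdet k (\<lambda>i j. G (p i) j)"
      unfolding e[symmetric] by (rule Determinant.det_permute_rows[symmetric]) (use p in auto)
    also have "\<dots> = (\<Sum>q\<in>?P. of_int (sign q) * (\<Prod>i=0..<k. G (p i) (q i)))"
      by (subst Determinant.det_def'[of _ k]) (auto simp: intro!: sum.cong prod.cong)
    finally have "(\<Sum>q\<in>?P. of_int (sign p) * of_int (sign q) * (\<Prod>i=0..<k. G (p i) (q i)))
       = of_int (sign p) * (of_int (sign p) * fdet k G)"
      by (simp add: sum_distrib_left mult.assoc)
    also have "\<dots> = of_int (sign p * sign p) * fdet k G" by (simp only: of_int_mult mult.assoc)
    finally show ?thesis by (simp add: sign_idempotent)
  qed
  have "(\<integral>x. cnj (slater k a x) * slater k b x \<partial>(\<Pi>\<^sub>M i\<in>{1..k}. \<nu>))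
     = (\<Sum>p\<in>?P. \<Sum>q\<in>?P. of_int (sign p) * of_int (sign q) * (\<Prod>i=0..<k. G (p i) (q i)))"
    unfolding prod using int val
    by (subst Bochner_Integration.integral_sum, force intro!: Bochner_Integration.integrable_sum integrable_mult_right)
      (intro sum.cong refl, subst Bochner_Integration.integral_sum, auto intro!: integrable_mult_right)
  also have "\<dots> = (\<Sum>p\<in>?P. fdet k G)" using row by (intro sum.cong) auto
  also have "\<dots> = fact k * fdet k G"
    using card_permutations[of "{0..<k}" k] by simp
  finally show ?E unfolding G_def .
qed

lemma slater_normalised:
  assumes "sigma_finite_measure \<nu>" and a: "orthonormal_family \<nu> k a"
  shows "integrable (\<Pi>\<^sub>M i\<in>{1..k}. \<nu>) (\<lambda>x. (cmod (slater k a x))\<^sup>2)"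
    and "(\<integral>x. (cmod (slater k a x))\<^sup>2 \<partial>(\<Pi>\<^sub>M i\<in>{1..k}. \<nu>)) = fact k"
proof -
  have l: "\<And>j. j < k \<Longrightarrow> a j \<in> l2_space \<nu>" using a by (auto simp: orthonormal_family_def)
  have eq: "cnj (slater k a x) * slater k a x = of_real ((cmod (slater k a x))\<^sup>2)" for x
    using complex_norm_square[of "slater k a x"] by (simp only: mult.commute)
  note A = andreief[of \<nu> k a a, OF assms(1) l l, unfolded eq]
  from integrable_norm[OF A(1)]
  show "integrable (\<Pi>\<^sub>M i\<in>{1..k}. \<nu>) (\<lambda>x. (cmod (slater k a x))\<^sup>2)"
    by (simp add: norm_power)
  have "mat k k (\<lambda>(i, j). l2_inner \<nu> (a i) (a j)) = 1\<^sub>m k"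
    by (rule eq_matI) (use a in \<open>auto simp: orthonormal_family_def\<close>)
  then have "complex_of_real (\<integral>x. (cmod (slater k a x))\<^sup>2 \<partial>(\<Pi>\<^sub>M i\<in>{1..k}. \<nu>)) = of_real (fact k)"
    using A(2) by (simp only: integral_complex_of_real) simp
  then show "(\<integral>x. (cmod (slater k a x))\<^sup>2 \<partial>(\<Pi>\<^sub>M i\<in>{1..k}. \<nu>)) = fact k"
    by (simp only: of_real_eq_iff)
qed

text \<open>
  Passing from the Slater determinants to their moduli only increases the affinity:
  $\int |D_a||D_b| \ge |\int \overline{D_a} D_b| = k!\,|\det G|$.
\<close>

lemma slater_distance:
  assumes \<nu>: "sigma_finite_measure \<nu>" and a: "orthonormal_family \<nu> k a" and b: "orthonormal_family \<nu> k b"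
  shows "(\<integral>\<^sup>+ x. ennreal ((cmod (slater k a x) - cmod (slater k b x))\<^sup>2) \<partial>(\<Pi>\<^sub>M i\<in>{1..k}. \<nu>))
    \<le> ennreal (2 * fact k * (\<Sum>j<k. l2_dist2 \<nu> (a j) (b j)))"
proof -
  let ?M = "\<Pi>\<^sub>M i\<in>{1..k}. \<nu>"
  have al: "\<And>j. j < k \<Longrightarrow> a j \<in> l2_space \<nu>" and bl: "\<And>j. j < k \<Longrightarrow> b j \<in> l2_space \<nu>"
    using a b by (auto simp: orthonormal_family_def)
  note N = slater_normalised[OF \<nu> a] slater_normalised[OF \<nu> b]
  note A = andreief[of \<nu> k a b, OF \<nu> al bl]
  have int: "integrable ?M (\<lambda>x. cmod (slater k a x) * cmod (slater k b x))"
    using integrable_norm[OF A(1)] by (simp add: norm_mult)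
  have "fact k * cmod (fdet k (\<lambda>i j. l2_inner \<nu> (a i) (b j))) = cmod (\<integral>x. cnj (slater k a x) * slater k b x \<partial>?M)"
    using arg_cong[OF A(2), of cmod] by (simp add: norm_mult)
  also have "\<dots> \<le> (\<integral>x. cmod (slater k a x) * cmod (slater k b x) \<partial>?M)"
    using integral_norm_bound[of ?M "\<lambda>x. cnj (slater k a x) * slater k b x"] by (simp add: norm_mult)
  finally have low: "fact k * cmod (fdet k (\<lambda>i j. l2_inner \<nu> (a i) (b j)))
     \<le> (\<integral>x. cmod (slater k a x) * cmod (slater k b x) \<partial>?M)" .
  have eq: "(cmod (slater k a x) - cmod (slater k b x))\<^sup>2
     = (cmod (slater k a x))\<^sup>2 + (cmod (slater k b x))\<^sup>2 - 2 * (cmod (slater k a x) * cmod (slater k b x))" for x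
    by (simp add: power2_eq_square algebra_simps)
  have i2: "integrable ?M (\<lambda>x. (cmod (slater k a x) - cmod (slater k b x))\<^sup>2)"
    unfolding eq using N(1) N(3) int by simp
  have "(\<integral>x. (cmod (slater k a x) - cmod (slater k b x))\<^sup>2 \<partial>?M)
     = fact k + fact k - 2 * (\<integral>x. cmod (slater k a x) * cmod (slater k b x) \<partial>?M)"
    unfolding eq using N int by simp
  also have "\<dots> \<le> 2 * fact k * (1 - cmod (fdet k (\<lambda>i j. l2_inner \<nu> (a i) (b j))))"
    using low by (simp add: algebra_simps)
  also have "\<dots> \<le> 2 * fact k * (\<Sum>j<k. l2_dist2 \<nu> (a j) (b j))"
    by (intro mult_left_mono det_cross_gram_bound a b) auto
  finally show ?thesis
    by (subst nn_integral_eq_integral[OF i2]) (auto intro: ennreal_leI)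
qed

section \<open>The reference measure on configurations\<close>

lemma ennreal_suminf_swap:
  fixes f :: "nat \<Rightarrow> nat \<Rightarrow> ennreal"
  shows "(\<Sum>n. \<Sum>i. f n i) = (\<Sum>i. \<Sum>n. f n i)"
  using nn_integral_suminf[of f "count_space UNIV"] unfolding nn_integral_count_space_nat by simp

text \<open>
  A measurable subset of \<open>S\<close> that is largest up to null sets. The $\sigma$-finite measure is replaced by an
  equivalent finite measure \<open>N\<close>; the kernel is the union of a sequence of measurable subsets of \<open>S\<close> whose \<open>N\<close>-measures
  approach the supremum.
\<close>

lemma measurable_kernel:
  assumes "sigma_finite_measure M"
  shows "\<exists>K\<in>sets M. K \<subseteq> S \<and> (\<forall>A\<in>sets M. A \<subseteq> S \<longrightarrow> emeasure M (A - K) = 0)"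
proof -
  interpret sigma_finite_measure M by fact
  from Ex_finite_integrable_function obtain h where
    h [measurable]: "h \<in> borel_measurable M" and hfin: "integral\<^sup>N M h \<noteq> \<infinity>"
    and hpos: "\<And>x. x \<in> space M \<Longrightarrow> 0 < h x"
    by blast
  define N where "N = density M h"
  have [simp]: "sets N = sets M" "space N = space M" by (auto simp: N_def)
  have fin: "emeasure N A \<noteq> \<infinity>" for A
  proof -
    have "emeasure N A \<le> emeasure N (space N)" by (rule emeasure_space)
    also have "\<dots> = integral\<^sup>N M h"
      unfolding N_def by (subst emeasure_density) (auto intro!: nn_integral_cong)
    finally show ?thesis using hfin by (auto simp: top_unique)
  qed
  define \<A> where "\<A> = {A\<in>sets M. A \<subseteq> S}"
  have "{} \<in> \<A>" by (simp add: \<A>_def)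
  then obtain f :: "nat \<Rightarrow> ennreal" where f: "range f \<subseteq> emeasure N ` \<A>" "Sup (emeasure N ` \<A>) = Sup (range f)"
    using ennreal_SUP_countable_SUP[of \<A> "emeasure N"] by auto
  then have "\<forall>n. \<exists>A\<in>\<A>. f n = emeasure N A" by blast
  then obtain A where A: "\<And>n. A n \<in> \<A>" "\<And>n. f n = emeasure N (A n)" by metis
  define K where "K = (\<Union>n. A n)"
  have K: "K \<in> sets M" "K \<subseteq> S" using A(1) by (auto simp: K_def \<A>_def)
  have "emeasure M (B - K) = 0" if B: "B \<in> sets M" "B \<subseteq> S" for B
  proof -
    have "emeasure N (B \<union> K) \<le> Sup (emeasure N ` \<A>)"
      by (rule Sup_upper) (use B K in \<open>auto simp: \<A>_def\<close>)
    also have "\<dots> \<le> emeasure N K"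
      unfolding f(2) A(2) using A(1) K by (intro SUP_least emeasure_mono) (auto simp: K_def \<A>_def)
    finally have "emeasure N (B \<union> K) \<le> emeasure N K" .
    moreover have "emeasure N (B \<union> K) = emeasure N K + emeasure N (B - K)"
      using B K by (subst plus_emeasure) (auto intro!: arg_cong[where f = "emeasure N"])
    ultimately have "emeasure N K + emeasure N (B - K) \<le> emeasure N K + 0" by simp
    then have "emeasure N (B - K) \<le> 0" using fin[of K] by (metis ennreal_add_left_cancel_le infinity_ennreal_def)
    then have "(\<integral>\<^sup>+x. h x * indicator (B - K) x \<partial>M) = 0"
      unfolding N_def using B K by (subst (asm) emeasure_density) auto
    then have "AE x in M. h x * indicator (B - K) x = 0"
      using B K by (subst (asm) nn_integral_0_iff_AE) auto
    then have "AE x in M. x \<notin> B - K"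
    proof (rule AE_mp, intro AE_I2 impI notI)
      fix x assume "x \<in> space M" "h x * indicator (B - K) x = 0" "x \<in> B - K"
      then show False using hpos[of x] by auto
    qed
    then show ?thesis using B K by (subst (asm) AE_iff_measurable[of "B - K"]) (auto dest: sets.sets_into_space)
  qed
  then show ?thesis using K by blast
qed

lemma space_config_algebra [simp]: "space (config_algebra \<mu>) = configs \<mu>"
  unfolding config_algebra_def by (rule space_measure_of) auto

lemma sets_config_algebra:
  "sets (config_algebra \<mu>) = sigma_sets (configs \<mu>)
     {(\<lambda>\<alpha>. card (\<alpha> \<inter> B)) -` A \<inter> configs \<mu> | A B. B \<in> sets \<mu>}"
  unfolding config_algebra_def by (rule sets_measure_of) auto

lemma sets_config_measure [simp]: "sets (config_measure \<mu>) = sets (config_algebra \<mu>)"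
proof -
  have "sets (config_measure \<mu>) = sigma_sets (configs \<mu>) (sets (config_algebra \<mu>))"
    unfolding config_measure_def by (rule sets_measure_of) (use sets.space_closed[of "config_algebra \<mu>"] in simp)
  then show ?thesis using sets.sigma_sets_eq[of "config_algebra \<mu>"] by simp
qed

lemma space_config_measure [simp]: "space (config_measure \<mu>) = configs \<mu>"
  using sets_eq_imp_space_eq[OF sets_config_measure] by simp

lemma card_inter_measurable:
  assumes "B \<in> sets \<mu>"
  shows "(\<lambda>\<alpha>. card (\<alpha> \<inter> B)) \<in> measurable (config_algebra \<mu>) (count_space UNIV)"
proof (rule measurableI)
  fix A :: "nat set"
  show "(\<lambda>\<alpha>. card (\<alpha> \<inter> B)) -` A \<inter> space (config_algebra \<mu>) \<in> sets (config_algebra \<mu>)"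
    unfolding sets_config_algebra by (rule sigma_sets.Basic) (use assms in auto)
qed auto

lemma card_sets [measurable]: "{\<alpha>\<in>configs \<mu>. card \<alpha> = k} \<in> sets (config_algebra \<mu>)"
proof -
  have "(\<lambda>\<alpha>. card (\<alpha> \<inter> space \<mu>)) -` {k} \<inter> space (config_algebra \<mu>) \<in> sets (config_algebra \<mu>)"
    by (rule measurable_sets[OF card_inter_measurable]) auto
  moreover have "(\<lambda>\<alpha>. card (\<alpha> \<inter> space \<mu>)) -` {k} \<inter> space (config_algebra \<mu>) = {\<alpha>\<in>configs \<mu>. card \<alpha> = k}"
    by (auto simp: configs_def Int_absorb2)
  ultimately show ?thesis by simp
qed

text \<open>
  On tuples with distinct entries, the number of points of the image in $B$ is $\sum_i 1_B(x_i)$.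
\<close>

lemma tuple_image_measurable:
  assumes K: "K \<in> sets (\<Pi>\<^sub>M i\<in>{1..k}. \<mu>)" "K \<subseteq> {x. inj_on x {1..k::nat}}"
  shows "(\<lambda>x. x ` {1..k}) \<in> measurable (restrict_space (\<Pi>\<^sub>M i\<in>{1..k}. \<mu>) K) (config_algebra \<mu>)"
  unfolding config_algebra_def
proof (rule measurable_measure_of)
  let ?P = "\<Pi>\<^sub>M i\<in>{1..k}. \<mu>"
  have sp: "space (restrict_space ?P K) = K"
    using sets.sets_into_space[OF K(1)] by (auto simp: space_restrict_space)
  have Ks: "K \<subseteq> {1..k} \<rightarrow>\<^sub>E space \<mu>" using sets.sets_into_space[OF K(1)] by (simp add: space_PiM)
  show "(\<lambda>x. x ` {1..k}) \<in> space (restrict_space ?P K) \<rightarrow> configs \<mu>"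
    unfolding sp using Ks by (force simp: configs_def)
  show "{(\<lambda>\<alpha>. card (\<alpha> \<inter> B)) -` A \<inter> configs \<mu> |A B. B \<in> sets \<mu>} \<subseteq> Pow (configs \<mu>)" by auto
  fix y assume "y \<in> {(\<lambda>\<alpha>. card (\<alpha> \<inter> B)) -` A \<inter> configs \<mu> |A B. B \<in> sets \<mu>}"
  then obtain A B where y: "y = (\<lambda>\<alpha>. card (\<alpha> \<inter> B)) -` A \<inter> configs \<mu>" and B [measurable]: "B \<in> sets \<mu>"
    by auto
  define s where "s x = (\<Sum>i\<in>{1..k}. indicator B (x i) :: real)" for x :: "nat \<Rightarrow> _"
  have s: "s \<in> borel_measurable ?P"
    unfolding s_def
  proof (intro borel_measurable_sum)
    fix i assume "i \<in> {1..k}"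
    then show "(\<lambda>x. indicator B (x i) :: real) \<in> borel_measurable ?P"
      by (intro measurable_compose[OF measurable_component_singleton borel_measurable_indicator]) auto
  qed
  have cnt: "real (card (x ` {1..k} \<inter> B)) = s x" if "x \<in> K" for x
  proof -
    have inj: "inj_on x {1..k}" using K(2) that by auto
    have "x ` {1..k} \<inter> B = x ` {i\<in>{1..k}. x i \<in> B}" by auto
    then have "card (x ` {1..k} \<inter> B) = card {i\<in>{1..k}. x i \<in> B}"
      by (simp only:) (rule card_image, rule inj_on_subset[OF inj], auto)
    also have "real \<dots> = (\<Sum>i\<in>{i\<in>{1..k}. x i \<in> B}. 1)" by simp
    also have "\<dots> = s x"
      unfolding s_def by (rule sum.mono_neutral_cong_left) (auto simp: indicator_def)
    finally show ?thesis .
  qed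
  have "real ` A \<in> sets borel" by (rule sets.countable) simp_all
  then have "s -` (real ` A) \<inter> space ?P \<inter> K \<in> sets ?P" using s K(1) by (intro sets.Int measurable_sets)
  moreover have "(\<lambda>x. x ` {1..k}) -` y \<inter> K = s -` (real ` A) \<inter> space ?P \<inter> K"
  proof -
    have "x ` {1..k} \<in> y \<longleftrightarrow> s x \<in> real ` A" if "x \<in> K" for x
    proof -
      have "x ` {1..k} \<in> configs \<mu>" using Ks that by (force simp: configs_def)
      then have "x ` {1..k} \<in> y \<longleftrightarrow> card (x ` {1..k} \<inter> B) \<in> A" by (simp add: y)
      also have "\<dots> \<longleftrightarrow> s x \<in> real ` A" unfolding cnt[OF that, symmetric] by auto
      finally show ?thesis .
    qed
    then show ?thesis using sets.sets_into_space[OF K(1)] by auto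
  qed
  ultimately have "(\<lambda>x. x ` {1..k}) -` y \<inter> K \<in> sets ?P" by simp
  then show "(\<lambda>x. x ` {1..k}) -` y \<inter> space (restrict_space ?P K) \<in> sets (restrict_space ?P K)"
    unfolding sp by (subst sets_restrict_space_iff) (use K(1) sets.sets_into_space[OF K(1)] in \<open>auto simp: Int_absorb2\<close>)
qed

lemma sigma_finite_PiM:
  assumes "sigma_finite_measure \<mu>" "finite I"
  shows "sigma_finite_measure (\<Pi>\<^sub>M i\<in>I. \<mu>)"
proof -
  interpret product_sigma_finite "\<lambda>_. \<mu>"
    using assms(1) by (simp add: product_sigma_finite_def)
  show ?thesis by (rule sigma_finite) fact
qed

text \<open>
  If points are separated by countably many measurable sets, the kernel is, up to a null set, the set of all tuples
  with distinct entries.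
\<close>

definition distinct_kernel :: "'a measure \<Rightarrow> nat \<Rightarrow> (nat \<Rightarrow> 'a) set" where
  "distinct_kernel \<mu> k = (SOME K. K \<in> sets (\<Pi>\<^sub>M i\<in>{1..k}. \<mu>) \<and> K \<subseteq> {x. inj_on x {1..k}} \<and>
     (\<forall>A\<in>sets (\<Pi>\<^sub>M i\<in>{1..k}. \<mu>). A \<subseteq> {x. inj_on x {1..k}} \<longrightarrow>
        emeasure (\<Pi>\<^sub>M i\<in>{1..k}. \<mu>) (A - K) = 0))"

definition tuple_law :: "'a measure \<Rightarrow> nat \<Rightarrow> 'a set measure" where
  "tuple_law \<mu> k = distr (restrict_space (\<Pi>\<^sub>M i\<in>{1..k}. \<mu>) (distinct_kernel \<mu> k))
     (config_algebra \<mu>) (\<lambda>x. x ` {1..k})"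

lemma distinct_kernel:
  assumes "sigma_finite_measure \<mu>"
  shows "distinct_kernel \<mu> k \<in> sets (\<Pi>\<^sub>M i\<in>{1..k}. \<mu>)"
    and "distinct_kernel \<mu> k \<subseteq> {x. inj_on x {1..k}}"
    and "A \<in> sets (\<Pi>\<^sub>M i\<in>{1..k}. \<mu>) \<Longrightarrow> A \<subseteq> {x. inj_on x {1..k}} \<Longrightarrow>
        emeasure (\<Pi>\<^sub>M i\<in>{1..k}. \<mu>) (A - distinct_kernel \<mu> k) = 0"
  using someI_ex[OF measurable_kernel[OF sigma_finite_PiM[OF assms, of "{1..k}"], of "{x. inj_on x {1..k}}", unfolded Bex_def]]
  unfolding distinct_kernel_def[symmetric] by auto

text \<open>
  The integral of a function that is not measurable is a supremum over smaller simple functions, hence the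
  inner measure of \<open>F\<close>, and this is attained on the kernel.
\<close>

lemma nn_integral_indicator_kernel:
  assumes "K \<in> sets M" "K \<subseteq> S" "\<And>A. A \<in> sets M \<Longrightarrow> A \<subseteq> S \<Longrightarrow> emeasure M (A - K) = 0"
    and "K \<inter> F \<in> sets M" "F \<subseteq> S"
  shows "(\<integral>\<^sup>+x. indicator F x \<partial>M) = emeasure M (K \<inter> F)"
proof (rule antisym)
  have "emeasure M (K \<inter> F) = (\<integral>\<^sup>+x. indicator (K \<inter> F) x \<partial>M)"
    using assms by simp
  also have "\<dots> \<le> (\<integral>\<^sup>+x. indicator F x \<partial>M)"
    by (intro nn_integral_mono) (auto simp: indicator_def)
  finally show "emeasure M (K \<inter> F) \<le> (\<integral>\<^sup>+x. indicator F x \<partial>M)" .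
  show "(\<integral>\<^sup>+x. indicator F x \<partial>M) \<le> emeasure M (K \<inter> F)"
    unfolding nn_integral_def
  proof (rule SUP_least)
    fix g :: "_ \<Rightarrow> ennreal" assume "g \<in> {g. simple_function M g \<and> g \<le> indicator F}"
    then have g: "simple_function M g" and le: "\<And>x. g x \<le> indicator F x" by (auto simp: le_fun_def)
    define E where "E = {x\<in>space M. g x \<noteq> 0}"
    have [measurable]: "g \<in> borel_measurable M" using g by (rule borel_measurable_simple_function)
    have E: "E \<in> sets M" unfolding E_def by measurable
    have EF: "E \<subseteq> F"
    proof
      fix x assume "x \<in> E"
      then have "g x \<noteq> 0" by (simp add: E_def)
      then show "x \<in> F" using le[of x] by (cases "x \<in> F") auto
    qed
    have "integral\<^sup>S M g = (\<integral>\<^sup>+x. g x \<partial>M)" using g by (simp add: nn_integral_eq_simple_integral)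
    also have "\<dots> \<le> (\<integral>\<^sup>+x. indicator E x \<partial>M)"
    proof (intro nn_integral_mono)
      fix x assume "x \<in> space M"
      then show "g x \<le> indicator E x"
        using le[of x] by (cases "g x = 0"; cases "x \<in> F") (auto simp: E_def)
    qed
    also have "\<dots> = emeasure M E" using E by simp
    also have "\<dots> \<le> emeasure M ((E - K) \<union> (K \<inter> F))"
      using E EF assms by (intro emeasure_mono) auto
    also have "\<dots> \<le> emeasure M (E - K) + emeasure M (K \<inter> F)"
      using E assms by (intro emeasure_subadditive) auto
    also have "emeasure M (E - K) = 0" using E EF assms(3)[of E] assms(5) by auto
    finally show "integral\<^sup>S M g \<le> emeasure M (K \<inter> F)" by simp
  qed
qed

lemma sets_tuple_law [simp]: "sets (tuple_law \<mu> k) = sets (config_algebra \<mu>)"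
  by (simp add: tuple_law_def)

lemma space_tuple_law [simp]: "space (tuple_law \<mu> k) = configs \<mu>"
  by (simp add: tuple_law_def)

lemma emeasure_tuple_law:
  assumes \<mu>: "sigma_finite_measure \<mu>" and A: "A \<in> sets (config_algebra \<mu>)"
  shows "(\<integral>\<^sup>+ x. indicator {x. inj_on x {1..k}} x * indicator A (x ` {1..k}) \<partial>(\<Pi>\<^sub>M _\<in>{1..k}. \<mu>))
    = emeasure (tuple_law \<mu> k) A"
proof -
  let ?P = "\<Pi>\<^sub>M _\<in>{1..k}. \<mu>"
  note K = distinct_kernel[OF \<mu>, where k = k]
  define F where "F = {x. inj_on x {1..k} \<and> x ` {1..k} \<in> A}"
  have KP: "distinct_kernel \<mu> k \<inter> space ?P = distinct_kernel \<mu> k"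
    using sets.sets_into_space[OF K(1)] by auto
  have m: "(\<lambda>x. x ` {1..k}) \<in> measurable (restrict_space ?P (distinct_kernel \<mu> k)) (config_algebra \<mu>)"
    by (rule tuple_image_measurable[OF K(1,2)])
  have eq: "(\<lambda>x. x ` {1..k}) -` A \<inter> space (restrict_space ?P (distinct_kernel \<mu> k)) = distinct_kernel \<mu> k \<inter> F"
    using K(2) KP by (auto simp: space_restrict_space F_def)
  have "distinct_kernel \<mu> k \<inter> F \<in> sets (restrict_space ?P (distinct_kernel \<mu> k))"
    using measurable_sets[OF m A] unfolding eq .
  then have KF: "distinct_kernel \<mu> k \<inter> F \<in> sets ?P"
    by (subst (asm) sets_restrict_space_iff) (use K(1) KP in auto)
  have "emeasure (tuple_law \<mu> k) A = emeasure ?P (distinct_kernel \<mu> k \<inter> F)"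
    unfolding tuple_law_def using m A
    by (subst emeasure_distr, simp, simp, subst eq, subst emeasure_restrict_space) (use K(1) KP in auto)
  also have "\<dots> = (\<integral>\<^sup>+ x. indicator F x \<partial>?P)"
    by (rule nn_integral_indicator_kernel[OF K KF, symmetric]) (auto simp: F_def)
  also have "\<dots> = (\<integral>\<^sup>+ x. indicator {x. inj_on x {1..k}} x * indicator A (x ` {1..k}) \<partial>?P)"
    by (intro nn_integral_cong) (auto simp: F_def indicator_def)
  finally show ?thesis by simp
qed

lemma tuple_law_card:
  assumes \<mu>: "sigma_finite_measure \<mu>"
  shows "AE \<alpha> in tuple_law \<mu> k. card \<alpha> = k"
proof -
  note K = distinct_kernel[OF \<mu>, where k = k]
  have "card (x ` {1..k}) = k" if "x \<in> distinct_kernel \<mu> k" for x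
    using K(2) that card_image[of x "{1..k}"] by auto
  moreover have "{\<alpha> \<in> space (config_algebra \<mu>). card \<alpha> = k} \<in> sets (config_algebra \<mu>)" by simp
  ultimately show ?thesis
    unfolding tuple_law_def
    by (subst AE_distr_iff[OF tuple_image_measurable[OF K(1,2)]]) (auto simp: space_restrict_space)
qed

text \<open>
  The set function in the definition of the reference measure is countably additive, since by
  \<open>emeasure_tuple_law\<close> each of its terms is a measure. Hence the measure is given by this set function and is not the
  zero measure, the default value for a set function that is not a measure.
\<close>

lemma emeasure_config_measure:
  assumes \<mu>: "sigma_finite_measure \<mu>" and A: "A \<in> sets (config_algebra \<mu>)"
  shows "emeasure (config_measure \<mu>) A =
    indicator A {} + (\<Sum>i. ennreal (1 / fact (Suc i)) * emeasure (tuple_law \<mu> (Suc i)) A)"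
proof -
  define F where "F A = indicator A {} +
        (\<Sum>i. let k = Suc i in ennreal (1 / fact k) *
           (\<integral>\<^sup>+ x. indicator {x. inj_on x {1..k}} x * indicator A (x ` {1..k})
              \<partial>(\<Pi>\<^sub>M _\<in>{1..k}. \<mu>)))" for A
  have F: "F A = indicator A {} + (\<Sum>i. ennreal (1 / fact (Suc i)) * emeasure (tuple_law \<mu> (Suc i)) A)"
    if "A \<in> sets (config_algebra \<mu>)" for A
    unfolding F_def Let_def emeasure_tuple_law[OF \<mu> that] ..
  have "emeasure (measure_of (configs \<mu>) (sets (config_algebra \<mu>)) F) A = F A"
  proof (rule emeasure_measure_of_sigma[OF _ _ _ A])
    show "sigma_algebra (configs \<mu>) (sets (config_algebra \<mu>))"
      using sets.sigma_algebra_axioms[of "config_algebra \<mu>"] by simp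
    show "positive (sets (config_algebra \<mu>)) F" by (simp add: positive_def F)
    show "countably_additive (sets (config_algebra \<mu>)) F"
    proof (rule countably_additiveI)
      fix B :: "nat \<Rightarrow> _" assume B: "range B \<subseteq> sets (config_algebra \<mu>)" "disjoint_family B"
      have ind: "(\<Sum>n. indicator (B n) {}) = (indicator (\<Union>n. B n) {} :: ennreal)"
        by (rule suminf_indicator[OF B(2)])
      have "(\<Sum>n. F (B n)) = (\<Sum>n. indicator (B n) {} + (\<Sum>i. ennreal (1 / fact (Suc i)) * emeasure (tuple_law \<mu> (Suc i)) (B n)))"
        using B(1) by (intro suminf_cong F) auto
      also have "\<dots> = (\<Sum>n. indicator (B n) {}) + (\<Sum>n. \<Sum>i. ennreal (1 / fact (Suc i)) * emeasure (tuple_law \<mu> (Suc i)) (B n))"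
        by (rule suminf_add[symmetric]) auto
      also have "(\<Sum>n. \<Sum>i. ennreal (1 / fact (Suc i)) * emeasure (tuple_law \<mu> (Suc i)) (B n))
         = (\<Sum>i. \<Sum>n. ennreal (1 / fact (Suc i)) * emeasure (tuple_law \<mu> (Suc i)) (B n))"
        by (rule ennreal_suminf_swap)
      also have "\<dots> = (\<Sum>i. ennreal (1 / fact (Suc i)) * emeasure (tuple_law \<mu> (Suc i)) (\<Union>n. B n))"
        using B by (intro suminf_cong) (subst ennreal_suminf_cmult, subst suminf_emeasure, auto)
      finally show "(\<Sum>n. F (B n)) = F (\<Union>n. B n)"
        using B(1) F[of "\<Union>n. B n"] ind by (simp add: sets.countable_UN)
    qed
  qed
  then show ?thesis using F[OF A] unfolding config_measure_def F_def by simp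
qed

lemma emeasure_config_measure_empty:
  assumes \<mu>: "sigma_finite_measure \<mu>"
  shows "{{}} \<in> sets (config_measure \<mu>)" "emeasure (config_measure \<mu>) {{}} = 1"
proof -
  have eq: "{\<alpha>\<in>configs \<mu>. card \<alpha> = 0} = {{}}" by (auto simp: configs_def)
  show S: "{{}} \<in> sets (config_measure \<mu>)" using card_sets[of \<mu> 0] unfolding eq by simp
  have "emeasure (tuple_law \<mu> (Suc i)) {{}} = 0" for i
  proof -
    have "AE \<alpha> in tuple_law \<mu> (Suc i). \<alpha> \<notin> {{}}"
      using tuple_law_card[OF \<mu>, of "Suc i"] by eventually_elim auto
    then show ?thesis using S
      by (subst (asm) AE_iff_measurable[of "{{}}"]) (auto simp: configs_def)
  qed
  then show "emeasure (config_measure \<mu>) {{}} = 1"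
    using S by (subst emeasure_config_measure[OF \<mu>]) auto
qed

text \<open>
  Restricted to configurations of cardinality $k \ge 1$, the reference measure is $1/k!$ times the law of the images of
  tuples. Only an upper bound is stated, since the kernel may be smaller than the set of all tuples with distinct
  entries.
\<close>

lemma nn_integral_config_measure_card:
  assumes \<mu>: "sigma_finite_measure \<mu>" and k: "k \<ge> 1"
    and f: "f \<in> borel_measurable (config_algebra \<mu>)"
    and supp: "\<And>\<alpha>. \<alpha> \<in> configs \<mu> \<Longrightarrow> card \<alpha> \<noteq> k \<Longrightarrow> f \<alpha> = 0"
    and le: "\<And>x. x \<in> space (\<Pi>\<^sub>M _\<in>{1..k}. \<mu>) \<Longrightarrow> inj_on x {1..k} \<Longrightarrow> f (x ` {1..k}) \<le> F x"
  shows "(\<integral>\<^sup>+ \<alpha>. f \<alpha> \<partial>config_measure \<mu>) \<le> ennreal (1 / fact k) * (\<integral>\<^sup>+ x. F x \<partial>(\<Pi>\<^sub>M _\<in>{1..k}. \<mu>))"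
proof -
  let ?P = "\<Pi>\<^sub>M _\<in>{1..k}. \<mu>"
  note K = distinct_kernel[OF \<mu>, where k = k]
  define C where "C = {\<alpha>\<in>configs \<mu>. card \<alpha> = k}"
  have C [measurable]: "C \<in> sets (config_algebra \<mu>)" by (simp add: C_def card_sets)
  have C' [measurable]: "C \<in> sets (config_measure \<mu>)" using C by simp
  have f' [measurable]: "f \<in> borel_measurable (config_measure \<mu>)"
    using f by (simp cong: measurable_cong_sets)
  have "density (config_measure \<mu>) (indicator C) = scale_measure (ennreal (1 / fact k)) (tuple_law \<mu> k)"
  proof (rule measure_eqI)
    fix A assume "A \<in> sets (density (config_measure \<mu>) (indicator C))"
    then have A: "A \<in> sets (config_algebra \<mu>)" by simp
    have AC: "A \<inter> C \<in> sets (config_algebra \<mu>)" using A C by auto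
    have T: "emeasure (tuple_law \<mu> (Suc i)) (A \<inter> C) = (if Suc i = k then emeasure (tuple_law \<mu> k) A else 0)" for i
    proof -
      have "emeasure (tuple_law \<mu> (Suc i)) (A \<inter> C) = emeasure (tuple_law \<mu> (Suc i)) (if Suc i = k then A else {})"
      proof (rule emeasure_eq_AE)
        show "AE x in tuple_law \<mu> (Suc i). (x \<in> A \<inter> C) = (x \<in> (if Suc i = k then A else {}))"
          using tuple_law_card[OF \<mu>, of "Suc i"] AE_space
          by eventually_elim (auto simp: C_def)
      qed (use A AC in auto)
      then show ?thesis by auto
    qed
    have "emeasure (density (config_measure \<mu>) (indicator C)) A = emeasure (config_measure \<mu>) (A \<inter> C)"
    proof -
      have "emeasure (density (config_measure \<mu>) (indicator C)) A = (\<integral>\<^sup>+ x. indicator C x * indicator A x \<partial>config_measure \<mu>)"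
        by (rule emeasure_density) (use A C' in auto)
      also have "\<dots> = (\<integral>\<^sup>+ x. indicator (A \<inter> C) x \<partial>config_measure \<mu>)"
        by (intro nn_integral_cong) (auto simp: indicator_def)
      finally show ?thesis using AC by simp
    qed
    also have "\<dots> = indicator (A \<inter> C) {} + (\<Sum>i. ennreal (1 / fact (Suc i)) * (if Suc i = k then emeasure (tuple_law \<mu> k) A else 0))"
      unfolding emeasure_config_measure[OF \<mu> AC] T ..
    also have "indicator (A \<inter> C) {} = (0 :: ennreal)" using k by (simp add: C_def)
    also have "(\<Sum>i. ennreal (1 / fact (Suc i)) * (if Suc i = k then emeasure (tuple_law \<mu> k) A else 0))
        = (\<Sum>i\<in>{k - 1}. ennreal (1 / fact (Suc i)) * (if Suc i = k then emeasure (tuple_law \<mu> k) A else 0))"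
    proof (rule suminf_finite)
      fix i assume "i \<notin> {k - 1}"
      then have "Suc i \<noteq> k" by auto
      then show "ennreal (1 / fact (Suc i)) * (if Suc i = k then emeasure (tuple_law \<mu> k) A else 0) = 0"
        by (simp only: if_False mult_zero_right)
    qed simp
    also have "\<dots> = ennreal (1 / fact k) * emeasure (tuple_law \<mu> k) A"
    proof -
      have "Suc (k - 1) = k" using k by simp
      then show ?thesis by (simp only: sum.insert sum.empty finite.emptyI empty_iff not_False_eq_True add_0_right simp_thms if_True)
    qed
    finally show "emeasure (density (config_measure \<mu>) (indicator C)) A
        = emeasure (scale_measure (ennreal (1 / fact k)) (tuple_law \<mu> k)) A"
      by (simp only: emeasure_scale_measure add_0_left)
  qed simp
  note dens = this
  have "(\<integral>\<^sup>+ \<alpha>. f \<alpha> \<partial>config_measure \<mu>) = (\<integral>\<^sup>+ \<alpha>. indicator C \<alpha> * f \<alpha> \<partial>config_measure \<mu>)"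
    using supp by (intro nn_integral_cong) (auto simp: C_def indicator_def)
  also have "\<dots> = (\<integral>\<^sup>+ \<alpha>. f \<alpha> \<partial>density (config_measure \<mu>) (indicator C))"
    by (rule nn_integral_density[symmetric, OF borel_measurable_indicator[OF C'] f'])
  also have "\<dots> = ennreal (1 / fact k) * (\<integral>\<^sup>+ \<alpha>. f \<alpha> \<partial>tuple_law \<mu> k)"
    unfolding dens by (rule nn_integral_scale_measure) (use f in \<open>simp cong: measurable_cong_sets\<close>)
  also have "(\<integral>\<^sup>+ \<alpha>. f \<alpha> \<partial>tuple_law \<mu> k) = (\<integral>\<^sup>+ x. f (x ` {1..k}) \<partial>restrict_space ?P (distinct_kernel \<mu> k))"
    unfolding tuple_law_def by (rule nn_integral_distr[OF tuple_image_measurable[OF K(1,2)]]) (use f in simp)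
  also have "\<dots> = (\<integral>\<^sup>+ x. f (x ` {1..k}) * indicator (distinct_kernel \<mu> k) x \<partial>?P)"
    by (rule nn_integral_restrict_space) (use K(1) in auto)
  also have "\<dots> \<le> (\<integral>\<^sup>+ x. F x \<partial>?P)"
    using le K(2) by (intro nn_integral_mono) (auto simp: indicator_def)
  finally show ?thesis by (simp add: mult_left_mono)
qed

section \<open>Determinantal densities as functions of configurations\<close>

text \<open>
  The counts $|\alpha\cap B|$ are the sums of indicator functions; linearity and monotone limits give all other
  functions.
\<close>

lemma config_sum_measurable_ennreal:
  fixes g :: "'a \<Rightarrow> ennreal"
  assumes "g \<in> borel_measurable \<mu>"
  shows "(\<lambda>\<alpha>. \<Sum>x\<in>\<alpha>. g x) \<in> borel_measurable (config_algebra \<mu>)"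
  using assms
proof (induction rule: borel_measurable_induct)
  case (cong f g)
  have "(\<Sum>x\<in>\<alpha>. f x) = (\<Sum>x\<in>\<alpha>. g x)" if "\<alpha> \<in> space (config_algebra \<mu>)" for \<alpha>
    using that cong(3) by (intro sum.cong) (auto simp: configs_def)
  from iffD2[OF measurable_cong[OF this] cong(4)] show ?case .
next
  case (set B)
  have "(\<lambda>\<alpha>. of_nat (card (\<alpha> \<inter> B)) :: ennreal) \<in> borel_measurable (config_algebra \<mu>)"
    by (rule measurable_compose[OF card_inter_measurable[OF set]]) simp
  note card = this
  have "(\<Sum>x\<in>\<alpha>. indicator B x) = (of_nat (card (\<alpha> \<inter> B)) :: ennreal)"
    if "\<alpha> \<in> space (config_algebra \<mu>)" for \<alpha>
  proof -
    have "finite \<alpha>" using that by (simp add: configs_def)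
    then show ?thesis by (simp add: indicator_def sum.If_cases)
  qed
  from iffD2[OF measurable_cong[OF this] card] show ?case .
next
  case (mult u c)
  then show ?case by (simp flip: sum_distrib_left)
next
  case (add u v)
  then show ?case by (simp add: sum.distrib)
next
  case (seq U)
  have "(\<Sum>x\<in>\<alpha>. (SUP i. U i) x) = (SUP i. \<Sum>x\<in>\<alpha>. U i x)"
    if "\<alpha> \<in> space (config_algebra \<mu>)" for \<alpha>
  proof -
    have "finite \<alpha>" using that by (simp add: configs_def)
    then have "(\<Sum>x\<in>\<alpha>. (SUP i. U i x)) = (SUP i. \<Sum>x\<in>\<alpha>. U i x)"
      using nn_integral_monotone_convergence_SUP[of U "count_space \<alpha>"] seq(3)
      by (simp add: nn_integral_count_space_finite)
    then show ?thesis by (simp only: SUP_apply)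
  qed
  note sup = this
  have "(\<lambda>\<alpha>. SUP i. \<Sum>x\<in>\<alpha>. U i x) \<in> borel_measurable (config_algebra \<mu>)"
    by (rule borel_measurable_SUP) (use seq in auto)
  from iffD2[OF measurable_cong[OF sup] this] show ?case .
qed

lemma config_sum_measurable_real:
  fixes g :: "'a \<Rightarrow> real"
  assumes g [measurable]: "g \<in> borel_measurable \<mu>"
  shows "(\<lambda>\<alpha>. \<Sum>x\<in>\<alpha>. g x) \<in> borel_measurable (config_algebra \<mu>)"
proof -
  have p: "(\<lambda>\<alpha>. \<Sum>x\<in>\<alpha>. ennreal (g x)) \<in> borel_measurable (config_algebra \<mu>)"
    by (rule config_sum_measurable_ennreal) measurable
  have q: "(\<lambda>\<alpha>. \<Sum>x\<in>\<alpha>. ennreal (- g x)) \<in> borel_measurable (config_algebra \<mu>)"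
    by (rule config_sum_measurable_ennreal) measurable
  have "(\<lambda>\<alpha>. enn2real (\<Sum>x\<in>\<alpha>. ennreal (g x)) - enn2real (\<Sum>x\<in>\<alpha>. ennreal (- g x)))
     \<in> borel_measurable (config_algebra \<mu>)"
    by (intro borel_measurable_diff measurable_compose[OF p] measurable_compose[OF q]) auto
  moreover have "enn2real (\<Sum>x\<in>\<alpha>. ennreal (g x)) - enn2real (\<Sum>x\<in>\<alpha>. ennreal (- g x)) = (\<Sum>x\<in>\<alpha>. g x)"
    for \<alpha> :: "'a set"
  proof -
    have e: "enn2real (\<Sum>x\<in>\<alpha>. ennreal (f x)) = (\<Sum>x\<in>\<alpha>. max 0 (f x))" for f :: "'a \<Rightarrow> real"
    proof -
      have "(\<Sum>x\<in>\<alpha>. ennreal (f x)) = (\<Sum>x\<in>\<alpha>. ennreal (max 0 (f x)))"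
        by (intro sum.cong refl) (auto simp: max_def ennreal_neg)
      also have "\<dots> = ennreal (\<Sum>x\<in>\<alpha>. max 0 (f x))" by (rule sum_ennreal) simp
      finally show ?thesis by (simp add: sum_nonneg)
    qed
    show ?thesis unfolding e sum_subtractf[symmetric] by (intro sum.cong) (auto simp: max_def)
  qed
  ultimately show ?thesis by simp
qed

lemma config_sum_measurable:
  fixes g :: "'a \<Rightarrow> complex"
  assumes g [measurable]: "g \<in> borel_measurable \<mu>"
  shows "(\<lambda>\<alpha>. \<Sum>x\<in>\<alpha>. g x) \<in> borel_measurable (config_algebra \<mu>)"
proof -
  have r: "(\<lambda>\<alpha>. \<Sum>x\<in>\<alpha>. Re (g x)) \<in> borel_measurable (config_algebra \<mu>)"
    by (rule config_sum_measurable_real) measurable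
  have i: "(\<lambda>\<alpha>. \<Sum>x\<in>\<alpha>. Im (g x)) \<in> borel_measurable (config_algebra \<mu>)"
    by (rule config_sum_measurable_real) measurable
  have "(\<lambda>\<alpha>. complex_of_real (\<Sum>x\<in>\<alpha>. Re (g x)) + \<i> * complex_of_real (\<Sum>x\<in>\<alpha>. Im (g x)))
      \<in> borel_measurable (config_algebra \<mu>)"
    by (intro borel_measurable_add borel_measurable_times borel_measurable_const
        measurable_compose[OF r borel_measurable_of_real] measurable_compose[OF i borel_measurable_of_real])
  moreover have "complex_of_real (\<Sum>x\<in>\<alpha>. Re (g x)) + \<i> * complex_of_real (\<Sum>x\<in>\<alpha>. Im (g x)) = (\<Sum>x\<in>\<alpha>. g x)"
    for \<alpha> :: "'a set"
    by (simp add: complex_eq_iff)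
  ultimately show ?thesis by simp
qed

lemma fdet_measurable:
  assumes "\<And>i j. i < k \<Longrightarrow> j < k \<Longrightarrow> (\<lambda>\<alpha>. A \<alpha> i j) \<in> borel_measurable M"
  shows "(\<lambda>\<alpha>. fdet k (A \<alpha>)) \<in> borel_measurable M"
proof -
  have "fdet k (A \<alpha>) = (\<Sum>p | p permutes {0..<k}. of_int (sign p) * (\<Prod>i = 0..<k. A \<alpha> i (p i)))" for \<alpha>
    by (subst Determinant.det_def'[of _ k]) (auto intro!: sum.cong prod.cong)
  moreover have "(\<lambda>\<alpha>. \<Sum>p | p permutes {0..<k}. of_int (sign p) * (\<Prod>i = 0..<k. A \<alpha> i (p i))) \<in> borel_measurable M"
    by (intro borel_measurable_sum borel_measurable_times borel_measurable_prod borel_measurable_const assms) auto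
  ultimately show ?thesis by simp
qed

abbreviation nth_index :: "nat set \<Rightarrow> nat \<Rightarrow> nat" where
  "nth_index J c \<equiv> sorted_list_of_set J ! c"

lemma bij_betw_nth_index: "finite J \<Longrightarrow> bij_betw (nth_index J) {..<card J} J"
  by (rule bij_betw_nth) auto

lemma cmod_det_enumeration:
  assumes "bij_betw e {..<k} \<alpha>"
  shows "(cmod (fdet k (\<lambda>l j. g j (e l))))\<^sup>2 = Re (fdet k (\<lambda>i j. \<Sum>x\<in>\<alpha>. cnj (g i x) * g j x))"
proof -
  have "complex_of_real ((cmod (fdet k (\<lambda>l j. g j (e l))))\<^sup>2) = fdet k (\<lambda>i j. \<Sum>x\<in>\<alpha>. cnj (g i x) * g j x)"
    unfolding cmod_det_squared
    by (subst sum.reindex_bij_betw[OF assms, symmetric]) (rule refl)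
  then show ?thesis by (metis Re_complex_of_real)
qed

lemma det_density_gram:
  assumes "finite \<alpha>" "card \<alpha> = card J" "J \<noteq> {}"
  shows "det_density \<iota> \<Phi> J \<alpha> = Re (fdet (card J) (\<lambda>i j. \<Sum>x\<in>\<alpha>.
     cnj (\<Phi> (nth_index J i) (\<iota> x)) * \<Phi> (nth_index J j) (\<iota> x)))"
proof -
  define xs where "xs = (SOME xs. set xs = \<alpha> \<and> distinct xs)"
  have xs: "set xs = \<alpha>" "distinct xs"
    using someI_ex[OF finite_distinct_list[OF assms(1)]] by (auto simp: xs_def)
  then have "length xs = card J" using assms(2) distinct_card[of xs] by simp
  then have bij: "bij_betw (\<lambda>r. xs ! r) {..<card J} \<alpha>"
    using bij_betw_nth[OF xs(2)] xs(1) by simp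
  have "det_density \<iota> \<Phi> J \<alpha> = (cmod (fdet (card J) (\<lambda>r c. \<Phi> (nth_index J c) (\<iota> (xs ! r)))))\<^sup>2"
    using assms by (simp add: det_density_def det_matrix_def xs_def[symmetric] Let_def)
  also have "\<dots> = Re (fdet (card J) (\<lambda>i j. \<Sum>x\<in>\<alpha>.
     cnj (\<Phi> (nth_index J i) (\<iota> x)) * \<Phi> (nth_index J j) (\<iota> x)))"
    by (rule cmod_det_enumeration[OF bij, where g = "\<lambda>c x. \<Phi> (nth_index J c) (\<iota> x)"])
  finally show ?thesis .
qed

text \<open>
  By the Gram form, every enumeration of the configuration gives the same squared modulus, in particular the one
  by the tuple \<open>x\<close> itself.
\<close>

lemma det_density_image:
  assumes J: "finite J" "J \<noteq> {}" and x: "inj_on x {1..card J}"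
  shows "det_density \<iota> \<Phi> J (x ` {1..card J}) = (cmod (slater (card J) (\<lambda>c. \<Phi> (nth_index J c)) (\<lambda>i. \<iota> (x i))))\<^sup>2"
proof -
  have bij: "bij_betw (\<lambda>r. x (Suc r)) {..<card J} (x ` {1..card J})"
  proof (rule bij_betw_trans[of Suc _ "{1..card J}" x, unfolded comp_def])
    show "bij_betw Suc {..<card J} {1..card J}"
      by (rule bij_betwI[of _ _ _ "\<lambda>i. i - 1"]) auto
    show "bij_betw x {1..card J} (x ` {1..card J})" using x by (rule inj_on_imp_bij_betw)
  qed
  have "det_density \<iota> \<Phi> J (x ` {1..card J}) = Re (fdet (card J) (\<lambda>i j. \<Sum>y\<in>x ` {1..card J}.
     cnj (\<Phi> (nth_index J i) (\<iota> y)) * \<Phi> (nth_index J j) (\<iota> y)))"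
    by (rule det_density_gram) (use J x in \<open>auto simp: card_image\<close>)
  also have "\<dots> = (cmod (fdet (card J) (\<lambda>r c. \<Phi> (nth_index J c) (\<iota> (x (Suc r))))))\<^sup>2"
    by (rule cmod_det_enumeration[OF bij, where g = "\<lambda>c x. \<Phi> (nth_index J c) (\<iota> x)", symmetric])
  finally show ?thesis unfolding slater_def .
qed

lemma det_density_nonneg [simp]: "det_density \<iota> \<Phi> J \<alpha> \<ge> 0"
  by (simp add: det_density_def)

lemma det_density_measurable:
  assumes J: "finite J" and \<iota>: "\<iota> \<in> measurable \<mu> \<nu>" and \<Phi>: "\<And>j. j \<in> J \<Longrightarrow> \<Phi> j \<in> borel_measurable \<nu>"
  shows "det_density \<iota> \<Phi> J \<in> borel_measurable (config_algebra \<mu>)"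
proof (cases "J = {}")
  case True
  have "{\<alpha>\<in>configs \<mu>. card \<alpha> = 0} \<in> sets (config_algebra \<mu>)" by (rule card_sets)
  then have "(indicator {\<alpha>\<in>configs \<mu>. card \<alpha> = 0} :: _ \<Rightarrow> real) \<in> borel_measurable (config_algebra \<mu>)"
    by (rule borel_measurable_indicator)
  note ind = this
  have "det_density \<iota> \<Phi> J \<alpha> = indicator {\<alpha>\<in>configs \<mu>. card \<alpha> = 0} \<alpha>" if "\<alpha> \<in> space (config_algebra \<mu>)" for \<alpha>
    using that True by (auto simp: det_density_def configs_def)
  from iffD2[OF measurable_cong[OF this] ind] show ?thesis .
next
  case False
  define h where "h \<alpha> = Re (fdet (card J) (\<lambda>i j. \<Sum>x\<in>\<alpha>.
     cnj (\<Phi> (nth_index J i) (\<iota> x)) * \<Phi> (nth_index J j) (\<iota> x)))" for \<alpha>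
  have mem: "nth_index J i \<in> J" if "i < card J" for i
    using bij_betw_nth_index[OF J] that by (auto simp: bij_betw_def)
  have "h \<in> borel_measurable (config_algebra \<mu>)"
    unfolding h_def
    by (intro measurable_compose[OF fdet_measurable borel_measurable_Re] config_sum_measurable
        borel_measurable_times borel_measurable_cnj' measurable_compose[OF \<iota> \<Phi>] mem)
  moreover have "{\<alpha>\<in>configs \<mu>. card \<alpha> = card J} \<in> sets (config_algebra \<mu>)" by (rule card_sets)
  ultimately have "(\<lambda>\<alpha>. h \<alpha> * indicator {\<alpha>\<in>configs \<mu>. card \<alpha> = card J} \<alpha>) \<in> borel_measurable (config_algebra \<mu>)"
    by (intro borel_measurable_times borel_measurable_indicator)
  note prod = this
  have "det_density \<iota> \<Phi> J \<alpha> = h \<alpha> * indicator {\<alpha>\<in>configs \<mu>. card \<alpha> = card J} \<alpha>"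
    if "\<alpha> \<in> space (config_algebra \<mu>)" for \<alpha>
  proof (cases "card \<alpha> = card J")
    case True
    then show ?thesis using that False det_density_gram[of \<alpha> J \<iota> \<Phi>] by (simp add: h_def configs_def)
  next
    case ne: False
    then show ?thesis using False by (simp add: det_density_def)
  qed
  from iffD2[OF measurable_cong[OF this] prod] show ?thesis .
qed

text \<open>
  The identity on an infinite state space, and the inclusion of a finite one into the positive integers, satisfy
  this domination, with equality in the first case. In the second case mass outside the range of \<open>\<iota>\<close> is
  lost, and determinantal densities integrate to at most 1.
\<close>

locale embedding =
  fixes \<mu> :: "'a measure" and \<nu> :: "'b measure" and \<iota> :: "'a \<Rightarrow> 'b"
  assumes \<mu>: "sigma_finite_measure \<mu>" and \<nu>: "sigma_finite_measure \<nu>"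
    and \<iota> [measurable]: "\<iota> \<in> measurable \<mu> \<nu>"
    and dominated: "\<And>f. f \<in> borel_measurable \<nu> \<Longrightarrow> (\<integral>\<^sup>+x. f (\<iota> x) \<partial>\<mu>) \<le> (\<integral>\<^sup>+y. f y \<partial>\<nu>)"
begin

abbreviation L :: "'a set measure" where "L \<equiv> config_measure \<mu>"

text \<open>
  Fubini's theorem, replacing one coordinate at a time.
\<close>

lemma dominated_tuples:
  fixes I :: "nat set"
  assumes "finite I" "f \<in> borel_measurable (\<Pi>\<^sub>M i\<in>I. \<nu>)"
  shows "(\<integral>\<^sup>+x. f (\<lambda>i\<in>I. \<iota> (x i)) \<partial>(\<Pi>\<^sub>M i\<in>I. \<mu>)) \<le> (\<integral>\<^sup>+y. f y \<partial>(\<Pi>\<^sub>M i\<in>I. \<nu>))"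
  using assms
proof (induction I arbitrary: f rule: finite_induct)
  case empty
  interpret M: product_sigma_finite "\<lambda>_::nat. \<mu>" using \<mu> by (simp add: product_sigma_finite_def)
  interpret N: product_sigma_finite "\<lambda>_::nat. \<nu>" using \<nu> by (simp add: product_sigma_finite_def)
  show ?case unfolding PiM_empty by (simp add: nn_integral_count_space_finite restrict_def)
next
  case (insert i I)
  interpret M: product_sigma_finite "\<lambda>_::nat. \<mu>" using \<mu> by (simp add: product_sigma_finite_def)
  interpret N: product_sigma_finite "\<lambda>_::nat. \<nu>" using \<nu> by (simp add: product_sigma_finite_def)
  note [measurable] = insert.prems
  have r: "(\<lambda>x. \<lambda>j\<in>insert i I. \<iota> (x j)) \<in> measurable (\<Pi>\<^sub>M i\<in>insert i I. \<mu>) (\<Pi>\<^sub>M i\<in>insert i I. \<nu>)"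
    by (rule measurable_restrict, rule measurable_compose[OF _ \<iota>], rule measurable_component_singleton)
  have up [measurable]: "(\<lambda>(x, y). x(i := y)) \<in> measurable ((\<Pi>\<^sub>M i\<in>I. \<nu>) \<Otimes>\<^sub>M \<nu>) (\<Pi>\<^sub>M i\<in>insert i I. \<nu>)"
    using measurable_add_dim[of i I "\<lambda>_. \<nu>"] by simp
  have f2: "(\<lambda>(x, y). f (x(i := y))) \<in> borel_measurable ((\<Pi>\<^sub>M i\<in>I. \<nu>) \<Otimes>\<^sub>M \<nu>)"
    using measurable_comp[OF up insert.prems] by (simp add: comp_def case_prod_beta')
  have "(\<integral>\<^sup>+x. f (\<lambda>j\<in>insert i I. \<iota> (x j)) \<partial>(\<Pi>\<^sub>M i\<in>insert i I. \<mu>))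
      = (\<integral>\<^sup>+x. (\<integral>\<^sup>+y. f (\<lambda>j\<in>insert i I. \<iota> ((x(i := y)) j)) \<partial>\<mu>) \<partial>(\<Pi>\<^sub>M i\<in>I. \<mu>))"
    by (rule M.product_nn_integral_insert[OF insert.hyps]) (use measurable_comp[OF r insert.prems] in \<open>simp add: comp_def\<close>)
  also have "\<dots> = (\<integral>\<^sup>+x. (\<integral>\<^sup>+y. f ((\<lambda>j\<in>I. \<iota> (x j))(i := \<iota> y)) \<partial>\<mu>) \<partial>(\<Pi>\<^sub>M i\<in>I. \<mu>))"
  proof (intro nn_integral_cong arg_cong[where f = f] ext)
    fix x y j
    show "(\<lambda>j\<in>insert i I. \<iota> ((x(i := y)) j)) j = ((\<lambda>j\<in>I. \<iota> (x j))(i := \<iota> y)) j"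
      using insert.hyps(2) by auto
  qed
  also have "\<dots> \<le> (\<integral>\<^sup>+x. (\<integral>\<^sup>+y. f ((\<lambda>j\<in>I. \<iota> (x j))(i := y)) \<partial>\<nu>) \<partial>(\<Pi>\<^sub>M i\<in>I. \<mu>))"
  proof (intro nn_integral_mono dominated)
    fix x assume x: "x \<in> space (\<Pi>\<^sub>M i\<in>I. \<mu>)"
    then have "(\<lambda>j\<in>I. \<iota> (x j)) \<in> space (\<Pi>\<^sub>M i\<in>I. \<nu>)"
      using measurable_space[OF \<iota>] by (auto simp: space_PiM)
    from measurable_Pair2[OF f2 this]
    show "(\<lambda>y. f ((\<lambda>j\<in>I. \<iota> (x j))(i := y))) \<in> borel_measurable \<nu>" by simp
  qed
  also have "\<dots> \<le> (\<integral>\<^sup>+x. (\<integral>\<^sup>+y. f (x(i := y)) \<partial>\<nu>) \<partial>(\<Pi>\<^sub>M i\<in>I. \<nu>))"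
    by (rule insert.IH) (use sigma_finite_measure.borel_measurable_nn_integral_fst[OF \<nu> f2] in \<open>simp only: prod.case\<close>)
  also have "\<dots> = (\<integral>\<^sup>+y. f y \<partial>(\<Pi>\<^sub>M i\<in>insert i I. \<nu>))"
    by (rule N.product_nn_integral_insert[OF insert.hyps insert.prems, symmetric])
  finally show ?case .
qed

lemma slater_embedding: "slater k a (\<lambda>i. \<iota> (x i)) = slater k a (\<lambda>i\<in>{1..k}. \<iota> (x i))"
  unfolding slater_leibniz by (intro sum.cong refl arg_cong2[where f = "(*)"] prod.cong) auto

lemma orthonormal_subfamily:
  assumes "\<Phi> \<in> orthonormal_seqs \<nu>" "finite J" "J \<subseteq> {1..}"
  shows "orthonormal_family \<nu> (card J) (\<lambda>c. \<Phi> (nth_index J c))"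
proof -
  have mem: "nth_index J i \<in> J" if "i < card J" for i
    using bij_betw_nth_index[OF assms(2)] that by (auto simp: bij_betw_def)
  then have "nth_index J i \<ge> 1" if "i < card J" for i using assms(3) that by fastforce
  moreover have "nth_index J i = nth_index J j \<longleftrightarrow> i = j" if "i < card J" "j < card J" for i j
    using nth_eq_iff_index_eq[of "sorted_list_of_set J" i j] that by simp
  ultimately show ?thesis using assms(1) by (auto simp: orthonormal_family_def orthonormal_seqs_def)
qed

lemma det_density_measurable' [measurable]:
  assumes "\<Phi> \<in> orthonormal_seqs \<nu>" "finite J" "J \<subseteq> {1..}"
  shows "det_density \<iota> \<Phi> J \<in> borel_measurable (L)"
proof -
  have "\<Phi> j \<in> borel_measurable \<nu>" if "j \<in> J" for j
    using assms that by (auto simp: orthonormal_seqs_def l2_space_def)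
  then have "det_density \<iota> \<Phi> J \<in> borel_measurable (config_algebra \<mu>)"
    by (intro det_density_measurable[OF assms(2) \<iota>])
  then show ?thesis by (simp cong: measurable_cong_sets)
qed

text \<open>
  Integrals over configurations are bounded by integrals over tuples in the state space, and these by integrals over
  tuples in the space that carries the functions.
\<close>

lemma det_density_comparison:
  assumes J: "finite J" "J \<noteq> {}"
    and g: "g \<in> borel_measurable (L)" "\<And>\<alpha>. card \<alpha> \<noteq> card J \<Longrightarrow> g \<alpha> = 0"
    and le: "\<And>x. inj_on x {1..card J} \<Longrightarrow> g (x ` {1..card J}) \<le> G (\<lambda>i\<in>{1..card J}. \<iota> (x i))"
    and G: "G \<in> borel_measurable (\<Pi>\<^sub>M i\<in>{1..card J}. \<nu>)"
  shows "(\<integral>\<^sup>+ \<alpha>. g \<alpha> \<partial>L)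
    \<le> ennreal (1 / fact (card J)) * (\<integral>\<^sup>+ y. G y \<partial>(\<Pi>\<^sub>M i\<in>{1..card J}. \<nu>))"
proof -
  have "card J \<ge> 1" using J by (simp add: Suc_leI card_gt_0_iff)
  then have "(\<integral>\<^sup>+ \<alpha>. g \<alpha> \<partial>L)
     \<le> ennreal (1 / fact (card J)) * (\<integral>\<^sup>+ x. G (\<lambda>i\<in>{1..card J}. \<iota> (x i)) \<partial>(\<Pi>\<^sub>M i\<in>{1..card J}. \<mu>))"
    by (rule nn_integral_config_measure_card[OF \<mu>]) (use g le in \<open>auto cong: measurable_cong_sets\<close>)
  also have "\<dots> \<le> ennreal (1 / fact (card J)) * (\<integral>\<^sup>+ y. G y \<partial>(\<Pi>\<^sub>M i\<in>{1..card J}. \<nu>))"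
    by (intro mult_left_mono dominated_tuples G) auto
  finally show ?thesis .
qed

lemma orthonormal_measurable:
  assumes "orthonormal_family \<nu> k a"
  shows "slater k a \<in> borel_measurable (\<Pi>\<^sub>M i\<in>{1..k}. \<nu>)"
  using assms by (intro slater_measurable) (auto simp: orthonormal_family_def)

lemma det_density_mass:
  assumes "\<Phi> \<in> orthonormal_seqs \<nu>" "finite J" "J \<subseteq> {1..}"
  shows "(\<integral>\<^sup>+ \<alpha>. ennreal (det_density \<iota> \<Phi> J \<alpha>) \<partial>L) \<le> 1"
proof (cases "J = {}")
  case True
  have "(\<integral>\<^sup>+ \<alpha>. ennreal (det_density \<iota> \<Phi> J \<alpha>) \<partial>L) = (\<integral>\<^sup>+ \<alpha>. indicator {{}} \<alpha> \<partial>L)"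
    by (intro nn_integral_cong) (auto simp: True det_density_def)
  then show ?thesis using emeasure_config_measure_empty[OF \<mu>] by simp
next
  case False
  let ?a = "\<lambda>c. \<Phi> (nth_index J c)"
  note o = orthonormal_subfamily[OF assms]
  have [measurable]: "slater (card J) ?a \<in> borel_measurable (\<Pi>\<^sub>M i\<in>{1..card J}. \<nu>)"
    by (rule orthonormal_measurable[OF o])
  have "(\<integral>\<^sup>+ \<alpha>. ennreal (det_density \<iota> \<Phi> J \<alpha>) \<partial>L)
     \<le> ennreal (1 / fact (card J)) * (\<integral>\<^sup>+ y. ennreal ((cmod (slater (card J) ?a y))\<^sup>2) \<partial>(\<Pi>\<^sub>M i\<in>{1..card J}. \<nu>))"
  proof (rule det_density_comparison[OF assms(2) False])
    show "(\<lambda>\<alpha>. ennreal (det_density \<iota> \<Phi> J \<alpha>)) \<in> borel_measurable (L)"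
      using det_density_measurable'[OF assms] by simp
    show "ennreal (det_density \<iota> \<Phi> J \<alpha>) = 0" if "card \<alpha> \<noteq> card J" for \<alpha>
      using that False by (simp add: det_density_def)
    show "ennreal (det_density \<iota> \<Phi> J (x ` {1..card J}))
        \<le> ennreal ((cmod (slater (card J) ?a (\<lambda>i\<in>{1..card J}. \<iota> (x i))))\<^sup>2)" if "inj_on x {1..card J}" for x
      unfolding det_density_image[OF assms(2) False that] slater_embedding ..
  qed measurable
  also have "(\<integral>\<^sup>+ y. ennreal ((cmod (slater (card J) ?a y))\<^sup>2) \<partial>(\<Pi>\<^sub>M i\<in>{1..card J}. \<nu>)) = ennreal (fact (card J))"
    using slater_normalised[OF \<nu> o] by (subst nn_integral_eq_integral) auto
  also have "ennreal (1 / fact (card J)) * ennreal (fact (card J)) = 1"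
    by (simp flip: ennreal_mult)
  finally show ?thesis .
qed

lemma det_density_distance:
  assumes "\<Phi> \<in> orthonormal_seqs \<nu>" "\<Psi> \<in> orthonormal_seqs \<nu>" "finite J" "J \<subseteq> {1..}"
  shows "(\<integral>\<^sup>+ \<alpha>. ennreal ((sqrt (det_density \<iota> \<Phi> J \<alpha>) - sqrt (det_density \<iota> \<Psi> J \<alpha>))\<^sup>2) \<partial>L)
    \<le> ennreal (2 * (\<Sum>j\<in>J. l2_dist2 \<nu> (\<Phi> j) (\<Psi> j)))"
proof (cases "J = {}")
  case True
  then show ?thesis by (simp add: det_density_def)
next
  case False
  let ?a = "\<lambda>c. \<Phi> (nth_index J c)" and ?b = "\<lambda>c. \<Psi> (nth_index J c)"
  let ?d = "\<lambda>j. l2_dist2 \<nu> (\<Phi> j) (\<Psi> j)"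
  note a = orthonormal_subfamily[OF assms(1,3,4)]
  note b = orthonormal_subfamily[OF assms(2,3,4)]
  have [measurable]: "slater (card J) ?a \<in> borel_measurable (\<Pi>\<^sub>M i\<in>{1..card J}. \<nu>)"
     "slater (card J) ?b \<in> borel_measurable (\<Pi>\<^sub>M i\<in>{1..card J}. \<nu>)"
    by (intro orthonormal_measurable a b)+
  note [measurable] = det_density_measurable'[OF assms(1,3,4)] det_density_measurable'[OF assms(2,3,4)]
  have "(\<integral>\<^sup>+ \<alpha>. ennreal ((sqrt (det_density \<iota> \<Phi> J \<alpha>) - sqrt (det_density \<iota> \<Psi> J \<alpha>))\<^sup>2) \<partial>L)
    \<le> ennreal (1 / fact (card J)) *
      (\<integral>\<^sup>+ y. ennreal ((cmod (slater (card J) ?a y) - cmod (slater (card J) ?b y))\<^sup>2) \<partial>(\<Pi>\<^sub>M i\<in>{1..card J}. \<nu>))"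
  proof (rule det_density_comparison[OF assms(3) False])
    show "ennreal ((sqrt (det_density \<iota> \<Phi> J \<alpha>) - sqrt (det_density \<iota> \<Psi> J \<alpha>))\<^sup>2) = 0"
      if "card \<alpha> \<noteq> card J" for \<alpha>
      using that False by (simp add: det_density_def)
    show "ennreal ((sqrt (det_density \<iota> \<Phi> J (x ` {1..card J})) - sqrt (det_density \<iota> \<Psi> J (x ` {1..card J})))\<^sup>2)
        \<le> ennreal ((cmod (slater (card J) ?a (\<lambda>i\<in>{1..card J}. \<iota> (x i)))
            - cmod (slater (card J) ?b (\<lambda>i\<in>{1..card J}. \<iota> (x i))))\<^sup>2)" if "inj_on x {1..card J}" for x
      unfolding det_density_image[OF assms(3) False that] slater_embedding by simp
  qed measurable
  also have "\<dots> \<le> ennreal (1 / fact (card J)) * ennreal (2 * fact (card J) * (\<Sum>c<card J. ?d (nth_index J c)))"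
    by (intro mult_left_mono slater_distance[OF \<nu> a b]) auto
  also have "(\<Sum>c<card J. ?d (nth_index J c)) = (\<Sum>j\<in>J. ?d j)"
    by (rule sum.reindex_bij_betw[OF bij_betw_nth_index[OF assms(3)]])
  also have "ennreal (1 / fact (card J)) * ennreal (2 * fact (card J) * (\<Sum>j\<in>J. ?d j)) = ennreal (2 * (\<Sum>j\<in>J. ?d j))"
    by (subst ennreal_mult[symmetric]) (auto intro!: mult_nonneg_nonneg sum_nonneg)
  finally show ?thesis .
qed

end

section \<open>The law of the random index set\<close>

definition index_sets :: "nat set set" where
  "index_sets = {J. finite J \<and> J \<subseteq> {1..}}"

lemma Pow_index_sets: "Pow {1..m} \<subseteq> index_sets"
  by (auto simp: index_sets_def intro: finite_subset)

lemma index_sets_cofinal: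
  assumes "finite S" "S \<subseteq> index_sets"
  shows "\<exists>m. \<forall>N\<ge>m. S \<subseteq> Pow {1..N}"
proof -
  have "finite (\<Union>S)" using assms by (auto simp: index_sets_def)
  then obtain m where "\<Union>S \<subseteq> {..m}" by (auto simp: finite_nat_iff_bounded_le)
  moreover have "\<Union>S \<subseteq> {1..}" using assms by (auto simp: index_sets_def)
  ultimately have "S \<subseteq> Pow {1..N}" if "N \<ge> m" for N using that by fastforce
  then show ?thesis by blast
qed

text \<open>
  The law of a random subset of \<open>{1..m}\<close> that contains \<open>j\<close> with probability \<open>(lam j)\<^sup>2\<close>, independently for all
  \<open>j\<close>.
\<close>

definition finite_weight :: "(nat \<Rightarrow> real) \<Rightarrow> nat \<Rightarrow> nat set \<Rightarrow> real" where
  "finite_weight lam m J = (\<Prod>j\<in>J. (lam j)\<^sup>2) * (\<Prod>j\<in>{1..m} - J. 1 - (lam j)\<^sup>2)"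

definition tail_weight :: "(nat \<Rightarrow> real) \<Rightarrow> nat \<Rightarrow> real" where
  "tail_weight lam m = (\<Prod>j. if j \<le> m then 1 else 1 - (lam j)\<^sup>2)"

lemma LambdaD:
  assumes "lam \<in> Lambda" "j \<ge> 1"
  shows "0 \<le> lam j" "lam j \<le> 1" "(lam j)\<^sup>2 \<le> 1"
  using assms by (auto simp: Lambda_def intro: power_le_one)

lemma Lambda_summable:
  assumes "lam \<in> Lambda"
  shows "summable (\<lambda>j. if j = 0 then 0 else (lam j)\<^sup>2)"
proof (rule summable_on_imp_summable)
  have "(\<lambda>j. (lam j)\<^sup>2) summable_on {1..}" using assms by (simp add: Lambda_def)
  then show "(\<lambda>j. if j = 0 then 0 else (lam j)\<^sup>2) summable_on UNIV"
    by (rule summable_on_cong_neutral[THEN iffD1, rotated -1]) (auto simp: not_less_eq_eq)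
qed

lemma Lambda_convergent:
  assumes "lam \<in> Lambda" "0 \<in> S"
  shows "convergent_prod (\<lambda>j. if j \<in> S then 1 else 1 - (lam j)\<^sup>2)"
proof (rule abs_convergent_prod_imp_convergent_prod, unfold abs_convergent_prod_conv_summable)
  show "summable (\<lambda>i. norm ((if i \<in> S then 1 else 1 - (lam i)\<^sup>2) - 1))"
    by (rule summable_comparison_test'[OF Lambda_summable[OF assms(1)], of 0]) (use assms(2) in auto)
qed

lemma finite_weight_nonneg:
  assumes "lam \<in> Lambda" "J \<subseteq> {1..m}"
  shows "finite_weight lam m J \<ge> 0"
  unfolding finite_weight_def
  using LambdaD[OF assms(1)] by (intro mult_nonneg_nonneg prod_nonneg) auto

lemma finite_weight_sum: "(\<Sum>J\<in>Pow {1..m}. finite_weight lam m J) = 1"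
proof -
  have "(\<Sum>J\<in>Pow {1..m}. finite_weight lam m J) = (\<Prod>j\<in>{1..m}. (lam j)\<^sup>2 + (1 - (lam j)\<^sup>2))"
    unfolding finite_weight_def by (rule prod_add[symmetric]) simp
  then show ?thesis by simp
qed

text \<open>
  The infinite product may contain zero factors, so it is split as a product of two convergent products and not
  through logarithms or quotients.
\<close>

lemma index_weight_factor:
  assumes "lam \<in> Lambda" "J \<subseteq> {1..m}"
  shows "index_weight lam J = tail_weight lam m * finite_weight lam m J"
proof -
  let ?f = "\<lambda>j. if j = 0 \<or> j \<in> J then 1 else 1 - (lam j)\<^sup>2" and ?g = "\<lambda>j. if j \<le> m then 1 else 1 - (lam j)\<^sup>2"
  let ?h = "\<lambda>j. if j \<in> {1..m} - J then 1 - (lam j)\<^sup>2 else 1"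
  have "convergent_prod ?g" using Lambda_convergent[OF assms(1), of "{..m}"] by simp
  moreover have "?h has_prod (\<Prod>j\<in>{1..m} - J. 1 - (lam j)\<^sup>2)"
    by (rule has_prod_If_finite_set) simp
  ultimately have "prodinf ?h * prodinf ?g = (\<Prod>j. ?h j * ?g j)"
    by (intro prodinf_mult) (auto simp: has_prod_iff)
  also have "(\<lambda>j. ?h j * ?g j) = ?f" using assms(2) by (auto simp: fun_eq_iff)
  also have "prodinf ?h = (\<Prod>j\<in>{1..m} - J. 1 - (lam j)\<^sup>2)"
    using \<open>?h has_prod _\<close> by (simp add: has_prod_iff)
  finally show ?thesis unfolding index_weight_def tail_weight_def finite_weight_def by (simp add: mult_ac)
qed

lemma weierstrass_product:
  fixes f :: "nat \<Rightarrow> real"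
  assumes "finite A" "\<And>i. i \<in> A \<Longrightarrow> 0 \<le> f i \<and> f i \<le> 1"
  shows "1 - (\<Sum>i\<in>A. 1 - f i) \<le> (\<Prod>i\<in>A. f i)"
  using assms
proof (induction A rule: finite_induct)
  case (insert a A)
  have p: "(\<Prod>i\<in>A. f i) \<le> 1" "(\<Prod>i\<in>A. f i) \<ge> 0" 
    using insert.prems by (auto intro!: prod_le_1 prod_nonneg)
  have a: "0 \<le> f a" "f a \<le> 1" using insert.prems by auto
  \<comment> \<open>$xy \ge x + y - 1$ for $x, y \le 1$; the same step is used for the affinities.\<close>
  have "0 \<le> (1 - f a) * (1 - (\<Prod>i\<in>A. f i))" using p a by (intro mult_nonneg_nonneg) auto
  then have "f a + (\<Prod>i\<in>A. f i) - 1 \<le> f a * (\<Prod>i\<in>A. f i)" by (simp add: algebra_simps)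
  then show ?case using insert by (simp add: algebra_simps)
qed simp

lemma tail_weight_bounds:
  assumes "lam \<in> Lambda"
  shows "0 \<le> tail_weight lam m" "tail_weight lam m \<le> 1"
    "1 - (\<Sum>\<^sub>\<infinity>j\<in>{m<..}. (lam j)\<^sup>2) \<le> tail_weight lam m"
proof -
  let ?g = "\<lambda>j. if j \<le> m then 1 else 1 - (lam j)\<^sup>2"
  have "convergent_prod ?g" using Lambda_convergent[OF assms, of "{..m}"] by simp
  then have lim: "(\<lambda>N. \<Prod>j\<le>N. ?g j) \<longlonglongrightarrow> tail_weight lam m"
    unfolding tail_weight_def by (rule convergent_prod_LIMSEQ)
  have g: "0 \<le> ?g j" "?g j \<le> 1" for j using LambdaD[OF assms, of j] by (cases "j = 0"; simp)+
  show "0 \<le> tail_weight lam m" by (rule LIMSEQ_le_const[OF lim]) (use g in \<open>auto intro!: prod_nonneg\<close>)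
  show "tail_weight lam m \<le> 1" by (rule LIMSEQ_le_const2[OF lim]) (use g in \<open>auto intro!: prod_le_1\<close>)
  have "(\<lambda>j. (lam j)\<^sup>2) summable_on {1..}" using assms by (simp add: Lambda_def)
  then have s: "(\<lambda>j. (lam j)\<^sup>2) summable_on {m<..}" by (rule summable_on_subset_banach) auto
  have "1 - (\<Sum>\<^sub>\<infinity>j\<in>{m<..}. (lam j)\<^sup>2) \<le> (\<Prod>j\<le>N. ?g j)" for N
  proof -
    have "(\<Sum>j\<le>N. 1 - ?g j) = (\<Sum>j\<in>{m<..N}. (lam j)\<^sup>2)"
      by (rule sum.mono_neutral_cong_right) auto
    also have "\<dots> \<le> (\<Sum>\<^sub>\<infinity>j\<in>{m<..}. (lam j)\<^sup>2)"
      by (rule finite_sum_le_infsum[OF s]) auto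
    finally show ?thesis using weierstrass_product[of "{..N}" ?g] g by fastforce
  qed
  then show "1 - (\<Sum>\<^sub>\<infinity>j\<in>{m<..}. (lam j)\<^sup>2) \<le> tail_weight lam m"
    by (intro LIMSEQ_le_const[OF lim]) auto
qed

lemma index_weight_nonneg:
  assumes "lam \<in> Lambda" "J \<in> index_sets"
  shows "index_weight lam J \<ge> 0"
proof -
  obtain m where m: "J \<subseteq> {1..m}" using index_sets_cofinal[of "{J}"] assms(2) by auto
  show ?thesis unfolding index_weight_factor[OF assms(1) m]
    by (intro mult_nonneg_nonneg tail_weight_bounds finite_weight_nonneg assms(1) m)
qed

lemma index_weight_sum_le:
  assumes "lam \<in> Lambda"
  shows "(\<Sum>J\<in>Pow {1..m}. index_weight lam J) \<le> 1"
proof -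
  have "(\<Sum>J\<in>Pow {1..m}. index_weight lam J) = tail_weight lam m * (\<Sum>J\<in>Pow {1..m}. finite_weight lam m J)"
    unfolding sum_distrib_left by (intro sum.cong refl index_weight_factor assms) auto
  then show ?thesis using tail_weight_bounds[OF assms, of m] by (simp only: finite_weight_sum mult_1_right)
qed

lemma index_weight_truncated:
  assumes "kap \<in> Lambda" "\<And>i. i > m \<Longrightarrow> kap i = 0"
  shows "J \<subseteq> {1..m} \<Longrightarrow> index_weight kap J = finite_weight kap m J"
    and "J \<in> index_sets \<Longrightarrow> \<not> J \<subseteq> {1..m} \<Longrightarrow> index_weight kap J = 0"
proof -
  have "(\<lambda>j. if j \<le> m then 1 else 1 - (kap j)\<^sup>2) = (\<lambda>_. 1)" using assms(2) by auto
  then have "tail_weight kap m = 1" unfolding tail_weight_def by simp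
  then show "J \<subseteq> {1..m} \<Longrightarrow> index_weight kap J = finite_weight kap m J"
    using index_weight_factor[OF assms(1)] by simp
  assume "J \<in> index_sets" "\<not> J \<subseteq> {1..m}"
  then obtain j where "j \<in> J" "j > m" "finite J" by (force simp: index_sets_def)
  then have "(\<Prod>j\<in>J. (kap j)\<^sup>2) = 0" using assms(2) by (auto intro!: prod_zero)
  then show "index_weight kap J = 0" by (simp add: index_weight_def)
qed

text \<open>
  The squared distance of the square roots is at most $2(1-\rho)$, with the affinity
  $\rho = \sum_J \sqrt{p_J q_J}$. As $q$ charges only subsets of \<open>{1..m}\<close>, expanding the product gives
  $\rho = \sqrt t\,\prod_{i\le m} c_i$, with the tail factor $t$ of $p$ and the Bernoulli affinities
  $c_i = \lambda_i\kappa_i + \sqrt{1-\lambda_i^2}\sqrt{1-\kappa_i^2}$. The factor $3/2$ comes from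
  $2(1-c_i) = (\lambda_i-\kappa_i)^2 + (\sqrt{1-\lambda_i^2}-\sqrt{1-\kappa_i^2})^2$, where the second square is at most
  $|\lambda_i^2-\kappa_i^2|$.
\<close>

lemma weight_affinity:
  assumes lam: "lam \<in> Lambda" and kap: "kap \<in> Lambda" "\<And>i. i > m \<Longrightarrow> kap i = 0" and N: "m \<le> N"
  shows "(\<Sum>J\<in>Pow {1..N}. (sqrt (index_weight lam J) - sqrt (index_weight kap J))\<^sup>2)
    \<le> 2 * ((\<Sum>i=1..m. 3 / 2 * \<bar>lam i - kap i\<bar>) + (\<Sum>\<^sub>\<infinity>i\<in>{m<..}. (lam i)\<^sup>2))"
proof -
  let ?p = "index_weight lam" and ?q = "index_weight kap" and ?t = "tail_weight lam m"
  define c where "c i = lam i * kap i + sqrt (1 - (lam i)\<^sup>2) * sqrt (1 - (kap i)\<^sup>2)" for i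
  have p: "?p J \<ge> 0" "?q J \<ge> 0" if "J \<in> Pow {1..N}" for J
    using that Pow_index_sets index_weight_nonneg lam kap(1) by blast+
  have "(\<Sum>J\<in>Pow {1..m}. sqrt (?p J) * sqrt (?q J)) = sqrt ?t * (\<Prod>i\<in>{1..m}. c i)"
  proof -
    have "(\<Prod>i\<in>{1..m}. c i) = (\<Sum>J\<in>Pow {1..m}. (\<Prod>i\<in>J. lam i * kap i) *
        (\<Prod>i\<in>{1..m} - J. sqrt (1 - (lam i)\<^sup>2) * sqrt (1 - (kap i)\<^sup>2)))"
      unfolding c_def by (rule prod_add) simp
    then have "sqrt ?t * (\<Prod>i\<in>{1..m}. c i) = (\<Sum>J\<in>Pow {1..m}. sqrt ?t * ((\<Prod>i\<in>J. lam i * kap i) *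
        (\<Prod>i\<in>{1..m} - J. sqrt (1 - (lam i)\<^sup>2) * sqrt (1 - (kap i)\<^sup>2))))"
      by (simp only: sum_distrib_left)
    also have "\<dots> = (\<Sum>J\<in>Pow {1..m}. sqrt (?p J) * sqrt (?q J))"
    proof (rule sum.cong[OF refl])
      fix J assume J: "J \<in> Pow {1..m}"
      have sq: "sqrt (\<Prod>i\<in>A. f i) = (\<Prod>i\<in>A. sqrt (f i))" for A and f :: "nat \<Rightarrow> real"
        by (induction A rule: infinite_finite_induct) (auto simp: real_sqrt_mult)
      have pos: "lam i \<ge> 0" "kap i \<ge> 0" if "i \<in> J" for i
        using that J LambdaD(1)[OF lam, of i] LambdaD(1)[OF kap(1), of i] by auto
      have "sqrt (?p J) = sqrt ?t * ((\<Prod>i\<in>J. lam i) * (\<Prod>i\<in>{1..m} - J. sqrt (1 - (lam i)\<^sup>2)))"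
        using J pos by (simp add: index_weight_factor[OF lam, of J m] finite_weight_def real_sqrt_mult sq)
      moreover have "sqrt (?q J) = (\<Prod>i\<in>J. kap i) * (\<Prod>i\<in>{1..m} - J. sqrt (1 - (kap i)\<^sup>2))"
        using J pos by (simp add: index_weight_truncated[OF kap] finite_weight_def real_sqrt_mult sq)
      ultimately show "sqrt ?t * ((\<Prod>i\<in>J. lam i * kap i) *
        (\<Prod>i\<in>{1..m} - J. sqrt (1 - (lam i)\<^sup>2) * sqrt (1 - (kap i)\<^sup>2))) = sqrt (?p J) * sqrt (?q J)"
        by (simp only: prod.distrib mult.assoc mult.left_commute mult.commute)
    qed
    finally show ?thesis by simp
  qed
  moreover have "(\<Sum>J\<in>Pow {1..N}. sqrt (?p J) * sqrt (?q J)) = (\<Sum>J\<in>Pow {1..m}. sqrt (?p J) * sqrt (?q J))"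
  proof (rule sum.mono_neutral_right)
    show "\<forall>J\<in>Pow {1..N} - Pow {1..m}. sqrt (?p J) * sqrt (?q J) = 0"
    proof
      fix J assume J: "J \<in> Pow {1..N} - Pow {1..m}"
      then have "J \<in> index_sets" using Pow_index_sets by blast
      then have "?q J = 0" using J by (intro index_weight_truncated(2)[OF kap]) auto
      then show "sqrt (?p J) * sqrt (?q J) = 0" by simp
    qed
  qed (use N in auto)
  ultimately have aff: "(\<Sum>J\<in>Pow {1..N}. sqrt (?p J) * sqrt (?q J)) = sqrt ?t * (\<Prod>i\<in>{1..m}. c i)" by simp
  have c: "0 \<le> c i \<and> c i \<le> 1" "1 - c i \<le> 3 / 2 * \<bar>lam i - kap i\<bar>" if "i \<in> {1..m}" for i
  proof -
    define l k where "l = lam i" and "k = kap i"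
    have l: "0 \<le> l" "l \<le> 1" "l\<^sup>2 \<le> 1" and k: "0 \<le> k" "k \<le> 1" "k\<^sup>2 \<le> 1"
      using that LambdaD[OF lam, of i] LambdaD[OF kap(1), of i] by (auto simp: l_def k_def)
    define u v where "u = sqrt (1 - l\<^sup>2)" and "v = sqrt (1 - k\<^sup>2)"
    have u: "u\<^sup>2 = 1 - l\<^sup>2" "0 \<le> u" and v: "v\<^sup>2 = 1 - k\<^sup>2" "0 \<le> v"
      using l k by (auto simp: u_def v_def)
    have ci: "c i = l * k + u * v" by (simp add: c_def l_def k_def u_def v_def)
    have id: "2 * (1 - c i) = (l - k)\<^sup>2 + (u - v)\<^sup>2"
      using u(1) v(1) by (simp add: ci power2_eq_square algebra_simps)
    show "0 \<le> c i \<and> c i \<le> 1"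
    proof
      show "0 \<le> c i" using l k u v by (simp add: ci)
      have "0 \<le> 2 * (1 - c i)" unfolding id by simp
      then show "c i \<le> 1" by simp
    qed
    have "(l - k)\<^sup>2 \<le> \<bar>l - k\<bar>"
    proof -
      have "\<bar>l - k\<bar> \<le> 1" using l k by auto
      then have "\<bar>l - k\<bar> * \<bar>l - k\<bar> \<le> \<bar>l - k\<bar> * 1" by (intro mult_left_mono) auto
      then show ?thesis by (simp add: power2_eq_square)
    qed
    moreover have "(u - v)\<^sup>2 \<le> 2 * \<bar>l - k\<bar>"
    proof -
      have "(u - v)\<^sup>2 = \<bar>u - v\<bar> * \<bar>u - v\<bar>" by (simp add: power2_eq_square)
      also have "\<dots> \<le> \<bar>u - v\<bar> * (u + v)" using u v by (intro mult_left_mono) auto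
      also have "\<dots> = \<bar>(u - v) * (u + v)\<bar>" using u v by (simp add: abs_mult)
      also have "(u - v) * (u + v) = k\<^sup>2 - l\<^sup>2" using u(1) v(1) by (simp add: power2_eq_square algebra_simps)
      also have "\<dots> = (k - l) * (k + l)" by (simp add: power2_eq_square algebra_simps)
      also have "\<bar>(k - l) * (k + l)\<bar> = \<bar>l - k\<bar> * (k + l)" using l k by (simp add: abs_mult abs_minus_commute)
      also have "\<dots> \<le> \<bar>l - k\<bar> * 2" using l k by (intro mult_left_mono) auto
      finally show ?thesis by simp
    qed
    ultimately show "1 - c i \<le> 3 / 2 * \<bar>lam i - kap i\<bar>" using id by (simp add: l_def k_def)
  qed
  define P where "P = (\<Prod>i\<in>{1..m}. c i)"
  have P: "0 \<le> P" "P \<le> 1" unfolding P_def using c(1) by (auto intro!: prod_nonneg prod_le_1)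
  have P2: "1 - (\<Sum>i=1..m. 3 / 2 * \<bar>lam i - kap i\<bar>) \<le> P"
  proof -
    have "(\<Sum>i=1..m. 1 - c i) \<le> (\<Sum>i=1..m. 3 / 2 * \<bar>lam i - kap i\<bar>)" by (intro sum_mono c(2))
    moreover have "1 - (\<Sum>i=1..m. 1 - c i) \<le> P" unfolding P_def by (intro weierstrass_product c(1)) auto
    ultimately show ?thesis by linarith
  qed
  note t = tail_weight_bounds[OF lam, of m]
  have st: "?t \<le> sqrt ?t" using t by (intro real_le_rsqrt) (simp add: power2_eq_square mult_left_le)
  have st1: "sqrt ?t \<le> 1" using t by simp
  have "0 \<le> (1 - sqrt ?t) * (1 - P)" using P st1 by (intro mult_nonneg_nonneg) auto
  then have low: "sqrt ?t + P - 1 \<le> sqrt ?t * P" by (simp add: algebra_simps)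
  have "(\<Sum>J\<in>Pow {1..N}. (sqrt (?p J) - sqrt (?q J))\<^sup>2)
     = (\<Sum>J\<in>Pow {1..N}. ?p J + ?q J - 2 * (sqrt (?p J) * sqrt (?q J)))"
    using p by (intro sum.cong refl) (simp add: power2_diff)
  also have "\<dots> = (\<Sum>J\<in>Pow {1..N}. ?p J) + (\<Sum>J\<in>Pow {1..N}. ?q J) - 2 * (\<Sum>J\<in>Pow {1..N}. sqrt (?p J) * sqrt (?q J))"
    by (simp only: sum.distrib sum_subtractf sum_distrib_left)
  also have "\<dots> \<le> 1 + 1 - 2 * (sqrt ?t * P)"
    unfolding aff P_def[symmetric] using index_weight_sum_le[OF lam, of N] index_weight_sum_le[OF kap(1), of N] by linarith
  also have "\<dots> \<le> 2 * ((\<Sum>i=1..m. 3 / 2 * \<bar>lam i - kap i\<bar>) + (\<Sum>\<^sub>\<infinity>i\<in>{m<..}. (lam i)\<^sup>2))"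
    using low st t(3) P2 by argo
  finally show ?thesis .
qed

section \<open>Hellinger distance between determinantal mixtures\<close>

text \<open>
  The index sets are exhausted by the finite sets \<open>Pow {1..N}\<close>. If the limit is infinite, both sides are 0 by the
  default values of \<open>infsum\<close> and \<open>enn2real\<close>; so the equation holds everywhere and yields measurability.
\<close>

lemma infsum_index_sets:
  fixes a :: "nat set \<Rightarrow> real"
  assumes a: "\<And>J. J \<in> index_sets \<Longrightarrow> a J \<ge> 0"
  defines "T \<equiv> (SUP N. ennreal (\<Sum>J\<in>Pow {1..N}. a J))"
  shows "infsum a index_sets = enn2real T"
    and "T \<noteq> \<infinity> \<Longrightarrow> (\<lambda>N. \<Sum>J\<in>Pow {1..N}. a J) \<longlonglongrightarrow> infsum a index_sets"
proof -
  let ?S = "\<lambda>N. \<Sum>J\<in>Pow {1..N}. a J"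
  have le: "?S N \<le> infsum a index_sets" if "a summable_on index_sets" for N
    by (rule finite_sum_le_infsum[OF that]) (use Pow_index_sets a in auto)
  have nn: "?S N \<ge> 0" for N using Pow_index_sets[of N] a by (auto intro!: sum_nonneg)
  have fin: "a summable_on index_sets \<and> infsum a index_sets \<le> t" if t: "T = ennreal t" "t \<ge> 0" for t
  proof -
    have bd: "sum a S \<le> t" if S: "S \<subseteq> index_sets" "finite S" for S
    proof -
      obtain m where "S \<subseteq> Pow {1..m}" using index_sets_cofinal[OF S(2,1)] by blast
      then have "sum a S \<le> ?S m"
        using Pow_index_sets[of m] a by (intro sum_mono2) auto
      moreover have "ennreal (?S m) \<le> ennreal t" unfolding t(1)[symmetric] T_def by (rule SUP_upper) simp
      ultimately show ?thesis using t(2) by simp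
    qed
    have s: "a summable_on index_sets"
      by (rule nonneg_bdd_above_summable_on) (use a bd in \<open>auto intro!: bdd_aboveI[of _ t]\<close>)
    then show ?thesis using infsum_le_finite_sums[OF s, of t] bd by auto
  qed
  show 1: "infsum a index_sets = enn2real T"
  proof (cases T)
    case (real t)
    have "T \<le> ennreal (infsum a index_sets)"
      unfolding T_def by (intro SUP_least ennreal_leI le) (use fin[OF real(2,1)] in auto)
    then have "t \<le> infsum a index_sets"
      using real infsum_nonneg[of index_sets a] a by (simp add: ennreal_le_iff)
    then show ?thesis using fin[OF real(2,1)] real by simp
  next
    case top
    have "\<not> a summable_on index_sets"
    proof
      assume "a summable_on index_sets"
      then have "T \<le> ennreal (infsum a index_sets)" unfolding T_def by (intro SUP_least ennreal_leI le)
      then show False using top by (simp add: top_unique)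
    qed
    then show ?thesis using top by (simp add: infsum_not_exists)
  qed
  assume "T \<noteq> \<infinity>"
  then obtain t where t: "T = ennreal t" "t \<ge> 0" by (cases T) auto
  have "(\<lambda>N. ennreal (?S N)) \<longlonglongrightarrow> T"
    unfolding T_def
  proof (rule LIMSEQ_SUP)
    show "incseq (\<lambda>N. ennreal (?S N))"
    proof (intro incseq_SucI ennreal_leI sum_mono2)
      fix N J assume "J \<in> Pow {1..Suc N} - Pow {1..N}"
      then show "0 \<le> a J" using Pow_index_sets[of "Suc N"] a by blast
    qed (auto simp: subset_iff)
  qed
  then have "(\<lambda>N. ennreal (?S N)) \<longlonglongrightarrow> ennreal t" by (simp add: t)
  then have "?S \<longlonglongrightarrow> t" by (rule tendsto_ennrealD) (use t nn in auto)
  then show "?S \<longlonglongrightarrow> infsum a index_sets" using 1 t by simp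
qed

text \<open>
  The reverse triangle inequality for the Euclidean norms of the vectors of square roots.
\<close>

lemma sqrt_sum_diff_le:
  fixes a b :: "'i \<Rightarrow> real"
  assumes "finite S" "\<And>i. i \<in> S \<Longrightarrow> a i \<ge> 0" "\<And>i. i \<in> S \<Longrightarrow> b i \<ge> 0"
  shows "(sqrt (\<Sum>i\<in>S. a i) - sqrt (\<Sum>i\<in>S. b i))\<^sup>2 \<le> (\<Sum>i\<in>S. (sqrt (a i) - sqrt (b i))\<^sup>2)"
proof -
  have A: "(\<Sum>i\<in>S. a i) \<ge> 0" "(\<Sum>i\<in>S. b i) \<ge> 0" using assms by (auto intro: sum_nonneg)
  have "\<bar>\<Sum>i\<in>S. sqrt (a i) * sqrt (b i)\<bar> \<le> L2_set (\<lambda>i. sqrt (a i)) S * L2_set (\<lambda>i. sqrt (b i)) S"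
    using L2_set_mult_ineq[of "\<lambda>i. sqrt (a i)" "\<lambda>i. sqrt (b i)" S] assms(2,3)
    by (simp add: abs_mult sum_nonneg)
  moreover have "L2_set (\<lambda>i. sqrt (a i)) S = sqrt (\<Sum>i\<in>S. a i)" "L2_set (\<lambda>i. sqrt (b i)) S = sqrt (\<Sum>i\<in>S. b i)"
    unfolding L2_set_def using assms(2,3) by (auto intro!: arg_cong[where f = sqrt] sum.cong)
  ultimately have cs: "(\<Sum>i\<in>S. sqrt (a i) * sqrt (b i)) \<le> sqrt (\<Sum>i\<in>S. a i) * sqrt (\<Sum>i\<in>S. b i)" by simp
  have "(sqrt (\<Sum>i\<in>S. a i) - sqrt (\<Sum>i\<in>S. b i))\<^sup>2
     = (\<Sum>i\<in>S. a i) + (\<Sum>i\<in>S. b i) - 2 * (sqrt (\<Sum>i\<in>S. a i) * sqrt (\<Sum>i\<in>S. b i))"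
    using A by (simp add: power2_diff)
  also have "\<dots> \<le> (\<Sum>i\<in>S. a i) + (\<Sum>i\<in>S. b i) - 2 * (\<Sum>i\<in>S. sqrt (a i) * sqrt (b i))"
    using cs by simp
  also have "\<dots> = (\<Sum>i\<in>S. a i + b i - 2 * (sqrt (a i) * sqrt (b i)))"
    by (simp only: sum.distrib sum_subtractf sum_distrib_left)
  also have "\<dots> = (\<Sum>i\<in>S. (sqrt (a i) - sqrt (b i))\<^sup>2)"
    using assms(2,3) by (intro sum.cong refl) (simp add: power2_diff)
  finally show ?thesis .
qed

context embedding
begin

abbreviation partial_mixture :: "(nat \<Rightarrow> 'b \<Rightarrow> complex) \<Rightarrow> (nat \<Rightarrow> real) \<Rightarrow> nat \<Rightarrow> 'a set \<Rightarrow> real" where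
  "partial_mixture \<Phi> lam N \<alpha> \<equiv> \<Sum>J\<in>Pow {1..N}. index_weight lam J * det_density \<iota> \<Phi> J \<alpha>"

lemma partial_mixture_measurable:
  assumes "\<Phi> \<in> orthonormal_seqs \<nu>"
  shows "partial_mixture \<Phi> lam N \<in> borel_measurable (L)"
proof (intro borel_measurable_sum borel_measurable_times borel_measurable_const)
  fix J assume "J \<in> Pow {1..N}"
  then show "det_density \<iota> \<Phi> J \<in> borel_measurable (L)"
    using Pow_index_sets[of N] by (intro det_density_measurable' assms) (auto simp: index_sets_def)
qed

lemma mixed_det_density_limit:
  assumes "lam \<in> Lambda"
  shows "mixed_det_density \<iota> \<Phi> lam \<alpha> = enn2real (SUP N. ennreal (partial_mixture \<Phi> lam N \<alpha>))"
    and "(SUP N. ennreal (partial_mixture \<Phi> lam N \<alpha>)) \<noteq> \<infinity> \<Longrightarrow> (\<lambda>N. partial_mixture \<Phi> lam N \<alpha>) \<longlonglongrightarrow> mixed_det_density \<iota> \<Phi> lam \<alpha>"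
  using infsum_index_sets[of "\<lambda>J. index_weight lam J * det_density \<iota> \<Phi> J \<alpha>"]
    index_weight_nonneg[OF assms(1)]
  unfolding mixed_det_density_def index_sets_def[symmetric] by auto

lemma mixed_det_density_nonneg: "lam \<in> Lambda \<Longrightarrow> mixed_det_density \<iota> \<Phi> lam \<alpha> \<ge> 0"
  by (simp add: mixed_det_density_limit(1))

lemma mixed_det_density_measurable:
  assumes "\<Phi> \<in> orthonormal_seqs \<nu>" "lam \<in> Lambda"
  shows "mixed_det_density \<iota> \<Phi> lam \<in> borel_measurable (L)"
proof -
  note [measurable] = partial_mixture_measurable[OF assms(1)]
  have "(\<lambda>\<alpha>. enn2real (SUP N. ennreal (partial_mixture \<Phi> lam N \<alpha>))) \<in> borel_measurable (L)"
    by measurable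
  then show ?thesis by (simp only: mixed_det_density_limit(1)[OF assms(2), symmetric] eta_contract_eq)
qed

lemma mixture_total_mass:
  assumes "\<Phi> \<in> orthonormal_seqs \<nu>" "lam \<in> Lambda"
  shows "(\<integral>\<^sup>+\<alpha>. (SUP N. ennreal (partial_mixture \<Phi> lam N \<alpha>)) \<partial>L) \<le> 1"
proof -
  note [measurable] = partial_mixture_measurable[OF assms(1)]
  have w: "index_weight lam J \<ge> 0" if "J \<in> Pow {1..N}" for J N
    using that Pow_index_sets[of N] index_weight_nonneg[OF assms(2)] by blast
  have inc: "incseq (\<lambda>N \<alpha>. ennreal (partial_mixture \<Phi> lam N \<alpha>))"
  proof (intro incseq_SucI le_funI ennreal_leI sum_mono2)
    fix N J \<alpha> assume "J \<in> Pow {1..Suc N} - Pow {1..N}"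
    then show "0 \<le> index_weight lam J * det_density \<iota> \<Phi> J \<alpha>" using w[of J "Suc N"] by auto
  qed (auto simp: subset_iff)
  have "(\<integral>\<^sup>+\<alpha>. (SUP N. ennreal (partial_mixture \<Phi> lam N \<alpha>)) \<partial>L)
     = (SUP N. \<integral>\<^sup>+\<alpha>. ennreal (partial_mixture \<Phi> lam N \<alpha>) \<partial>L)"
    by (rule nn_integral_monotone_convergence_SUP[OF inc]) measurable
  also have "\<dots> \<le> 1"
  proof (rule SUP_least)
    fix N
    have d: "det_density \<iota> \<Phi> J \<in> borel_measurable (L)"
      "(\<integral>\<^sup>+\<alpha>. ennreal (det_density \<iota> \<Phi> J \<alpha>) \<partial>L) \<le> 1" if "J \<in> Pow {1..N}" for J
      using that Pow_index_sets[of N] det_density_measurable'[OF assms(1), of J] det_density_mass[OF assms(1), of J]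
      by (auto simp: index_sets_def)
    have "(\<integral>\<^sup>+\<alpha>. ennreal (partial_mixture \<Phi> lam N \<alpha>) \<partial>L)
      = (\<integral>\<^sup>+\<alpha>. (\<Sum>J\<in>Pow {1..N}. ennreal (index_weight lam J) * ennreal (det_density \<iota> \<Phi> J \<alpha>)) \<partial>L)"
    proof (intro nn_integral_cong)
      fix \<alpha>
      have "ennreal (partial_mixture \<Phi> lam N \<alpha>) = (\<Sum>J\<in>Pow {1..N}. ennreal (index_weight lam J * det_density \<iota> \<Phi> J \<alpha>))"
        by (rule sum_ennreal[symmetric]) (use w[of _ N] in auto)
      also have "\<dots> = (\<Sum>J\<in>Pow {1..N}. ennreal (index_weight lam J) * ennreal (det_density \<iota> \<Phi> J \<alpha>))"
        by (intro sum.cong refl ennreal_mult w[of _ N] det_density_nonneg)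
      finally show "ennreal (partial_mixture \<Phi> lam N \<alpha>)
         = (\<Sum>J\<in>Pow {1..N}. ennreal (index_weight lam J) * ennreal (det_density \<iota> \<Phi> J \<alpha>))" .
    qed
    also have "\<dots> = (\<Sum>J\<in>Pow {1..N}. ennreal (index_weight lam J) * (\<integral>\<^sup>+\<alpha>. ennreal (det_density \<iota> \<Phi> J \<alpha>) \<partial>L))"
      using d(1) by (subst nn_integral_sum) (auto intro!: sum.cong nn_integral_cmult)
    also have "\<dots> \<le> (\<Sum>J\<in>Pow {1..N}. ennreal (index_weight lam J) * 1)"
      using d(2) by (intro sum_mono mult_left_mono) auto
    also have "\<dots> = ennreal (\<Sum>J\<in>Pow {1..N}. index_weight lam J)"
      unfolding mult_1_right by (rule sum_ennreal) (use w[of _ N] in auto)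
    also have "\<dots> \<le> 1" using index_weight_sum_le[OF assms(2), of N] by (simp add: ennreal_le_1)
    finally show "(\<integral>\<^sup>+\<alpha>. ennreal (partial_mixture \<Phi> lam N \<alpha>) \<partial>L) \<le> 1" .
  qed
  finally show ?thesis .
qed

lemma mixed_det_density_mass:
  assumes "\<Phi> \<in> orthonormal_seqs \<nu>" "lam \<in> Lambda"
  shows "(\<integral>\<^sup>+\<alpha>. ennreal (mixed_det_density \<iota> \<Phi> lam \<alpha>) \<partial>L) \<le> 1"
proof -
  have "(\<integral>\<^sup>+\<alpha>. ennreal (mixed_det_density \<iota> \<Phi> lam \<alpha>) \<partial>L)
     \<le> (\<integral>\<^sup>+\<alpha>. (SUP N. ennreal (partial_mixture \<Phi> lam N \<alpha>)) \<partial>L)"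
    unfolding mixed_det_density_limit(1)[OF assms(2)] by (intro nn_integral_mono) (simp add: ennreal_enn2real_if)
  then show ?thesis using mixture_total_mass[OF assms] by simp
qed

lemma mixture_converges_AE:
  assumes "\<Phi> \<in> orthonormal_seqs \<nu>" "lam \<in> Lambda"
  shows "AE \<alpha> in L. (\<lambda>N. partial_mixture \<Phi> lam N \<alpha>) \<longlonglongrightarrow> mixed_det_density \<iota> \<Phi> lam \<alpha>"
proof -
  note [measurable] = partial_mixture_measurable[OF assms(1)]
  have "AE \<alpha> in L. (SUP N. ennreal (partial_mixture \<Phi> lam N \<alpha>)) \<noteq> \<infinity>"
  proof (rule nn_integral_PInf_AE)
    show "(\<integral>\<^sup>+\<alpha>. (SUP N. ennreal (partial_mixture \<Phi> lam N \<alpha>)) \<partial>L) \<noteq> \<infinity>"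
      using mixture_total_mass[OF assms] by (auto simp: top_unique)
  qed measurable
  then show ?thesis by eventually_elim (rule mixed_det_density_limit(2)[OF assms(2)])
qed

text \<open>
  The weights and the densities are exchanged one after the other, at the price of a factor 2.
\<close>

lemma component_distance:
  assumes "\<Phi> \<in> orthonormal_seqs \<nu>" "\<Psi> \<in> orthonormal_seqs \<nu>" "J \<in> index_sets" "p \<ge> 0" "q \<ge> 0"
  shows "(\<integral>\<^sup>+\<alpha>. ennreal ((sqrt (p * det_density \<iota> \<Phi> J \<alpha>) - sqrt (q * det_density \<iota> \<Psi> J \<alpha>))\<^sup>2) \<partial>L)
    \<le> ennreal (2 * (sqrt p - sqrt q)\<^sup>2 + 4 * q * (\<Sum>j\<in>J. l2_dist2 \<nu> (\<Phi> j) (\<Psi> j)))"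
proof -
  have J: "finite J" "J \<subseteq> {1..}" using assms(3) by (auto simp: index_sets_def)
  note [measurable] = det_density_measurable'[OF assms(1) J] det_density_measurable'[OF assms(2) J]
  let ?u = "det_density \<iota> \<Phi> J" and ?v = "det_density \<iota> \<Psi> J"
  let ?s = "\<Sum>j\<in>J. l2_dist2 \<nu> (\<Phi> j) (\<Psi> j)"
  have pw: "(sqrt (p * ?u \<alpha>) - sqrt (q * ?v \<alpha>))\<^sup>2
      \<le> 2 * (sqrt p - sqrt q)\<^sup>2 * ?u \<alpha> + 2 * q * (sqrt (?u \<alpha>) - sqrt (?v \<alpha>))\<^sup>2" for \<alpha>
  proof -
    have sq: "(x + y)\<^sup>2 \<le> 2 * x\<^sup>2 + 2 * y\<^sup>2" for x y :: real
      using sum_squares_bound[of x y] by (simp add: power2_sum)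
    have "sqrt (p * ?u \<alpha>) - sqrt (q * ?v \<alpha>) = (sqrt p - sqrt q) * sqrt (?u \<alpha>) + sqrt q * (sqrt (?u \<alpha>) - sqrt (?v \<alpha>))"
      by (simp add: real_sqrt_mult algebra_simps)
    then have "(sqrt (p * ?u \<alpha>) - sqrt (q * ?v \<alpha>))\<^sup>2
      \<le> 2 * ((sqrt p - sqrt q) * sqrt (?u \<alpha>))\<^sup>2 + 2 * (sqrt q * (sqrt (?u \<alpha>) - sqrt (?v \<alpha>)))\<^sup>2"
      by (simp only: sq)
    then show ?thesis using assms(4,5) by (simp add: power_mult_distrib)
  qed
  have "(\<integral>\<^sup>+\<alpha>. ennreal ((sqrt (p * ?u \<alpha>) - sqrt (q * ?v \<alpha>))\<^sup>2) \<partial>L)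
    \<le> (\<integral>\<^sup>+\<alpha>. ennreal (2 * (sqrt p - sqrt q)\<^sup>2) * ennreal (?u \<alpha>)
        + ennreal (2 * q) * ennreal ((sqrt (?u \<alpha>) - sqrt (?v \<alpha>))\<^sup>2) \<partial>L)"
    using pw assms(5) by (intro nn_integral_mono) (simp flip: ennreal_mult ennreal_plus)
  also have "\<dots> = ennreal (2 * (sqrt p - sqrt q)\<^sup>2) * (\<integral>\<^sup>+\<alpha>. ennreal (?u \<alpha>) \<partial>L)
      + ennreal (2 * q) * (\<integral>\<^sup>+\<alpha>. ennreal ((sqrt (?u \<alpha>) - sqrt (?v \<alpha>))\<^sup>2) \<partial>L)"
    by (subst nn_integral_add) (auto simp: nn_integral_cmult)
  also have "\<dots> \<le> ennreal (2 * (sqrt p - sqrt q)\<^sup>2) * 1 + ennreal (2 * q) * ennreal (2 * ?s)"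
    by (intro add_mono mult_left_mono det_density_mass det_density_distance assms J) auto
  also have "\<dots> = ennreal (2 * (sqrt p - sqrt q)\<^sup>2 + 4 * q * ?s)"
    using assms(5) by (simp add: sum_nonneg algebra_simps flip: ennreal_mult ennreal_plus)
  finally show ?thesis .
qed

text \<open>
  For the partial mixtures, the reverse triangle inequality in $\ell_2$ reduces the claim to the single components. The
  bound does not depend on the number of components, and Fatou's lemma gives the limit.
\<close>

lemma mixture_distance:
  assumes \<Phi>: "\<Phi> \<in> orthonormal_seqs \<nu>" and \<Psi>: "\<Psi> \<in> orthonormal_seqs \<nu>"
    and lam: "lam \<in> Lambda" and kap: "kap \<in> Lambda" "\<And>i. i > m \<Longrightarrow> kap i = 0"
  shows "(\<integral>\<^sup>+\<alpha>. ennreal ((sqrt (mixed_det_density \<iota> \<Phi> lam \<alpha>) - sqrt (mixed_det_density \<iota> \<Psi> kap \<alpha>))\<^sup>2) \<partial>L)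
    \<le> ennreal (4 * (\<Sum>\<^sub>\<infinity>i\<in>{m<..}. (lam i)\<^sup>2)
        + (\<Sum>i=1..m. 6 * \<bar>lam i - kap i\<bar> + 4 * l2_dist2 \<nu> (\<Phi> i) (\<Psi> i)))"
proof -
  let ?M = "L" and ?d = "\<lambda>i. l2_dist2 \<nu> (\<Phi> i) (\<Psi> i)"
  let ?p = "index_weight lam" and ?q = "index_weight kap"
  let ?B = "4 * (\<Sum>\<^sub>\<infinity>i\<in>{m<..}. (lam i)\<^sup>2) + (\<Sum>i=1..m. 6 * \<bar>lam i - kap i\<bar> + 4 * ?d i)"
  define f where "f N \<alpha> = ennreal ((sqrt (partial_mixture \<Phi> lam N \<alpha>) - sqrt (partial_mixture \<Psi> kap N \<alpha>))\<^sup>2)" for N \<alpha>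
  note [measurable] = partial_mixture_measurable[OF \<Phi>] partial_mixture_measurable[OF \<Psi>]
  have fm: "f N \<in> borel_measurable ?M" for N unfolding f_def by measurable
  have bound: "(\<integral>\<^sup>+\<alpha>. f N \<alpha> \<partial>?M) \<le> ennreal ?B" if N: "m \<le> N" for N
  proof -
    have p: "?p J \<ge> 0" "?q J \<ge> 0" "J \<in> index_sets" if "J \<in> Pow {1..N}" for J
      using that Pow_index_sets[of N] index_weight_nonneg lam kap(1) by blast+
    let ?g = "\<lambda>J \<alpha>. ennreal ((sqrt (?p J * det_density \<iota> \<Phi> J \<alpha>) - sqrt (?q J * det_density \<iota> \<Psi> J \<alpha>))\<^sup>2)"
    have gm: "?g J \<in> borel_measurable ?M" if "J \<in> Pow {1..N}" for J
    proof -
      have J: "finite J" "J \<subseteq> {1..}" using p(3)[OF that] by (auto simp: index_sets_def)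
      note [measurable] = det_density_measurable'[OF \<Phi> J] det_density_measurable'[OF \<Psi> J]
      show ?thesis by measurable
    qed
    have "(\<integral>\<^sup>+\<alpha>. f N \<alpha> \<partial>?M) \<le> (\<integral>\<^sup>+\<alpha>. (\<Sum>J\<in>Pow {1..N}. ?g J \<alpha>) \<partial>?M)"
    proof (intro nn_integral_mono)
      fix \<alpha>
      have "f N \<alpha> \<le> ennreal (\<Sum>J\<in>Pow {1..N}. (sqrt (?p J * det_density \<iota> \<Phi> J \<alpha>) - sqrt (?q J * det_density \<iota> \<Psi> J \<alpha>))\<^sup>2)"
        unfolding f_def by (intro ennreal_leI sqrt_sum_diff_le mult_nonneg_nonneg p det_density_nonneg) auto
      also have "\<dots> = (\<Sum>J\<in>Pow {1..N}. ?g J \<alpha>)"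
        by (rule sum_ennreal[symmetric]) simp
      finally show "f N \<alpha> \<le> (\<Sum>J\<in>Pow {1..N}. ?g J \<alpha>)" .
    qed
    also have "\<dots> = (\<Sum>J\<in>Pow {1..N}. \<integral>\<^sup>+\<alpha>. ?g J \<alpha> \<partial>?M)"
      by (rule nn_integral_sum) (rule gm)
    also have "\<dots> \<le> (\<Sum>J\<in>Pow {1..N}. ennreal (2 * (sqrt (?p J) - sqrt (?q J))\<^sup>2 + 4 * ?q J * (\<Sum>j\<in>J. ?d j)))"
      by (intro sum_mono component_distance \<Phi> \<Psi> p)
    also have "\<dots> = ennreal (\<Sum>J\<in>Pow {1..N}. 2 * (sqrt (?p J) - sqrt (?q J))\<^sup>2 + 4 * ?q J * (\<Sum>j\<in>J. ?d j))"
      using p by (intro sum_ennreal) (auto intro!: add_nonneg_nonneg mult_nonneg_nonneg sum_nonneg)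
    also have "\<dots> \<le> ennreal ?B"
    proof (rule ennreal_leI)
      have "(\<Sum>J\<in>Pow {1..N}. 4 * ?q J * (\<Sum>j\<in>J. ?d j)) \<le> (\<Sum>J\<in>Pow {1..N}. 4 * ?q J * (\<Sum>i=1..m. ?d i))"
      proof (rule sum_mono)
        fix J assume J: "J \<in> Pow {1..N}"
        show "4 * ?q J * (\<Sum>j\<in>J. ?d j) \<le> 4 * ?q J * (\<Sum>i=1..m. ?d i)"
        proof (cases "J \<subseteq> {1..m}")
          case True
          then show ?thesis using p[OF J] by (intro mult_left_mono sum_mono2) auto
        next
          case False
          then show ?thesis using index_weight_truncated(2)[OF kap p(3)[OF J]] by simp
        qed
      qed
      also have "\<dots> = 4 * (\<Sum>i=1..m. ?d i) * (\<Sum>J\<in>Pow {1..N}. ?q J)"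
      proof -
        have "(\<Sum>J\<in>S. 4 * g J * D) = 4 * D * (\<Sum>J\<in>S. g J)" for S :: "nat set set" and g and D :: real
          unfolding sum_distrib_left by (intro sum.cong refl) (simp only: mult_ac)
        then show ?thesis .
      qed
      also have "\<dots> \<le> 4 * (\<Sum>i=1..m. ?d i) * 1"
        by (intro mult_left_mono index_weight_sum_le kap(1)) (auto intro: sum_nonneg)
      finally have 1: "(\<Sum>J\<in>Pow {1..N}. 4 * ?q J * (\<Sum>j\<in>J. ?d j)) \<le> 4 * (\<Sum>i=1..m. ?d i)" by simp
      have 2: "(\<Sum>J\<in>Pow {1..N}. 2 * (sqrt (?p J) - sqrt (?q J))\<^sup>2)
          \<le> 2 * (2 * ((\<Sum>i=1..m. 3 / 2 * \<bar>lam i - kap i\<bar>) + (\<Sum>\<^sub>\<infinity>i\<in>{m<..}. (lam i)\<^sup>2)))"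
      proof -
        have "(\<Sum>J\<in>Pow {1..N}. 2 * (sqrt (?p J) - sqrt (?q J))\<^sup>2) = 2 * (\<Sum>J\<in>Pow {1..N}. (sqrt (?p J) - sqrt (?q J))\<^sup>2)"
          by (rule sum_distrib_left[symmetric])
        then show ?thesis using weight_affinity[OF lam kap N] by linarith
      qed
      have 3: "?B = 2 * (2 * ((\<Sum>i=1..m. 3 / 2 * \<bar>lam i - kap i\<bar>) + (\<Sum>\<^sub>\<infinity>i\<in>{m<..}. (lam i)\<^sup>2))) + 4 * (\<Sum>i=1..m. ?d i)"
        by (simp add: sum.distrib sum_distrib_left algebra_simps)
      show "(\<Sum>J\<in>Pow {1..N}. 2 * (sqrt (?p J) - sqrt (?q J))\<^sup>2 + 4 * ?q J * (\<Sum>j\<in>J. ?d j)) \<le> ?B"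
        unfolding 3 unfolding sum.distrib using 1 2 by linarith
    qed
    finally show ?thesis .
  qed
  have "AE \<alpha> in ?M. ennreal ((sqrt (mixed_det_density \<iota> \<Phi> lam \<alpha>) - sqrt (mixed_det_density \<iota> \<Psi> kap \<alpha>))\<^sup>2)
      = liminf (\<lambda>N. f N \<alpha>)"
    using mixture_converges_AE[OF \<Phi> lam] mixture_converges_AE[OF \<Psi> kap(1)]
  proof eventually_elim
    fix \<alpha> assume "(\<lambda>N. partial_mixture \<Phi> lam N \<alpha>) \<longlonglongrightarrow> mixed_det_density \<iota> \<Phi> lam \<alpha>"
      "(\<lambda>N. partial_mixture \<Psi> kap N \<alpha>) \<longlonglongrightarrow> mixed_det_density \<iota> \<Psi> kap \<alpha>"
    then have "(\<lambda>N. f N \<alpha>) \<longlonglongrightarrow> ennreal ((sqrt (mixed_det_density \<iota> \<Phi> lam \<alpha>) - sqrt (mixed_det_density \<iota> \<Psi> kap \<alpha>))\<^sup>2)"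
      unfolding f_def by (intro tendsto_ennrealI tendsto_intros)
    from lim_imp_Liminf[OF _ this]
    show "ennreal ((sqrt (mixed_det_density \<iota> \<Phi> lam \<alpha>) - sqrt (mixed_det_density \<iota> \<Psi> kap \<alpha>))\<^sup>2) = liminf (\<lambda>N. f N \<alpha>)"
      by simp
  qed
  then have "(\<integral>\<^sup>+\<alpha>. ennreal ((sqrt (mixed_det_density \<iota> \<Phi> lam \<alpha>) - sqrt (mixed_det_density \<iota> \<Psi> kap \<alpha>))\<^sup>2) \<partial>?M)
     = (\<integral>\<^sup>+\<alpha>. liminf (\<lambda>N. f N \<alpha>) \<partial>?M)"
    by (rule nn_integral_cong_AE)
  also have "\<dots> \<le> liminf (\<lambda>N. \<integral>\<^sup>+\<alpha>. f N \<alpha> \<partial>?M)"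
    by (rule nn_integral_liminf) (rule fm)
  also have "\<dots> \<le> liminf (\<lambda>N. ennreal ?B)"
    by (rule Liminf_mono) (use bound in \<open>auto simp: eventually_sequentially\<close>)
  also have "\<dots> = ennreal ?B" by (rule Liminf_const) simp
  finally show ?thesis .
qed

end

section \<open>Robust selection in a countable family of densities\<close>

text \<open>
  The value is $(2\sqrt q+\sqrt p)/(2\sqrt p+\sqrt q)$ unless $p = q = 0$, where it is 1, as $0/0 = 0$. It is a bounded
  substitute for the likelihood ratio that is still inverted by exchanging $p$ and $q$.
\<close>

definition robust_ratio :: "real \<Rightarrow> real \<Rightarrow> real" where
  "robust_ratio p q = 1 + (sqrt q - sqrt p) / (2 * sqrt p + sqrt q)"

lemma robust_ratio_alt:
  assumes "p \<ge> 0" "q \<ge> 0" "\<not> (p = 0 \<and> q = 0)"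
  shows "robust_ratio p q = (2 * sqrt q + sqrt p) / (2 * sqrt p + sqrt q)"
proof -
  have "2 * sqrt p + sqrt q > 0"
    using assms by (cases "p = 0") (auto intro: add_pos_nonneg)
  then show ?thesis unfolding robust_ratio_def by (simp add: field_simps)
qed

lemma robust_ratio_bounds:
  assumes "p \<ge> 0" "q \<ge> 0"
  shows "robust_ratio p q > 0" "robust_ratio p q \<le> 2" "robust_ratio p q * robust_ratio q p = 1"
proof -
  have "robust_ratio p q > 0 \<and> robust_ratio p q \<le> 2 \<and> robust_ratio p q * robust_ratio q p = 1"
  proof (cases "p = 0 \<and> q = 0")
    case True
    then show ?thesis by (simp add: robust_ratio_def)
  next
    case False
    have pos: "2 * sqrt p + sqrt q > 0" "2 * sqrt q + sqrt p > 0"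
      using assms False by (cases "p = 0"; cases "q = 0"; auto intro: add_pos_nonneg)+
    have a: "robust_ratio p q = (2 * sqrt q + sqrt p) / (2 * sqrt p + sqrt q)"
      by (rule robust_ratio_alt) (use assms False in auto)
    have b: "robust_ratio q p = (2 * sqrt p + sqrt q) / (2 * sqrt q + sqrt p)"
      by (rule robust_ratio_alt) (use assms False in auto)
    show ?thesis unfolding a b using pos assms by (simp add: divide_simps)
  qed
  then show "robust_ratio p q > 0" "robust_ratio p q \<le> 2" "robust_ratio p q * robust_ratio q p = 1" by auto
qed

text \<open>
  Here $s,u,v$ stand for $\sqrt P,\sqrt p,\sqrt q$. If $s = u$, the left-hand side is at most
  $u(v-u)/3 = (v^2-u^2)/6-(v-u)^2/6$, whose first part integrates to 0 and whose second part is the gain. For general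
  $s$, the error terms in $s-u$ are split so that they use up only half of this gain; the remaining half is
  expressed by $(s-v)^2$.
\<close>

lemma robust_ratio_pointwise:
  fixes s u v :: real
  assumes "s \<ge> 0" "u \<ge> 0" "v \<ge> 0"
  shows "s\<^sup>2 * ((v - u) / (2 * u + v))
    \<le> (v\<^sup>2 - u\<^sup>2) / 6 + 5 * (s - u)\<^sup>2 - (s - v)\<^sup>2 / 24"
proof (cases "u = 0 \<and> v = 0")
  case True
  then show ?thesis by simp
next
  case False
  then have d: "2 * u + v > 0" using assms by (cases "u = 0") (auto intro: add_pos_nonneg)
  define w where "w = (v - u) / (2 * u + v)"
  define r where "r = 2 * u / (2 * u + v)"
  have w1: "w \<le> 1" using d assms by (simp add: w_def)
  have r: "0 \<le> r" "r \<le> 1" using d assms by (auto simp: r_def)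
  have uw: "2 * u * w = r * (v - u)" by (simp add: w_def r_def)
  have a: "u\<^sup>2 * w \<le> u * (v - u) / 3"
  proof -
    have "u * (v - u) / 3 - u\<^sup>2 * w = u * (v - u)\<^sup>2 / (3 * (2 * u + v))"
      using d by (simp add: w_def field_simps power2_eq_square)
    also have "\<dots> \<ge> 0" using d assms by simp
    finally show ?thesis by simp
  qed
  have b: "2 * u * (s - u) * w \<le> 3 * (s - u)\<^sup>2 + (v - u)\<^sup>2 / 12"
  proof -
    have "2 * u * (s - u) * w = (s - u) * (2 * u * w)" by (simp add: algebra_simps)
    also have "\<dots> = r * ((s - u) * (v - u))" unfolding uw by (simp add: algebra_simps)
    finally have "2 * u * (s - u) * w = r * ((s - u) * (v - u))" .
    also have "r * ((s - u) * (v - u)) \<le> r * \<bar>(s - u) * (v - u)\<bar>" using r by (intro mult_left_mono) auto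
    also have "\<dots> \<le> 1 * \<bar>(s - u) * (v - u)\<bar>" using r by (intro mult_right_mono) auto
    also have "\<dots> = \<bar>s - u\<bar> * \<bar>v - u\<bar>" by (simp add: abs_mult)
    also have "\<dots> \<le> 3 * \<bar>s - u\<bar>\<^sup>2 + \<bar>v - u\<bar>\<^sup>2 / 12"
    proof -
      have sq: "3 * (x - y / 6)\<^sup>2 = 3 * x\<^sup>2 + y\<^sup>2 / 12 - x * y" for x y :: real
        by (simp add: power2_eq_square field_simps)
      have "0 \<le> 3 * (\<bar>s - u\<bar> - \<bar>v - u\<bar> / 6)\<^sup>2" by simp
      then show ?thesis unfolding sq by linarith
    qed
    finally show ?thesis by simp
  qed
  have c: "(s - u)\<^sup>2 * w \<le> (s - u)\<^sup>2" using w1 by (simp add: mult_left_le)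
  have "s\<^sup>2 * w = u\<^sup>2 * w + 2 * u * (s - u) * w + (s - u)\<^sup>2 * w"
    by (simp add: power2_eq_square algebra_simps)
  then have m: "s\<^sup>2 * w \<le> u * (v - u) / 3 + (v - u)\<^sup>2 / 12 + 4 * (s - u)\<^sup>2"
    using a b c by simp
  have e: "u * (v - u) / 3 = (v\<^sup>2 - u\<^sup>2) / 6 - (v - u)\<^sup>2 / 6"
    by (simp add: power2_eq_square field_simps)
  have t: "(s - v)\<^sup>2 / 24 \<le> (s - u)\<^sup>2 / 12 + (v - u)\<^sup>2 / 12"
  proof -
    have "0 \<le> ((s - u) + (v - u))\<^sup>2" by simp
    also have "\<dots> = 2 * (s - u)\<^sup>2 + 2 * (v - u)\<^sup>2 - (s - v)\<^sup>2"
      by (simp add: power2_eq_square algebra_simps)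
    finally show ?thesis by simp
  qed
  have "0 \<le> (s - u)\<^sup>2" by simp
  then show ?thesis unfolding w_def[symmetric] using m[unfolded e] t by argo
qed

definition hell :: "'c measure \<Rightarrow> ('c \<Rightarrow> real) \<Rightarrow> ('c \<Rightarrow> real) \<Rightarrow> real" where
  "hell L p q = (\<integral>x. (sqrt (p x) - sqrt (q x))\<^sup>2 \<partial>L) / 2"

lemma is_densityD:
  assumes "is_density L p"
  shows "p \<in> borel_measurable L" "\<And>x. x \<in> space L \<Longrightarrow> 0 \<le> p x" "integrable L p" "(\<integral>x. p x \<partial>L) = 1"
proof -
  show m: "p \<in> borel_measurable L" and nn: "\<And>x. x \<in> space L \<Longrightarrow> 0 \<le> p x"
    using assms by (auto simp: is_density_def)
  have 1: "(\<integral>\<^sup>+x. ennreal (p x) \<partial>L) = ennreal 1" using assms by (simp add: is_density_def)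
  show "integrable L p"
    by (rule integrableI_nonneg[OF m]) (use nn 1 in auto)
  show "(\<integral>x. p x \<partial>L) = 1"
    by (rule integral_eq_nn_integral[OF m, THEN trans]) (use nn 1 in auto)
qed

lemma hell_integrable:
  assumes "is_density L p" "is_density L q"
  shows "integrable L (\<lambda>x. (sqrt (p x) - sqrt (q x))\<^sup>2)"
proof (rule Bochner_Integration.integrable_bound)
  note p = is_densityD[OF assms(1)] and q = is_densityD[OF assms(2)]
  note [measurable] = p(1) q(1)
  show "integrable L (\<lambda>x. 2 * p x + 2 * q x)" using p(3) q(3) by simp
  show "(\<lambda>x. (sqrt (p x) - sqrt (q x))\<^sup>2) \<in> borel_measurable L" by measurable
  show "AE x in L. norm ((sqrt (p x) - sqrt (q x))\<^sup>2) \<le> norm (2 * p x + 2 * q x)"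
  proof (rule AE_I2)
    fix x assume "x \<in> space L"
    then have nn: "0 \<le> p x" "0 \<le> q x" using p(2) q(2) by auto
    have "(sqrt (p x) - sqrt (q x))\<^sup>2 = p x + q x - 2 * (sqrt (p x) * sqrt (q x))"
      using nn by (simp add: power2_diff)
    also have "\<dots> \<le> p x + q x" using nn by simp
    finally show "norm ((sqrt (p x) - sqrt (q x))\<^sup>2) \<le> norm (2 * p x + 2 * q x)" using nn by simp
  qed
qed

lemma hellinger2_hell:
  assumes "is_density L p" "is_density L q"
  shows "hellinger2 L p q = ennreal (hell L p q)" "0 \<le> hell L p q" "hell L p q \<le> 1"
proof -
  note p = is_densityD[OF assms(1)] and q = is_densityD[OF assms(2)]
  note i = hell_integrable[OF assms]
  show nn: "0 \<le> hell L p q" unfolding hell_def by simp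
  show "hellinger2 L p q = ennreal (hell L p q)"
    unfolding hellinger2_def hell_def
    by (subst nn_integral_eq_integral[OF i], simp, subst ennreal_mult[symmetric]) auto
  have "(\<integral>x. (sqrt (p x) - sqrt (q x))\<^sup>2 \<partial>L) \<le> (\<integral>x. p x + q x \<partial>L)"
  proof (rule integral_mono[OF i])
    show "integrable L (\<lambda>x. p x + q x)" using p q by simp
    fix x assume "x \<in> space L"
    then have nn: "0 \<le> p x" "0 \<le> q x" using p(2) q(2) by auto
    then show "(sqrt (p x) - sqrt (q x))\<^sup>2 \<le> p x + q x" by (simp add: power2_diff)
  qed
  also have "\<dots> = 2" using p q by simp
  finally show "hell L p q \<le> 1" by (simp add: hell_def)
qed

text \<open>
  The factors 5 and $1/24$ of the pointwise bound are doubled because $h^2$ carries a factor $1/2$.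
\<close>

lemma robust_ratio_expectation:
  assumes P: "is_density L P" and p: "is_density L p" and q: "is_density L q"
  shows "(\<integral>\<^sup>+x. ennreal (robust_ratio (p x) (q x)) \<partial>density L (\<lambda>x. ennreal (P x)))
    \<le> ennreal (exp (10 * hell L P p - hell L P q / 12))"
proof -
  note Pd = is_densityD[OF P] and pd = is_densityD[OF p] and qd = is_densityD[OF q]
  note [measurable] = Pd(1) pd(1) qd(1)
  let ?F = "\<lambda>x. P x + (q x - p x) / 6 + 5 * (sqrt (P x) - sqrt (p x))\<^sup>2 - (sqrt (P x) - sqrt (q x))\<^sup>2 / 24"
  have le: "P x * robust_ratio (p x) (q x) \<le> ?F x" "0 \<le> P x * robust_ratio (p x) (q x)" if "x \<in> space L" for x
  proof -
    have nn: "0 \<le> P x" "0 \<le> p x" "0 \<le> q x" using that Pd(2) pd(2) qd(2) by auto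
    from robust_ratio_pointwise[of "sqrt (P x)" "sqrt (p x)" "sqrt (q x)"] nn
    show "P x * robust_ratio (p x) (q x) \<le> ?F x" by (simp add: robust_ratio_def algebra_simps)
    show "0 \<le> P x * robust_ratio (p x) (q x)"
      using nn robust_ratio_bounds(1)[of "p x" "q x"] by simp
  qed
  have i: "integrable L ?F"
    using Pd(3) pd(3) qd(3) hell_integrable[OF P p] hell_integrable[OF P q] by simp
  have "(\<integral>\<^sup>+x. ennreal (robust_ratio (p x) (q x)) \<partial>density L (\<lambda>x. ennreal (P x)))
     = (\<integral>\<^sup>+x. ennreal (P x) * ennreal (robust_ratio (p x) (q x)) \<partial>L)"
    unfolding robust_ratio_def by (subst nn_integral_density) auto
  also have "\<dots> \<le> (\<integral>\<^sup>+x. ennreal (?F x) \<partial>L)"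
  proof (rule nn_integral_mono)
    fix x assume x: "x \<in> space L"
    have "ennreal (P x) * ennreal (robust_ratio (p x) (q x)) = ennreal (P x * robust_ratio (p x) (q x))"
      by (rule ennreal_mult[symmetric]) (use x Pd(2) pd(2) qd(2) in \<open>auto intro!: less_imp_le[OF robust_ratio_bounds(1)]\<close>)
    also have "\<dots> \<le> ennreal (?F x)" by (intro ennreal_leI le x)
    finally show "ennreal (P x) * ennreal (robust_ratio (p x) (q x)) \<le> ennreal (?F x)" .
  qed
  also have "\<dots> = ennreal (\<integral>x. ?F x \<partial>L)"
    by (intro nn_integral_eq_integral[OF i] AE_I2 order_trans[OF le(2) le(1)])
  also have "(\<integral>x. ?F x \<partial>L) = 1 + (10 * hell L P p - hell L P q / 12)"
    using Pd(3,4) pd(3,4) qd(3,4) hell_integrable[OF P p] hell_integrable[OF P q]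
    by (simp add: hell_def)
  also have "ennreal \<dots> \<le> ennreal (exp (10 * hell L P p - hell L P q / 12))"
    by (intro ennreal_leI exp_ge_add_one_self)
  finally show ?thesis .
qed

lemma (in prob_space) nn_integral_affine:
  assumes [measurable]: "f \<in> borel_measurable M"
  shows "(\<integral>\<^sup>+x. 2 * f x + c \<partial>M) = 2 * (\<integral>\<^sup>+x. f x \<partial>M) + c"
  by (subst nn_integral_add) (auto simp: nn_integral_cmult emeasure_space_1)

locale density_selection =
  fixes L :: "'c measure" and n :: nat and I :: "nat set" and t :: "nat \<Rightarrow> 'c \<Rightarrow> real" and w :: "nat \<Rightarrow> real"
  assumes n: "n \<ge> 1" and I: "I \<noteq> {}"
    and t: "\<And>i. i \<in> I \<Longrightarrow> is_density L (t i)"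
    and w: "\<And>i. i \<in> I \<Longrightarrow> w i > 0"
    and w_sum: "(\<Sum>i. if i \<in> I then ennreal (w i) else 0) \<le> 1"
begin

definition pen :: "nat \<Rightarrow> real" where "pen i = ln (1 / w i)"

definition stat :: "nat \<Rightarrow> nat \<Rightarrow> (nat \<Rightarrow> 'c) \<Rightarrow> real" where
  "stat i k \<omega> = (\<Sum>l=1..n. ln (robust_ratio (t i (\<omega> l)) (t k (\<omega> l))))"

text \<open>
  A candidate is good if no competitor beats it by more than the penalty of the competitor. The term \<open>2 * pen i\<close> makes
  the criterion nonnegative and pays for the penalty of the selected index in \<open>selection_risk\<close>.
\<close>

definition crit :: "nat \<Rightarrow> (nat \<Rightarrow> 'c) \<Rightarrow> real" where
  "crit i \<omega> = (SUP k\<in>I. stat i k \<omega> - pen k) + 2 * pen i"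

text \<open>
  The infimum over infinitely many candidates need not be attained, hence the slack 1, which is negligible on the scale
  of the sum of $n$ logarithms.
\<close>

definition best :: "(nat \<Rightarrow> 'c) \<Rightarrow> nat" where
  "best \<omega> = (LEAST i. i \<in> I \<and> crit i \<omega> \<le> (INF j\<in>I. crit j \<omega>) + 1)"

abbreviation sample_space :: "(nat \<Rightarrow> 'c) measure" where
  "sample_space \<equiv> \<Pi>\<^sub>M _\<in>{1..n}. L"

lemma w_le_1: "i \<in> I \<Longrightarrow> w i \<le> 1"
proof -
  assume i: "i \<in> I"
  have "(\<Sum>j\<in>{i}. if j \<in> I then ennreal (w j) else 0) \<le> (\<Sum>j. if j \<in> I then ennreal (w j) else 0)"
    by (rule sum_le_suminf) auto
  from order_trans[OF this w_sum] have "ennreal (w i) \<le> 1" using i by simp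
  then show ?thesis using w[OF i] by (simp add: ennreal_le_1)
qed

lemma pen_nonneg: "i \<in> I \<Longrightarrow> pen i \<ge> 0"
  using w w_le_1 by (simp add: pen_def)

lemma t_nonneg: "i \<in> I \<Longrightarrow> x \<in> space L \<Longrightarrow> t i x \<ge> 0"
  by (rule is_densityD(2)[OF t])

lemma sample_component: "\<omega> \<in> space sample_space \<Longrightarrow> l \<in> {1..n} \<Longrightarrow> \<omega> l \<in> space L"
  by (auto simp: space_PiM)

lemma stat_antisym:
  assumes "i \<in> I" "k \<in> I" "\<omega> \<in> space sample_space"
  shows "stat k i \<omega> = - stat i k \<omega>"
  unfolding stat_def sum_negf[symmetric]
proof (rule sum.cong[OF refl])
  fix l assume l: "l \<in> {1..n}"
  note nn = t_nonneg[OF assms(1) sample_component[OF assms(3) l]] t_nonneg[OF assms(2) sample_component[OF assms(3) l]]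
  note b = robust_ratio_bounds[OF nn] robust_ratio_bounds[OF nn(2,1)]
  show "ln (robust_ratio (t k (\<omega> l)) (t i (\<omega> l))) = - ln (robust_ratio (t i (\<omega> l)) (t k (\<omega> l)))"
    using ln_mult_pos[OF b(1) b(4)] unfolding b(3) by simp
qed

lemma stat_upper:
  assumes "i \<in> I" "k \<in> I" "\<omega> \<in> space sample_space"
  shows "stat i k \<omega> \<le> real n * ln 2"
proof -
  have "stat i k \<omega> \<le> (\<Sum>l=1..n. ln 2)"
    unfolding stat_def
  proof (rule sum_mono)
    fix l assume l: "l \<in> {1..n}"
    note nn = t_nonneg[OF assms(1) sample_component[OF assms(3) l]] t_nonneg[OF assms(2) sample_component[OF assms(3) l]]
    show "ln (robust_ratio (t i (\<omega> l)) (t k (\<omega> l))) \<le> ln 2"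
      using robust_ratio_bounds[OF nn] by simp
  qed
  then show ?thesis by simp
qed

lemma bdd_stat:
  assumes "i \<in> I" "\<omega> \<in> space sample_space"
  shows "bdd_above ((\<lambda>k. stat i k \<omega> - pen k) ` I)"
  using stat_upper[OF assms(1) _ assms(2)] pen_nonneg
  by (intro bdd_aboveI[of _ "real n * ln 2"]) fastforce

lemma crit_lower:
  assumes "i \<in> I" "\<omega> \<in> space sample_space"
  shows "k \<in> I \<Longrightarrow> stat i k \<omega> - pen k + 2 * pen i \<le> crit i \<omega>" and "0 \<le> crit i \<omega>"
proof -
  show 1: "stat i k \<omega> - pen k + 2 * pen i \<le> crit i \<omega>" if "k \<in> I" for k
    unfolding crit_def using cSUP_upper[OF that bdd_stat[OF assms]] by simp
  have "stat i i \<omega> = 0" using stat_antisym[OF assms(1,1,2)] by simp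
  then show "0 \<le> crit i \<omega>" using 1[OF assms(1)] pen_nonneg[OF assms(1)] by simp
qed

lemma bdd_crit:
  assumes "\<omega> \<in> space sample_space"
  shows "bdd_below ((\<lambda>j. crit j \<omega>) ` I)"
  using crit_lower(2)[OF _ assms] by (intro bdd_belowI[of _ 0]) auto

lemma best:
  assumes "\<omega> \<in> space sample_space"
  shows "best \<omega> \<in> I" "j \<in> I \<Longrightarrow> crit (best \<omega>) \<omega> \<le> crit j \<omega> + 1"
proof -
  have "\<exists>i. i \<in> I \<and> crit i \<omega> \<le> (INF j\<in>I. crit j \<omega>) + 1"
  proof -
    have "(INF j\<in>I. crit j \<omega>) < (INF j\<in>I. crit j \<omega>) + 1" by simp
    then obtain i where "i \<in> I" "crit i \<omega> < (INF j\<in>I. crit j \<omega>) + 1"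
      by (subst (asm) cINF_less_iff[OF I bdd_crit[OF assms]]) auto
    then show ?thesis by (auto intro: less_imp_le)
  qed
  from LeastI_ex[OF this] have b: "best \<omega> \<in> I" "crit (best \<omega>) \<omega> \<le> (INF j\<in>I. crit j \<omega>) + 1"
    unfolding best_def by auto
  show "best \<omega> \<in> I" by (rule b)
  show "crit (best \<omega>) \<omega> \<le> crit j \<omega> + 1" if "j \<in> I"
    using b(2) cINF_lower[OF bdd_crit[OF assms] that] by simp
qed

lemma stat_measurable [measurable]:
  assumes "i \<in> I" "k \<in> I"
  shows "stat i k \<in> borel_measurable sample_space"
  unfolding stat_def
proof (intro borel_measurable_sum)
  fix l assume "l \<in> {1..n}"
  note [measurable] = is_densityD(1)[OF t[OF assms(1)]] is_densityD(1)[OF t[OF assms(2)]]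
  have "(\<lambda>x. ln (robust_ratio (t i x) (t k x))) \<in> borel_measurable L"
    unfolding robust_ratio_def by measurable
  from measurable_compose[OF measurable_component_singleton[OF \<open>l \<in> {1..n}\<close>] this]
  show "(\<lambda>\<omega>. ln (robust_ratio (t i (\<omega> l)) (t k (\<omega> l)))) \<in> borel_measurable sample_space" .
qed

lemma crit_measurable [measurable]:
  assumes "i \<in> I"
  shows "crit i \<in> borel_measurable sample_space"
proof -
  have "(\<lambda>\<omega>. SUP k\<in>I. stat i k \<omega> - pen k) \<in> borel_measurable sample_space"
  proof (rule borel_measurable_cSUP)
    show "countable I" by (rule countableI_type)
    show "(\<lambda>\<omega>. stat i k \<omega> - pen k) \<in> borel_measurable sample_space" if "k \<in> I" for k
      using stat_measurable[OF assms that] by (rule borel_measurable_diff) simp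
  qed (rule bdd_stat[OF assms])
  then show ?thesis unfolding crit_def by (rule borel_measurable_add) simp
qed

lemma best_measurable: "best \<in> measurable sample_space (count_space UNIV)"
  unfolding best_def
proof (rule measurable_Least)
  fix i
  have inf: "(\<lambda>\<omega>. INF j\<in>I. crit j \<omega>) \<in> borel_measurable sample_space"
    by (rule borel_measurable_cINF[OF countableI_type crit_measurable bdd_crit])
  show "(\<lambda>\<omega>. i \<in> I \<and> crit i \<omega> \<le> (INF j\<in>I. crit j \<omega>) + 1) \<in> measurable sample_space (count_space UNIV)"
  proof (cases "i \<in> I")
    case True
    have "Measurable.pred sample_space (\<lambda>\<omega>. crit i \<omega> \<le> (INF j\<in>I. crit j \<omega>) + 1)"
      unfolding pred_def
      by (rule borel_measurable_le[OF crit_measurable[OF True] borel_measurable_add[OF inf borel_measurable_const]])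
    then show ?thesis using True by simp
  qed simp
qed

lemma estimator_measurable:
  "(\<lambda>(\<omega>, x). t (best \<omega>) x) \<in> borel_measurable (sample_space \<Otimes>\<^sub>M L)"
proof -
  define u where "u i = (if i \<in> I then t i else (\<lambda>_. 0))" for i
  have [measurable]: "u i \<in> borel_measurable L" for i
    using is_densityD(1)[OF t] by (auto simp: u_def)
  have "(\<lambda>z. (\<lambda>i z. u i (snd z)) (best (fst z)) z) \<in> borel_measurable (sample_space \<Otimes>\<^sub>M L)"
  proof (rule measurable_compose_countable)
    show "(\<lambda>z. best (fst z)) \<in> measurable (sample_space \<Otimes>\<^sub>M L) (count_space UNIV)"
      by (rule measurable_compose[OF measurable_fst best_measurable])
  qed measurable
  moreover have "u (best (fst z)) (snd z) = (\<lambda>(\<omega>, x). t (best \<omega>) x) z" if "z \<in> space (sample_space \<Otimes>\<^sub>M L)" for z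
    using that best(1)[of "fst z"] by (auto simp: u_def space_pair_measure)
  ultimately show ?thesis by (subst measurable_cong[symmetric]) auto
qed

text \<open>
  Let $e_k = n(10\,h^2(P,t_i) - h^2(P,t_k)/12)$, and let $Z$ be the sum of $w_k \exp(T_{ik} - e_k)$ over all $k$, which has
  expectation at most 1. Each summand is at most $Z$, so
  $T_{ik} \le \log Z + \log(1/w_k) + e_k$ for all $k$ simultaneously. This bounds the criterion of $i$, hence that of
  the selected index $b$, hence $T_{bi} = -T_{ib}$ from above; the bound on $T_{ib}$ itself contains
  $-n\,h^2(P,t_b)/12$. Adding the two leaves $n\,h^2(P,t_b)/12$ on the left and $2\log Z \le 2Z$ on the right.
\<close>

lemma selection_risk:
  assumes dP: "is_density L P" and i: "i \<in> I"
  shows "(\<integral>\<^sup>+\<omega>. hellinger2 L P (t (best \<omega>)) \<partial>(\<Pi>\<^sub>M _\<in>{1..n}. density L (\<lambda>x. ennreal (P x))))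
    \<le> ennreal (240 * hell L P (t i) + 36 * (pen i + 1) / real n)"
proof -
  let ?Q = "density L (\<lambda>x. ennreal (P x))" and ?h = "\<lambda>k. hell L P (t k)"
  let ?S = "\<Pi>\<^sub>M _\<in>{1..n}. ?Q"
  note Pd = is_densityD[OF dP]
  note [measurable] = Pd(1)
  interpret Q: prob_space ?Q
    by (rule prob_spaceI) (use dP in \<open>simp add: emeasure_density is_density_def cong: nn_integral_cong\<close>)
  interpret product_prob_space "\<lambda>_::nat. ?Q" ..
  have sets_eq: "sets ?S = sets sample_space" by (intro sets_PiM_cong) auto
  have space_eq: "space ?S = space sample_space" by (rule sets_eq_imp_space_eq[OF sets_eq])
  have meas_eq: "borel_measurable ?S = borel_measurable sample_space" by (rule measurable_cong_sets[OF sets_eq refl])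
  define e where "e k = real n * (10 * ?h i - ?h k / 12)" for k
  define Z where "Z \<omega> = (\<Sum>k. if k \<in> I then ennreal (w k * exp (stat i k \<omega> - e k)) else 0)" for \<omega>
  have Zm: "(\<lambda>\<omega>. if k \<in> I then ennreal (w k * exp (stat i k \<omega> - e k)) else 0) \<in> borel_measurable ?S" for k
    unfolding meas_eq using stat_measurable[OF i] by (cases "k \<in> I") auto
  \<comment> \<open>The sample is independent, and each factor is bounded by \<open>robust_ratio_expectation\<close>.\<close>
  have mgf: "(\<integral>\<^sup>+\<omega>. ennreal (exp (stat i k \<omega>)) \<partial>?S) \<le> ennreal (exp (e k))" if k: "k \<in> I" for k
  proof -
    note [measurable] = is_densityD(1)[OF t[OF i]] is_densityD(1)[OF t[OF k]]
    have "(\<integral>\<^sup>+\<omega>. ennreal (exp (stat i k \<omega>)) \<partial>?S)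
       = (\<integral>\<^sup>+\<omega>. (\<Prod>l\<in>{1..n}. ennreal (robust_ratio (t i (\<omega> l)) (t k (\<omega> l)))) \<partial>?S)"
    proof (rule nn_integral_cong)
      fix \<omega> assume "\<omega> \<in> space ?S"
      then have om: "\<omega> \<in> space sample_space" unfolding space_eq .
      have pos: "robust_ratio (t i (\<omega> l)) (t k (\<omega> l)) > 0" if "l \<in> {1..n}" for l
        by (rule robust_ratio_bounds(1)[OF t_nonneg[OF i] t_nonneg[OF k]]; rule sample_component[OF om that])
      have e: "exp (stat i k \<omega>) = (\<Prod>l\<in>{1..n}. robust_ratio (t i (\<omega> l)) (t k (\<omega> l)))"
        unfolding stat_def exp_sum[OF finite_atLeastAtMost] using pos by (intro prod.cong) auto
      show "ennreal (exp (stat i k \<omega>)) = (\<Prod>l\<in>{1..n}. ennreal (robust_ratio (t i (\<omega> l)) (t k (\<omega> l))))"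
        unfolding e by (rule prod_ennreal[symmetric]) (rule less_imp_le[OF pos])
    qed
    also have "\<dots> = (\<Prod>l\<in>{1..n}. \<integral>\<^sup>+x. ennreal (robust_ratio (t i x) (t k x)) \<partial>?Q)"
      by (rule product_nn_integral_prod) (auto simp: robust_ratio_def)
    also have "\<dots> \<le> (\<Prod>l\<in>{1..n}. ennreal (exp (10 * ?h i - ?h k / 12)))"
      by (rule prod_mono_ennreal) (rule robust_ratio_expectation[OF dP t[OF i] t[OF k]])
    also have "\<dots> = ennreal (exp (e k))"
      by (simp add: e_def ennreal_power flip: exp_of_nat_mult)
    finally show ?thesis .
  qed
  have EZ: "(\<integral>\<^sup>+\<omega>. Z \<omega> \<partial>?S) \<le> 1"
  proof -
    have "(\<integral>\<^sup>+\<omega>. Z \<omega> \<partial>?S) = (\<Sum>k. \<integral>\<^sup>+\<omega>. (if k \<in> I then ennreal (w k * exp (stat i k \<omega> - e k)) else 0) \<partial>?S)"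
      unfolding Z_def by (rule nn_integral_suminf) (rule Zm)
    also have "\<dots> \<le> (\<Sum>k. if k \<in> I then ennreal (w k) else 0)"
    proof (rule suminf_le)
      fix k
      show "(\<integral>\<^sup>+\<omega>. (if k \<in> I then ennreal (w k * exp (stat i k \<omega> - e k)) else 0) \<partial>?S) \<le> (if k \<in> I then ennreal (w k) else 0)"
      proof (cases "k \<in> I")
        case True
        have "(\<integral>\<^sup>+\<omega>. ennreal (w k * exp (stat i k \<omega> - e k)) \<partial>?S)
           = (\<integral>\<^sup>+\<omega>. ennreal (w k * exp (- e k)) * ennreal (exp (stat i k \<omega>)) \<partial>?S)"
          using w[OF True] by (intro nn_integral_cong) (simp add: exp_diff exp_minus field_simps flip: ennreal_mult)
        also have "\<dots> = ennreal (w k * exp (- e k)) * (\<integral>\<^sup>+\<omega>. ennreal (exp (stat i k \<omega>)) \<partial>?S)"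
          using stat_measurable[OF i True] by (intro nn_integral_cmult) (simp add: meas_eq)
        also have "\<dots> \<le> ennreal (w k * exp (- e k)) * ennreal (exp (e k))"
          by (intro mult_left_mono mgf True) auto
        also have "\<dots> = ennreal (w k)"
          using w[OF True] by (simp add: exp_minus flip: ennreal_mult)
        finally show ?thesis using True by simp
      qed simp
    qed auto
    also note w_sum
    finally show ?thesis .
  qed
  \<comment> \<open>The deterministic inequality, with \<open>log Z\<close> replaced by \<open>Z\<close> so that it remains true for infinite \<open>Z\<close> and can be
    integrated.\<close>
  have key: "ennreal (real n * ?h (best \<omega>) / 12) \<le> 2 * Z \<omega> + ennreal (20 * real n * ?h i + 3 * pen i + 1)"
    if "\<omega> \<in> space ?S" for \<omega>
  proof (cases "Z \<omega>")
    case top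
    then show ?thesis by simp
  next
    case (real z)
    have om: "\<omega> \<in> space sample_space" using that unfolding space_eq .
    have summand: "w k * exp (stat i k \<omega> - e k) \<le> z" if k: "k \<in> I" for k
    proof -
      have "(\<Sum>k\<in>{k}. if k \<in> I then ennreal (w k * exp (stat i k \<omega> - e k)) else 0) \<le> Z \<omega>"
        unfolding Z_def by (rule sum_le_suminf) auto
      then show ?thesis using k real by simp
    qed
    have z0: "z > 0" using summand[OF i] w[OF i] by (meson exp_gt_zero less_le_trans mult_pos_pos)
    have st: "stat i k \<omega> \<le> ln z + pen k + e k" if k: "k \<in> I" for k
    proof -
      have "ln (w k * exp (stat i k \<omega> - e k)) \<le> ln z"
        using summand[OF k] w[OF k] by (intro ln_mono) auto
      then show ?thesis using w[OF k] by (simp add: ln_mult pen_def ln_div)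
    qed
    have lz: "ln z \<le> z - 1" using z0 by (rule ln_le_minus_one)
    have crit_i: "crit i \<omega> \<le> ln z + 10 * real n * ?h i + 2 * pen i"
    proof -
      have "(SUP k\<in>I. stat i k \<omega> - pen k) \<le> ln z + 10 * real n * ?h i"
      proof (rule cSUP_least[OF I])
        fix k assume k: "k \<in> I"
        have "e k \<le> 10 * real n * ?h i"
          using hellinger2_hell(2)[OF dP t[OF k]] by (simp add: e_def algebra_simps)
        then show "stat i k \<omega> - pen k \<le> ln z + 10 * real n * ?h i" using st[OF k] by simp
      qed
      then show ?thesis by (simp add: crit_def)
    qed
    let ?b = "best \<omega>"
    have b: "?b \<in> I" by (rule best(1)[OF om])
    have "stat ?b i \<omega> - pen i + 2 * pen ?b \<le> crit i \<omega> + 1"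
      using crit_lower(1)[OF b om i] best(2)[OF om i] by linarith
    then have "- stat i ?b \<omega> - pen i + 2 * pen ?b \<le> ln z + 10 * real n * ?h i + 2 * pen i + 1"
      using crit_i stat_antisym[OF i b om] by linarith
    moreover have "stat i ?b \<omega> \<le> ln z + pen ?b + (10 * real n * ?h i - real n * ?h ?b / 12)"
      using st[OF b] by (simp add: e_def algebra_simps)
    ultimately have "real n * ?h ?b / 12 \<le> 2 * z + (20 * real n * ?h i + 3 * pen i + 1)"
      using lz pen_nonneg[OF b] by linarith
    moreover have "0 \<le> 20 * real n * ?h i + 3 * pen i + 1"
      using hellinger2_hell(2)[OF dP t[OF i]] pen_nonneg[OF i] by simp
    moreover have "2 * Z \<omega> = ennreal (2 * z)" using real by (simp add: ennreal_mult)
    ultimately show ?thesis using real by (simp add: ennreal_leI flip: ennreal_plus)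
  qed
  have "ennreal (real n / 12) * (\<integral>\<^sup>+\<omega>. hellinger2 L P (t (best \<omega>)) \<partial>?S)
      = (\<integral>\<^sup>+\<omega>. ennreal (real n * ?h (best \<omega>) / 12) \<partial>?S)"
  proof -
    have hm: "(\<lambda>\<omega>. ennreal (?h (best \<omega>))) \<in> borel_measurable ?S"
      unfolding meas_eq by (rule measurable_compose[OF best_measurable]) simp
    have "(\<integral>\<^sup>+\<omega>. hellinger2 L P (t (best \<omega>)) \<partial>?S) = (\<integral>\<^sup>+\<omega>. ennreal (?h (best \<omega>)) \<partial>?S)"
      by (intro nn_integral_cong hellinger2_hell(1) dP t best(1)) (simp only: space_eq)
    then have "ennreal (real n / 12) * (\<integral>\<^sup>+\<omega>. hellinger2 L P (t (best \<omega>)) \<partial>?S)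
       = (\<integral>\<^sup>+\<omega>. ennreal (real n / 12) * ennreal (?h (best \<omega>)) \<partial>?S)"
      by (simp only: nn_integral_cmult[OF hm])
    also have "\<dots> = (\<integral>\<^sup>+\<omega>. ennreal (real n * ?h (best \<omega>) / 12) \<partial>?S)"
      by (intro nn_integral_cong) (simp flip: ennreal_mult')
    finally show ?thesis .
  qed
  also have "\<dots> \<le> (\<integral>\<^sup>+\<omega>. 2 * Z \<omega> + ennreal (20 * real n * ?h i + 3 * pen i + 1) \<partial>?S)"
    by (rule nn_integral_mono) (rule key)
  also have "\<dots> = 2 * (\<integral>\<^sup>+\<omega>. Z \<omega> \<partial>?S) + ennreal (20 * real n * ?h i + 3 * pen i + 1)"
  proof -
    have "Z \<in> borel_measurable ?S" unfolding Z_def by (rule borel_measurable_suminf_order) (rule Zm)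
    interpret S: prob_space ?S by (rule prob_space_PiM) (rule Q.prob_space_axioms)
    show ?thesis by (rule S.nn_integral_affine) fact
  qed
  also have "\<dots> \<le> 2 * 1 + ennreal (20 * real n * ?h i + 3 * pen i + 1)"
    by (intro add_mono mult_left_mono EZ) auto
  also have "\<dots> = ennreal (3 + 20 * real n * ?h i + 3 * pen i)"
    using hellinger2_hell(2)[OF dP t[OF i]] pen_nonneg[OF i]
    by (simp flip: ennreal_plus ennreal_numeral add: algebra_simps)
  finally have fin: "ennreal (real n / 12) * (\<integral>\<^sup>+\<omega>. hellinger2 L P (t (best \<omega>)) \<partial>?S)
      \<le> ennreal (3 + 20 * real n * ?h i + 3 * pen i)" .
  have "(\<integral>\<^sup>+\<omega>. hellinger2 L P (t (best \<omega>)) \<partial>?S)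
     = ennreal (12 / real n) * (ennreal (real n / 12) * (\<integral>\<^sup>+\<omega>. hellinger2 L P (t (best \<omega>)) \<partial>?S))"
    using n by (simp add: mult.assoc[symmetric] flip: ennreal_mult)
  also have "\<dots> \<le> ennreal (12 / real n) * ennreal (3 + 20 * real n * ?h i + 3 * pen i)"
    by (intro mult_left_mono fin) auto
  also have "\<dots> = ennreal (240 * ?h i + 36 * (pen i + 1) / real n)"
    using hellinger2_hell(2)[OF dP t[OF i]] pen_nonneg[OF i] n
    by (subst ennreal_mult[symmetric]) (auto simp: field_simps)
  finally show ?thesis .
qed

end

section \<open>Nets, weights of lists, normalisation\<close>

lemma topspace_l2_topology: "topspace (l2_topology \<nu>) = l2_space \<nu>"
proof -
  have "\<phi> \<in> {\<psi> \<in> l2_space \<nu>. l2_norm \<nu> (\<lambda>x. \<phi> x - \<psi> x) < 1}" if "\<phi> \<in> l2_space \<nu>" for \<phi>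
    using that by (simp add: l2_norm_def)
  moreover have "(1::real) > 0" by simp
  ultimately show ?thesis
    unfolding l2_topology_def topology_generated_by_topspace by blast
qed

text \<open>
  A ball of radius $\eta/2$ contains at most one point of an $\eta$-separated set, so finitely many balls covering
  \<open>H\<close> bound the cardinality of separated subsets and the maximum exists. A point at distance larger than $\eta$ from all
  points of a maximal separated set could be added to it.
\<close>

lemma max_separated_net:
  assumes H: "compactin (l2_topology \<nu>) H" and \<eta>: "\<eta> > 0"
  shows "finite (max_separated \<nu> H \<eta>)" "max_separated \<nu> H \<eta> \<subseteq> H"
    and "\<psi> \<in> H \<Longrightarrow> \<exists>\<psi>'\<in>max_separated \<nu> H \<eta>. l2_norm \<nu> (\<lambda>x. \<psi> x - \<psi>' x) \<le> \<eta>"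
proof -
  have Hl: "H \<subseteq> l2_space \<nu>" using compactin_subset_topspace[OF H] by (simp add: topspace_l2_topology)
  define B where "B \<phi> = {\<psi> \<in> l2_space \<nu>. l2_norm \<nu> (\<lambda>x. \<phi> x - \<psi> x) < \<eta> / 2}" for \<phi>
  have "openin (l2_topology \<nu>) (B \<phi>)" if "\<phi> \<in> l2_space \<nu>" for \<phi>
    unfolding l2_topology_def B_def
    by (rule topology_generated_by_Basis) (use that \<eta> in \<open>auto intro!: exI[of _ \<phi>] exI[of _ "\<eta> / 2"]\<close>)
  then have "\<forall>U\<in>B ` H. openin (l2_topology \<nu>) U" using Hl by auto
  moreover have "H \<subseteq> \<Union>(B ` H)" using Hl \<eta> by (auto simp: B_def l2_norm_def)
  ultimately obtain F where F: "finite F" "F \<subseteq> B ` H" "H \<subseteq> \<Union>F"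
    using H unfolding compactin_def by meson
  let ?P = "\<lambda>S. finite S \<and> S \<subseteq> H \<and> separated \<nu> \<eta> S"
  have bound: "card S < Suc (card F)" if S: "?P S" for S
  proof -
    have "\<forall>\<psi>\<in>S. \<exists>U\<in>F. \<psi> \<in> U" using S F(3) by blast
    then obtain g where g: "\<And>\<psi>. \<psi> \<in> S \<Longrightarrow> g \<psi> \<in> F \<and> \<psi> \<in> g \<psi>" by metis
    have "inj_on g S"
    proof (rule inj_onI, rule ccontr)
      fix x y assume xy: "x \<in> S" "y \<in> S" "g x = g y" "x \<noteq> y"
      then obtain \<phi> where \<phi>: "\<phi> \<in> H" "g x = B \<phi>" using g F(2) by blast
      then have x: "x \<in> B \<phi>" "y \<in> B \<phi>" using g xy by (metis, metis)
      then have l: "x \<in> l2_space \<nu>" "y \<in> l2_space \<nu>" "\<phi> \<in> l2_space \<nu>" using \<phi> Hl by (auto simp: B_def)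
      have "(l2_norm \<nu> (\<lambda>z. x z - y z))\<^sup>2
         \<le> 2 * (l2_norm \<nu> (\<lambda>z. x z - \<phi> z))\<^sup>2 + 2 * (l2_norm \<nu> (\<lambda>z. \<phi> z - y z))\<^sup>2"
        by (rule l2_norm_diff_squared_le[OF l(1,3,2)])
      also have "\<dots> \<le> 2 * (\<eta> / 2)\<^sup>2 + 2 * (\<eta> / 2)\<^sup>2"
        using x by (intro add_mono mult_left_mono power_mono) (auto simp: B_def l2_norm_diff_commute[of \<nu> x \<phi>])
      also have "\<dots> = \<eta>\<^sup>2" by (simp add: power2_eq_square)
      finally have "l2_norm \<nu> (\<lambda>z. x z - y z) \<le> \<eta>" using \<eta> by (simp add: power2_le_iff_abs_le)
      moreover have "l2_norm \<nu> (\<lambda>z. x z - y z) > \<eta>" using S xy by (auto simp: separated_def)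
      ultimately show False by simp
    qed
    moreover have "g ` S \<subseteq> F" using g by blast
    ultimately have "card S \<le> card F" using F(1) by (metis card_inj_on_le)
    then show ?thesis by simp
  qed
  have "?P {}" by (simp add: separated_def)
  from arg_max_nat_lemma[of ?P "{}" card "Suc (card F)", OF this] bound
  have A: "?P (max_separated \<nu> H \<eta>)" "\<And>S. ?P S \<Longrightarrow> card S \<le> card (max_separated \<nu> H \<eta>)"
    unfolding max_separated_def by blast+
  show "finite (max_separated \<nu> H \<eta>)" "max_separated \<nu> H \<eta> \<subseteq> H" using A(1) by auto
  show "\<exists>\<psi>'\<in>max_separated \<nu> H \<eta>. l2_norm \<nu> (\<lambda>x. \<psi> x - \<psi>' x) \<le> \<eta>" if \<psi>: "\<psi> \<in> H"
  proof (rule ccontr)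
    assume "\<not> ?thesis"
    then have far: "l2_norm \<nu> (\<lambda>x. \<psi> x - \<psi>' x) > \<eta>" if "\<psi>' \<in> max_separated \<nu> H \<eta>" for \<psi>' using that by force
    have "\<psi> \<notin> max_separated \<nu> H \<eta>" using far[of \<psi>] \<eta> by (auto simp: l2_norm_def)
    then have "card (insert \<psi> (max_separated \<nu> H \<eta>)) = Suc (card (max_separated \<nu> H \<eta>))" using A(1) by simp
    moreover have "?P (insert \<psi> (max_separated \<nu> H \<eta>))"
      using A(1) far \<psi> l2_norm_diff_commute[of \<nu> _ \<psi>] by (auto simp: separated_def)
    ultimately show False using A(2)[of "insert \<psi> (max_separated \<nu> H \<eta>)"] by simp
  qed
qed

lemma sum_prod_list_lists:
  fixes a :: "'x \<Rightarrow> real"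
  assumes "finite B"
  shows "(\<Sum>xs | set xs \<subseteq> B \<and> length xs = j. prod_list (map a xs)) = (\<Sum>x\<in>B. a x) ^ j"
proof (induction j)
  case 0
  have "{xs. set xs \<subseteq> B \<and> length xs = 0} = {[]}" by auto
  then show ?case by simp
next
  case (Suc j)
  have "(\<Sum>xs | set xs \<subseteq> B \<and> length xs = Suc j. prod_list (map a xs))
     = (\<Sum>z\<in>{xs. set xs \<subseteq> B \<and> length xs = j} \<times> B. prod_list (map a (snd z # fst z)))"
    unfolding lists_length_Suc_eq by (subst sum.reindex) (auto simp: inj_on_def case_prod_beta')
  also have "\<dots> = (\<Sum>xs | set xs \<subseteq> B \<and> length xs = j. \<Sum>x\<in>B. a x * prod_list (map a xs))"
    by (subst sum.cartesian_product) (simp add: case_prod_beta')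
  also have "\<dots> = (\<Sum>x\<in>B. a x) * (\<Sum>xs | set xs \<subseteq> B \<and> length xs = j. prod_list (map a xs))"
    by (simp add: sum_distrib_left sum_distrib_right)
  finally show ?case using Suc by simp
qed

text \<open>
  The lists of length $j$ contribute at most $2^{-j}$.
\<close>

lemma list_weights_sum_le:
  fixes a :: "'x::countable \<Rightarrow> real"
  assumes a: "\<And>x. x \<in> A \<Longrightarrow> a x \<ge> 0" and half: "\<And>B. finite B \<Longrightarrow> B \<subseteq> A \<Longrightarrow> (\<Sum>x\<in>B. a x) \<le> 1 / 2"
  defines "I \<equiv> to_nat ` {xs. xs \<noteq> [] \<and> set xs \<subseteq> A}"
  shows "(\<Sum>i. if i \<in> I then ennreal (prod_list (map a (from_nat i))) else 0) \<le> 1"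
proof -
  have pos: "prod_list (map a xs) \<ge> 0" if "set xs \<subseteq> A" for xs
    using that a by (induction xs) auto
  have "(\<Sum>i<K. if i \<in> I then ennreal (prod_list (map a (from_nat i))) else 0) \<le> 1" for K
  proof -
    define T where "T = {xs. xs \<noteq> [] \<and> set xs \<subseteq> A \<and> to_nat xs < K}"
    have img: "to_nat ` T = {i. i < K \<and> i \<in> I}" by (auto simp: T_def I_def)
    have inj: "inj_on to_nat T" by (rule inj_on_subset[OF inj_to_nat]) simp
    have "finite (to_nat ` T)" unfolding img by simp
    then have finT: "finite T" using inj by (rule finite_imageD)
    have "(\<Sum>i<K. if i \<in> I then ennreal (prod_list (map a (from_nat i))) else 0)
       = (\<Sum>i\<in>to_nat ` T. ennreal (prod_list (map a (from_nat i))))"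
      unfolding img by (rule sum.mono_neutral_cong_right) auto
    also have "\<dots> = (\<Sum>xs\<in>T. ennreal (prod_list (map a xs)))"
      by (subst sum.reindex[OF inj]) simp
    also have "\<dots> = ennreal (\<Sum>xs\<in>T. prod_list (map a xs))"
      by (rule sum_ennreal) (use pos in \<open>auto simp: T_def\<close>)
    also have "\<dots> \<le> 1"
    proof -
      define B where "B = (\<Union>xs\<in>T. set xs)"
      have B: "finite B" "B \<subseteq> A" using finT by (auto simp: B_def T_def)
      obtain R where R: "\<And>xs. xs \<in> T \<Longrightarrow> length xs \<le> R"
        using finite_nat_set_iff_bounded_le[of "length ` T"] finT by auto
      define C where "C j = {xs. set xs \<subseteq> B \<and> length xs = j}" for j
      have "(\<Sum>xs\<in>T. prod_list (map a xs)) \<le> (\<Sum>xs\<in>(\<Union>j\<in>{1..R}. C j). prod_list (map a xs))"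
      proof (rule sum_mono2)
        show "finite (\<Union>j\<in>{1..R}. C j)" using finite_lists_length_eq[OF B(1)] by (auto simp: C_def)
        show "T \<subseteq> (\<Union>j\<in>{1..R}. C j)"
        proof
          fix xs assume x: "xs \<in> T"
          then have "length xs \<in> {1..R}" using R[OF x] by (cases xs) (auto simp: T_def)
          then show "xs \<in> (\<Union>j\<in>{1..R}. C j)" using x by (auto simp: C_def B_def)
        qed
        show "0 \<le> prod_list (map a xs)" if "xs \<in> (\<Union>j\<in>{1..R}. C j) - T" for xs
          using that B(2) by (intro pos) (auto simp: C_def)
      qed
      also have "\<dots> = (\<Sum>j\<in>{1..R}. \<Sum>xs\<in>C j. prod_list (map a xs))"
        using finite_lists_length_eq[OF B(1)] by (intro sum.UNION_disjoint) (auto simp: C_def)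
      also have "\<dots> = (\<Sum>j\<in>{1..R}. (\<Sum>x\<in>B. a x) ^ j)"
        unfolding C_def sum_prod_list_lists[OF B(1)] ..
      also have "\<dots> \<le> (\<Sum>j\<in>{1..R}. (1 / 2) ^ j)"
        using half[OF B] B(2) a by (intro sum_mono power_mono) (auto intro!: sum_nonneg)
      also have "\<dots> = 1 - (1 / 2) ^ R" by (induction R) auto
      also have "\<dots> \<le> (1 :: real)" by simp
      finally show ?thesis by (simp add: ennreal_le_1)
    qed
    finally show ?thesis .
  qed
  then show ?thesis by (subst suminf_eq_SUP) (rule SUP_least)
qed

lemma le_add_INF:
  fixes a b :: ereal
  assumes "b \<ge> 0" "\<And>s. s \<in> S \<Longrightarrow> f s \<ge> 0" "\<And>s. s \<in> S \<Longrightarrow> a \<le> b + f s"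
  shows "a \<le> b + (INF s\<in>S. f s)"
proof (cases "b = \<infinity>")
  case False
  then obtain r where b: "b = ereal r" using assms(1) by (cases b) auto
  have "a - b \<le> (INF s\<in>S. f s)"
    by (rule INF_greatest) (use assms(3) b in \<open>simp add: ereal_minus_le add.commute\<close>)
  then show ?thesis using b by (simp add: ereal_minus_le add.commute)
qed simp

text \<open>
  Infima over finitely many independent choices may be taken one by one.
\<close>

lemma le_add_sum_INF:
  fixes a b :: ereal
  assumes "finite A" "b \<ge> 0" "\<And>i m. i \<in> A \<Longrightarrow> m \<in> S \<Longrightarrow> f i m \<ge> 0"
    and "\<And>s. (\<And>i. i \<in> A \<Longrightarrow> s i \<in> S) \<Longrightarrow> a \<le> b + (\<Sum>i\<in>A. f i (s i))"
  shows "a \<le> b + (\<Sum>i\<in>A. INF m\<in>S. f i m)"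
  using assms
proof (induction A arbitrary: b rule: finite_induct)
  case (insert i A)
  have nn: "0 \<le> (\<Sum>i\<in>A. INF m\<in>S. f i m)"
    using insert.prems(2) by (intro sum_nonneg INF_greatest) auto
  have "a \<le> (b + (\<Sum>i\<in>A. INF m\<in>S. f i m)) + (INF m\<in>S. f i m)"
  proof (rule le_add_INF)
    show "0 \<le> b + (\<Sum>i\<in>A. INF m\<in>S. f i m)" using nn insert.prems(1) by simp
    show "0 \<le> f i m" if "m \<in> S" for m using insert.prems(2) that by simp
    fix m assume m: "m \<in> S"
    have "a \<le> (b + f i m) + (\<Sum>i\<in>A. INF m\<in>S. f i m)"
    proof (rule insert.IH)
      show "0 \<le> b + f i m" using insert.prems(1,2) m by simp
      show "0 \<le> f i' m'" if "i' \<in> A" "m' \<in> S" for i' m' using insert.prems(2) that by simp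
      fix s assume s: "\<And>i. i \<in> A \<Longrightarrow> s i \<in> S"
      have "a \<le> b + (\<Sum>i'\<in>insert i A. f i' ((s(i := m)) i'))"
        by (rule insert.prems(3)) (use s m in auto)
      also have "(\<Sum>i'\<in>insert i A. f i' ((s(i := m)) i')) = f i m + (\<Sum>i'\<in>A. f i' (s i'))"
        using insert.hyps by (simp cong: sum.cong) (intro arg_cong2[where f = "(+)"] sum.cong; auto)
      finally show "a \<le> (b + f i m) + (\<Sum>i\<in>A. f i (s i))" by (simp only: add.assoc)
    qed
    then show "a \<le> b + (\<Sum>i\<in>A. INF m\<in>S. f i m) + f i m" by (simp only: add.assoc add.commute add.left_commute)
  qed
  then show ?case
    by (subst sum.insert[OF insert.hyps]) (simp only: add.assoc add.commute add.left_commute)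
qed simp

text \<open>
  The density \<open>e\<close> is the value for functions of integral 0.
\<close>

definition normalise :: "'c measure \<Rightarrow> ('c \<Rightarrow> real) \<Rightarrow> ('c \<Rightarrow> real) \<Rightarrow> 'c \<Rightarrow> real" where
  "normalise L e f = (if (\<integral>x. f x \<partial>L) = 0 then e else (\<lambda>x. f x / (\<integral>x. f x \<partial>L)))"

lemma hellinger2_triangle:
  assumes [measurable]: "f \<in> borel_measurable L" "g \<in> borel_measurable L" "h \<in> borel_measurable L"
  shows "hellinger2 L f h \<le> 2 * hellinger2 L f g + 2 * hellinger2 L g h"
proof -
  have sq: "(x - z)\<^sup>2 \<le> 2 * (x - y)\<^sup>2 + 2 * (y - z)\<^sup>2" for x y z :: real
    using zero_le_power2[of "(x - y) - (y - z)"] by (simp add: power2_eq_square algebra_simps)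
  have "(\<integral>\<^sup>+x. ennreal ((sqrt (f x) - sqrt (h x))\<^sup>2) \<partial>L)
    \<le> (\<integral>\<^sup>+x. 2 * ennreal ((sqrt (f x) - sqrt (g x))\<^sup>2) + 2 * ennreal ((sqrt (g x) - sqrt (h x))\<^sup>2) \<partial>L)"
  proof (rule nn_integral_mono)
    fix x
    have "ennreal ((sqrt (f x) - sqrt (h x))\<^sup>2) \<le> ennreal (2 * (sqrt (f x) - sqrt (g x))\<^sup>2 + 2 * (sqrt (g x) - sqrt (h x))\<^sup>2)"
      by (rule ennreal_leI) (rule sq)
    also have "\<dots> = 2 * ennreal ((sqrt (f x) - sqrt (g x))\<^sup>2) + 2 * ennreal ((sqrt (g x) - sqrt (h x))\<^sup>2)"
      by (simp add: ennreal_mult)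
    finally show "ennreal ((sqrt (f x) - sqrt (h x))\<^sup>2)
      \<le> 2 * ennreal ((sqrt (f x) - sqrt (g x))\<^sup>2) + 2 * ennreal ((sqrt (g x) - sqrt (h x))\<^sup>2)" .
  qed
  also have "\<dots> = 2 * (\<integral>\<^sup>+x. ennreal ((sqrt (f x) - sqrt (g x))\<^sup>2) \<partial>L) + 2 * (\<integral>\<^sup>+x. ennreal ((sqrt (g x) - sqrt (h x))\<^sup>2) \<partial>L)"
    by (subst nn_integral_add) (auto simp: nn_integral_cmult)
  finally have "ennreal (1 / 2) * (\<integral>\<^sup>+x. ennreal ((sqrt (f x) - sqrt (h x))\<^sup>2) \<partial>L)
    \<le> ennreal (1 / 2) * (2 * (\<integral>\<^sup>+x. ennreal ((sqrt (f x) - sqrt (g x))\<^sup>2) \<partial>L) + 2 * (\<integral>\<^sup>+x. ennreal ((sqrt (g x) - sqrt (h x))\<^sup>2) \<partial>L))"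
    by (rule mult_left_mono) simp
  then show ?thesis unfolding hellinger2_def by (simp only: distrib_left mult.left_commute)
qed

text \<open>
  Let $r = \sqrt{\int f}$. Up to the factor $1/2$, normalisation moves $f$ by
  $\|\sqrt f - \sqrt f/r\|^2 = (1-r)^2$, and $\|\sqrt P-\sqrt f\| \ge |1-r|$ for a density $P$. So $f$ is moved by at most its
  distance to $P$, and the triangle inequality costs a factor 4. Adding the missing mass at one point would not do: it
  moves $f$ by the order of $1-r$ instead of its square.
\<close>

lemma normalise:
  assumes e: "is_density L e"
    and f [measurable]: "f \<in> borel_measurable L" and f0: "\<And>x. f x \<ge> 0" and f1: "(\<integral>\<^sup>+x. ennreal (f x) \<partial>L) \<le> 1"
  shows "is_density L (normalise L e f)"
    and "is_density L P \<Longrightarrow> hellinger2 L P (normalise L e f) \<le> 4 * hellinger2 L P f"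
proof -
  have fi: "integrable L f" by (rule integrableI_nonneg) (use f0 f1 in \<open>auto simp: le_less_trans\<close>)
  define s where "s = (\<integral>x. f x \<partial>L)"
  have s0: "s \<ge> 0" using f0 by (simp add: s_def)
  have nf: "(\<integral>\<^sup>+x. ennreal (f x) \<partial>L) = ennreal s" unfolding s_def by (rule nn_integral_eq_integral[OF fi]) (use f0 in auto)
  have N: "normalise L e f = (if s = 0 then e else (\<lambda>x. f x / s))" by (simp add: normalise_def s_def)
  show d: "is_density L (normalise L e f)"
  proof (cases "s = 0")
    case False
    then have s: "s > 0" using s0 by simp
    have "(\<integral>\<^sup>+x. ennreal (f x / s) \<partial>L) = (\<integral>\<^sup>+x. ennreal (1 / s) * ennreal (f x) \<partial>L)"
      using s f0 by (intro nn_integral_cong) (simp flip: ennreal_mult)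
    also have "\<dots> = ennreal (1 / s) * ennreal s" by (subst nn_integral_cmult) (auto simp: nf)
    also have "\<dots> = 1" using s by (simp flip: ennreal_mult)
    finally show ?thesis using s f0 by (simp add: N is_density_def)
  qed (simp add: N e)
  assume P: "is_density L P"
  note Pd = is_densityD[OF P]
  note [measurable] = Pd(1)
  have i: "integrable L (\<lambda>x. (sqrt (P x) - sqrt (f x))\<^sup>2)"
  proof (rule Bochner_Integration.integrable_bound[where f = "\<lambda>x. P x + f x"])
    show "AE x in L. norm ((sqrt (P x) - sqrt (f x))\<^sup>2) \<le> norm (P x + f x)"
    proof (rule AE_I2)
      fix x assume "x \<in> space L"
      then have nn: "0 \<le> P x" "0 \<le> f x" using Pd(2) f0 by auto
      then have "(sqrt (P x) - sqrt (f x))\<^sup>2 \<le> P x + f x" by (simp add: power2_diff)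
      then show "norm ((sqrt (P x) - sqrt (f x))\<^sup>2) \<le> norm (P x + f x)" using nn by simp
    qed
  qed (use Pd fi in auto)
  define h where "h = (\<integral>x. (sqrt (P x) - sqrt (f x))\<^sup>2 \<partial>L)"
  have h0: "h \<ge> 0" by (simp add: h_def)
  have hf: "hellinger2 L P f = ennreal (h / 2)"
    unfolding hellinger2_def h_def by (subst nn_integral_eq_integral[OF i], simp, subst ennreal_mult[symmetric]) auto
  define r where "r = sqrt s"
  have r: "r \<ge> 0" "r\<^sup>2 = s" using s0 by (auto simp: r_def)
  have low: "(1 - r)\<^sup>2 \<le> h"
  proof (cases "r = 0")
    case True
    then have "s = 0" using r by simp
    then have "AE x in L. f x = 0"
      using fi f0 by (subst (asm) s_def, subst (asm) integral_nonneg_eq_0_iff_AE) auto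
    then have "AE x in L. (sqrt (P x) - sqrt (f x))\<^sup>2 = P x"
      using AE_space by eventually_elim (use Pd(2) in auto)
    then have "h = (\<integral>x. P x \<partial>L)"
      unfolding h_def by (intro integral_cong_AE) auto
    then show ?thesis using True Pd(4) by simp
  next
    case False
    then have rp: "r > 0" using r by simp
    have "(\<integral>x. (1 - r) * P x + (1 - 1 / r) * f x \<partial>L) \<le> h"
      unfolding h_def
    proof (rule integral_mono[OF _ i])
      show "integrable L (\<lambda>x. (1 - r) * P x + (1 - 1 / r) * f x)" using Pd fi by simp
      fix x assume "x \<in> space L"
      then have nn: "0 \<le> P x" "0 \<le> f x" using Pd f0 by auto
      define a b where "a = sqrt (P x)" and "b = sqrt (f x)"
      have ab: "P x = a\<^sup>2" "f x = b\<^sup>2" using nn by (auto simp: a_def b_def)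
      have "0 \<le> (r * a - b)\<^sup>2 / r" using rp by simp
      also have "\<dots> = (a - b)\<^sup>2 - ((1 - r) * a\<^sup>2 + (1 - 1 / r) * b\<^sup>2)"
        using rp by (simp add: power2_eq_square field_simps)
      finally have "(1 - r) * a\<^sup>2 + (1 - 1 / r) * b\<^sup>2 \<le> (a - b)\<^sup>2" by simp
      then show "(1 - r) * P x + (1 - 1 / r) * f x \<le> (sqrt (P x) - sqrt (f x))\<^sup>2"
        unfolding ab[symmetric] unfolding a_def b_def .
    qed
    also have "(\<integral>x. (1 - r) * P x + (1 - 1 / r) * f x \<partial>L) = (1 - r) * 1 + (1 - 1 / r) * s"
      using Pd fi by (simp add: s_def[symmetric])
    also have "\<dots> = (1 - r)\<^sup>2" unfolding r(2)[symmetric] using rp by (simp add: power2_eq_square field_simps)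
    finally show ?thesis by simp
  qed
  show "hellinger2 L P (normalise L e f) \<le> 4 * hellinger2 L P f"
  proof (cases "s = 0")
    case True
    then have "1 \<le> h" using low by (simp add: r_def)
    have "hellinger2 L P (normalise L e f) = ennreal (hell L P (normalise L e f))"
      by (rule hellinger2_hell(1)[OF P d])
    also have "\<dots> \<le> ennreal (4 * (h / 2))" using hellinger2_hell(3)[OF P d] \<open>1 \<le> h\<close> by (intro ennreal_leI) simp
    also have "\<dots> = 4 * hellinger2 L P f" unfolding hf using h0 by (subst ennreal_mult) auto
    finally show ?thesis .
  next
    case False
    then have s: "s > 0" using s0 by simp
    then have rp: "r > 0" by (simp add: r_def)
    have m: "normalise L e f \<in> borel_measurable L" using d by (simp add: is_density_def)
    have "hellinger2 L f (normalise L e f) \<le> hellinger2 L P f"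
    proof -
      have pw: "(sqrt (f x) - sqrt (normalise L e f x))\<^sup>2 = (1 - 1 / r)\<^sup>2 * f x" for x
      proof -
        have "sqrt (normalise L e f x) = sqrt (f x) / r" using False by (simp add: N real_sqrt_divide r_def)
        then have "sqrt (f x) - sqrt (normalise L e f x) = (1 - 1 / r) * sqrt (f x)" by (simp add: algebra_simps)
        then show ?thesis using f0[of x] by (simp add: power_mult_distrib)
      qed
      have "(\<integral>\<^sup>+x. ennreal ((sqrt (f x) - sqrt (normalise L e f x))\<^sup>2) \<partial>L) = ennreal ((1 - 1 / r)\<^sup>2) * ennreal s"
        unfolding pw nf[symmetric] using f0 by (subst nn_integral_cmult[symmetric]) (auto simp: ennreal_mult intro!: nn_integral_cong)
      also have "\<dots> = ennreal ((1 - 1 / r)\<^sup>2 * s)" using s0 by (simp add: ennreal_mult)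
      also have "(1 - 1 / r)\<^sup>2 * s = (1 - r)\<^sup>2"
        unfolding r(2)[symmetric] using rp by (simp add: power2_eq_square field_simps)
      also have "ennreal \<dots> \<le> ennreal h" using low by (rule ennreal_leI)
      finally have "ennreal (1 / 2) * (\<integral>\<^sup>+x. ennreal ((sqrt (f x) - sqrt (normalise L e f x))\<^sup>2) \<partial>L) \<le> ennreal (1 / 2) * ennreal h"
        by (rule mult_left_mono) simp
      also have "\<dots> = hellinger2 L P f" unfolding hf using h0 by (subst ennreal_mult[symmetric]) auto
      finally show ?thesis unfolding hellinger2_def .
    qed
    then have "2 * hellinger2 L P f + 2 * hellinger2 L f (normalise L e f) \<le> 2 * hellinger2 L P f + 2 * hellinger2 L P f"
      by (intro add_mono mult_left_mono) auto
    also have "\<dots> = 4 * hellinger2 L P f"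
    proof -
      have "2 * x + 2 * x = (2 + 2) * x" for x :: ennreal by (simp only: distrib_right)
      then show ?thesis by simp
    qed
    finally show ?thesis using hellinger2_triangle[OF Pd(1) f m] by (rule order_trans[rotated])
  qed
qed

section \<open>The family of candidates\<close>

lemma near_minimiser:
  fixes f :: "'x \<Rightarrow> real"
  assumes "S \<noteq> {}" "\<And>x. x \<in> S \<Longrightarrow> f x \<ge> 0" "e > 0"
  shows "\<exists>x\<in>S. \<forall>y\<in>S. f x \<le> f y + e"
proof -
  have bdd: "bdd_below (f ` S)" using assms(2) by (intro bdd_belowI[of _ 0]) auto
  have "Inf (f ` S) < Inf (f ` S) + e" using assms(3) by simp
  then obtain x where x: "x \<in> S" "f x < Inf (f ` S) + e"
    using cInf_lessD[of "f ` S"] assms(1) by blast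
  have "f x \<le> f y + e" if "y \<in> S" for y
    using x(2) cInf_lower[OF imageI[OF that, of f] bdd] by linarith
  then show ?thesis using x(1) by blast
qed

locale oracle_setting = embedding \<mu> \<nu> \<iota>
  for \<mu> :: "'a measure" and \<nu> :: "'b measure" and \<iota> :: "'a \<Rightarrow> 'b" +
  fixes n :: nat and M :: "nat set" and H :: "nat \<Rightarrow> ('b \<Rightarrow> complex) set" and p :: "nat \<Rightarrow> real"
  assumes n: "n \<ge> 2"
    and compact: "\<And>m. m \<in> M \<Longrightarrow> compactin (l2_topology \<nu>) (H m)"
    and subprob: "subprobability M p"
begin

abbreviation net :: "nat \<Rightarrow> ('b \<Rightarrow> complex) set" where
  "net m \<equiv> max_separated \<nu> (H m) (1 / sqrt (real n))"

definition net_point :: "nat \<Rightarrow> nat \<Rightarrow> 'b \<Rightarrow> complex" where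
  "net_point m = (SOME h. bij_betw h {0..<card (net m)} (net m))"

definition codes :: "(nat \<times> nat \<times> nat) set" where
  "codes = {(m, l, g). m \<in> M \<and> p m > 0 \<and> H m \<noteq> {} \<and> l < card (net m) \<and> g \<le> n}"

text \<open>
  The division by $2(n+1)$ instead of $n+1$, the number of grid points, makes the total weight of the codes at most
  $1/2$, as \<open>list_weights_sum_le\<close> requires.
\<close>

definition code_weight :: "nat \<times> nat \<times> nat \<Rightarrow> real" where
  "code_weight = (\<lambda>(m, l, g). p m / (real (card (net m)) * (2 * (real n + 1))))"

text \<open>
  The entries of a list are counted from 0, the functions and coefficients from 1.
\<close>

definition code_function :: "(nat \<times> nat \<times> nat) list \<Rightarrow> nat \<Rightarrow> 'b \<Rightarrow> complex" where
  "code_function \<tau> i = (case \<tau> ! (i - 1) of (m, l, g) \<Rightarrow> net_point m l)"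

definition code_level :: "(nat \<times> nat \<times> nat) list \<Rightarrow> nat \<Rightarrow> real" where
  "code_level \<tau> i = (if 1 \<le> i \<and> i \<le> length \<tau> then (case \<tau> ! (i - 1) of (m, l, g) \<Rightarrow> real g / real n) else 0)"

definition code_error :: "(nat \<times> nat \<times> nat) list \<Rightarrow> (nat \<Rightarrow> 'b \<Rightarrow> complex) \<Rightarrow> real" where
  "code_error \<tau> \<Phi> = (\<Sum>i=1..length \<tau>. l2_dist2 \<nu> (\<Phi> i) (code_function \<tau> i))"

text \<open>
  An orthonormal sequence almost nearest to the coded functions. The slack $1/n$ is of the order of the bound, and with
  it the existence of such a sequence is immediate from the definition of an infimum.
\<close>

definition code_basis :: "(nat \<times> nat \<times> nat) list \<Rightarrow> nat \<Rightarrow> 'b \<Rightarrow> complex" where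
  "code_basis \<tau> = (SOME \<Phi>. \<Phi> \<in> orthonormal_seqs \<nu> \<and>
     (\<forall>\<Phi>'\<in>orthonormal_seqs \<nu>. code_error \<tau> \<Phi> \<le> code_error \<tau> \<Phi>' + 1 / real n))"

definition code_mixture :: "(nat \<times> nat \<times> nat) list \<Rightarrow> 'a set \<Rightarrow> real" where
  "code_mixture \<tau> = mixed_det_density \<iota> (code_basis \<tau>) (code_level \<tau>)"

definition candidate :: "(nat \<times> nat \<times> nat) list \<Rightarrow> 'a set \<Rightarrow> real" where
  "candidate \<tau> = normalise L (indicator {{}}) (code_mixture \<tau>)"

definition code_indices :: "nat set" where
  "code_indices = to_nat ` {\<tau>. \<tau> \<noteq> [] \<and> set \<tau> \<subseteq> codes}"

lemma net_finite: "m \<in> M \<Longrightarrow> finite (net m)" and net_subset: "m \<in> M \<Longrightarrow> net m \<subseteq> H m"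
  and net_approximates: "m \<in> M \<Longrightarrow> \<psi> \<in> H m \<Longrightarrow> \<exists>\<psi>'\<in>net m. l2_norm \<nu> (\<lambda>x. \<psi> x - \<psi>' x) \<le> 1 / sqrt (real n)"
  using max_separated_net[OF compact, of m "1 / sqrt (real n)"] n by auto

lemma H_l2: "m \<in> M \<Longrightarrow> H m \<subseteq> l2_space \<nu>"
  using compactin_subset_topspace[OF compact] by (simp add: topspace_l2_topology)

lemma net_point: "m \<in> M \<Longrightarrow> bij_betw (net_point m) {0..<card (net m)} (net m)"
  unfolding net_point_def by (rule someI_ex[OF ex_bij_betw_nat_finite[OF net_finite]])

lemma code_nth:
  assumes "set \<tau> \<subseteq> codes" "i \<in> {1..length \<tau>}"
  shows "\<tau> ! (i - 1) \<in> codes"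
proof -
  have "i - 1 < length \<tau>" using assms(2) by auto
  then show ?thesis using assms(1) nth_mem by blast
qed

lemma code_function_l2:
  assumes "set \<tau> \<subseteq> codes" "i \<in> {1..length \<tau>}"
  shows "code_function \<tau> i \<in> l2_space \<nu>"
proof -
  obtain m l g where c: "\<tau> ! (i - 1) = (m, l, g)" by (cases "\<tau> ! (i - 1)")
  then have m: "m \<in> M" "l < card (net m)" using code_nth[OF assms] by (auto simp: codes_def)
  then have "net_point m l \<in> net m" using net_point[OF m(1)] by (auto simp: bij_betw_def)
  then show ?thesis using net_subset[OF m(1)] H_l2[OF m(1)] unfolding code_function_def c by auto
qed

lemma code_level_Lambda:
  assumes "set \<tau> \<subseteq> codes"
  shows "code_level \<tau> \<in> Lambda" "i > length \<tau> \<Longrightarrow> code_level \<tau> i = 0"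
proof -
  show 0: "code_level \<tau> i = 0" if "i > length \<tau>" for i using that by (simp add: code_level_def)
  have "0 \<le> code_level \<tau> i \<and> code_level \<tau> i \<le> 1" for i
  proof (cases "i \<in> {1..length \<tau>}")
    case True
    obtain m l g where c: "\<tau> ! (i - 1) = (m, l, g)" by (cases "\<tau> ! (i - 1)")
    then have "g \<le> n" using code_nth[OF assms True] by (auto simp: codes_def)
    then show ?thesis using c n True by (auto simp: code_level_def)
  next
    case False
    then show ?thesis by (auto simp: code_level_def)
  qed
  moreover have "(\<lambda>j. (code_level \<tau> j)\<^sup>2) summable_on {1..}"
  proof -
    have "(\<lambda>j. (code_level \<tau> j)\<^sup>2) summable_on {1..length \<tau>}" by (rule summable_on_finite) simp
    then show ?thesis by (rule summable_on_cong_neutral[THEN iffD1, rotated -1]) (use 0 in auto)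
  qed
  ultimately show "code_level \<tau> \<in> Lambda" by (simp add: Lambda_def)
qed

lemma code_basis:
  assumes "orthonormal_seqs \<nu> \<noteq> {}"
  shows "code_basis \<tau> \<in> orthonormal_seqs \<nu>"
    and "\<Phi> \<in> orthonormal_seqs \<nu> \<Longrightarrow> code_error \<tau> (code_basis \<tau>) \<le> code_error \<tau> \<Phi> + 1 / real n"
proof -
  have "\<exists>\<Phi>\<in>orthonormal_seqs \<nu>. \<forall>\<Phi>'\<in>orthonormal_seqs \<nu>. code_error \<tau> \<Phi> \<le> code_error \<tau> \<Phi>' + 1 / real n"
    by (rule near_minimiser[OF assms]) (use n in \<open>auto simp: code_error_def intro!: sum_nonneg\<close>)
  then have "\<exists>\<Phi>. \<Phi> \<in> orthonormal_seqs \<nu> \<and> (\<forall>\<Phi>'\<in>orthonormal_seqs \<nu>. code_error \<tau> \<Phi> \<le> code_error \<tau> \<Phi>' + 1 / real n)"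
    by blast
  from someI_ex[OF this, folded code_basis_def]
  show "code_basis \<tau> \<in> orthonormal_seqs \<nu>"
    and "\<Phi> \<in> orthonormal_seqs \<nu> \<Longrightarrow> code_error \<tau> (code_basis \<tau>) \<le> code_error \<tau> \<Phi> + 1 / real n"
    by blast+
qed

lemma empty_density: "is_density L (indicator {{}})"
proof -
  note E = emeasure_config_measure_empty[OF \<mu>]
  have "(\<integral>\<^sup>+\<alpha>. ennreal (indicator {{}} \<alpha>) \<partial>L) = (\<integral>\<^sup>+\<alpha>. indicator {{}} \<alpha> \<partial>L)"
    by (simp only: ennreal_indicator)
  also have "\<dots> = 1" using nn_integral_indicator[OF E(1)] E(2) by simp
  finally show ?thesis using borel_measurable_indicator[OF E(1)] by (simp add: is_density_def)
qed

lemma code_mixture: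
  assumes "orthonormal_seqs \<nu> \<noteq> {}" "set \<tau> \<subseteq> codes"
  shows "code_mixture \<tau> \<in> borel_measurable L" "code_mixture \<tau> \<alpha> \<ge> 0" "(\<integral>\<^sup>+\<alpha>. ennreal (code_mixture \<tau> \<alpha>) \<partial>L) \<le> 1"
  unfolding code_mixture_def
  using code_basis(1)[OF assms(1)] code_level_Lambda(1)[OF assms(2)]
  by (auto intro: mixed_det_density_measurable mixed_det_density_nonneg mixed_det_density_mass)

lemma candidate:
  assumes "orthonormal_seqs \<nu> \<noteq> {}" "set \<tau> \<subseteq> codes"
  shows "is_density L (candidate \<tau>)"
    and "is_density L P \<Longrightarrow> hellinger2 L P (candidate \<tau>) \<le> 4 * hellinger2 L P (code_mixture \<tau>)"
  unfolding candidate_def using normalise[OF empty_density code_mixture[OF assms]] by auto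

lemma code_weight_pos: "c \<in> codes \<Longrightarrow> code_weight c > 0"
  by (auto simp: codes_def code_weight_def intro!: divide_pos_pos mult_pos_pos)

lemma code_weight_sum:
  assumes "finite B" "B \<subseteq> codes"
  shows "(\<Sum>c\<in>B. code_weight c) \<le> 1 / 2"
proof -
  define F where "F = fst ` B"
  have F: "finite F" "F \<subseteq> M" using assms by (auto simp: F_def codes_def)
  have p0: "p m \<ge> 0" if "m \<in> M" for m using subprob that by (simp add: subprobability_def)
  \<comment> \<open>A finite set of triples containing \<open>B\<close> over which the sum factorises.\<close>
  define D where "D = (SIGMA m:{m\<in>F. card (net m) > 0}. {..<card (net m)} \<times> {..n})"
  have D: "finite D" using F by (auto simp: D_def)
  have nn: "code_weight c \<ge> 0" if "c \<in> D" for c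
    using that F p0 by (auto simp: D_def code_weight_def)
  have "(\<Sum>c\<in>B. code_weight c) \<le> (\<Sum>c\<in>D. code_weight c)"
    using D nn assms(2) by (intro sum_mono2) (force simp: D_def F_def codes_def)+
  also have "\<dots> = (\<Sum>m\<in>{m\<in>F. card (net m) > 0}. \<Sum>(l, g)\<in>{..<card (net m)} \<times> {..n}. code_weight (m, l, g))"
    unfolding D_def using F by (subst sum.Sigma) (auto simp: case_prod_beta')
  also have "\<dots> = (\<Sum>m\<in>{m\<in>F. card (net m) > 0}. p m / 2)"
  proof (rule sum.cong[OF refl])
    fix m assume "m \<in> {m\<in>F. card (net m) > 0}"
    then have c: "real (card (net m)) > 0" by simp
    have "(\<Sum>(l, g)\<in>{..<card (net m)} \<times> {..n}. code_weight (m, l, g))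
       = real (card (net m)) * (real n + 1) * (p m / (real (card (net m)) * (2 * (real n + 1))))"
    proof -
      have const: "(\<Sum>(l, g)\<in>{..<a} \<times> {..n}. b) = real a * (real n + 1) * b" for a and b :: real
        by (simp add: case_prod_beta' card_cartesian_product algebra_simps)
      show ?thesis unfolding code_weight_def prod.case by (rule const)
    qed
    also have "\<dots> = p m / 2"
    proof -
      have half: "x * y * (q / (x * (2 * y))) = q / 2" if "x > 0" "y > 0" for x y q :: real
        using that by simp
      show ?thesis by (rule half[OF c]) simp
    qed
    finally show "(\<Sum>(l, g)\<in>{..<card (net m)} \<times> {..n}. code_weight (m, l, g)) = p m / 2" .
  qed
  also have "\<dots> \<le> (\<Sum>m\<in>F. p m / 2)"
    using F p0 by (intro sum_mono2) auto
  also have "\<dots> = (\<Sum>m\<in>F. p m) / 2" by (simp add: sum_divide_distrib)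
  also have "(\<Sum>m\<in>F. p m) \<le> (\<Sum>\<^sub>\<infinity>m\<in>M. p m)"
    by (rule finite_sum_le_infsum) (use subprob F p0 in \<open>auto simp: subprobability_def\<close>)
  also have "(\<Sum>\<^sub>\<infinity>m\<in>M. p m) \<le> 1" using subprob by (simp add: subprobability_def)
  finally show ?thesis by simp
qed

lemma code_list_weight_pos: "set \<tau> \<subseteq> codes \<Longrightarrow> prod_list (map code_weight \<tau>) > 0"
  by (induction \<tau>) (auto simp: code_weight_pos)

lemma code_indexE:
  assumes "k \<in> code_indices"
  obtains \<tau> where "k = to_nat \<tau>" "from_nat k = \<tau>" "\<tau> \<noteq> []" "set \<tau> \<subseteq> codes"
  using assms by (auto simp: code_indices_def)

lemma selection:
  assumes "orthonormal_seqs \<nu> \<noteq> {}" "code_indices \<noteq> {}"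
  shows "density_selection L n code_indices (\<lambda>k. candidate (from_nat k)) (\<lambda>k. prod_list (map code_weight (from_nat k)))"
proof
  show "n \<ge> 1" using n by simp
  show "code_indices \<noteq> {}" by fact
  show "is_density L (candidate (from_nat k))" if "k \<in> code_indices" for k
    using that by (auto elim!: code_indexE intro!: candidate assms)
  show "prod_list (map code_weight (from_nat k)) > 0" if "k \<in> code_indices" for k
    using that by (auto elim!: code_indexE intro!: code_list_weight_pos)
  show "(\<Sum>k. if k \<in> code_indices then ennreal (prod_list (map code_weight (from_nat k))) else 0) \<le> 1"
    unfolding code_indices_def
    by (rule list_weights_sum_le[OF less_imp_le[OF code_weight_pos] code_weight_sum])
qed

definition cost :: "(nat \<Rightarrow> 'b \<Rightarrow> complex) \<Rightarrow> nat \<Rightarrow> nat \<Rightarrow> ereal" where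
  "cost \<Phi> i m = (INF \<psi>\<in>H m. ereal (l2_dist2 \<nu> (\<Phi> i) \<psi>)) +
        (if p m = 0 then \<infinity>
         else ereal (1 / real n * ln (real (card (net m)) * real n / p m)))"

lemma p_le_1:
  assumes "m \<in> M"
  shows "0 \<le> p m" "p m \<le> 1"
proof -
  show "0 \<le> p m" using subprob assms by (simp add: subprobability_def)
  have "(\<Sum>m\<in>{m}. p m) \<le> (\<Sum>\<^sub>\<infinity>m\<in>M. p m)"
    by (rule finite_sum_le_infsum) (use subprob assms in \<open>auto simp: subprobability_def\<close>)
  then show "p m \<le> 1" using subprob by (simp add: subprobability_def)
qed

lemma net_card_pos: "m \<in> M \<Longrightarrow> H m \<noteq> {} \<Longrightarrow> card (net m) > 0"
  using net_approximates[of m] net_finite[of m] by (force simp: card_gt_0_iff)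

lemma log_cost_ge:
  assumes "m \<in> M" "p m > 0" "H m \<noteq> {}"
  shows "1 / 2 \<le> ln (real (card (net m)) * real n / p m)"
proof -
  have "1 \<le> real (card (net m))" using net_card_pos[OF assms(1,3)] by simp
  then have "1 * 2 \<le> real (card (net m)) * real n" using n by (intro mult_mono) auto
  also have "\<dots> = real (card (net m)) * real n / 1" by simp
  also have "\<dots> \<le> real (card (net m)) * real n / p m"
    using p_le_1[OF assms(1)] assms(2) by (intro divide_left_mono) auto
  finally have "ln 2 \<le> ln (real (card (net m)) * real n / p m)" by (intro ln_mono) auto
  then show ?thesis using ln2_ge_two_thirds by linarith
qed

text \<open>
  The entry that encodes $\phi_i$ and its coefficient within the model $m$: a nearest point of the net, and the
  coefficient rounded down to the grid. A point of the net within $1/\sqrt n$ of $\psi \in H_m$ is at squared distance at most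
  $2\|\phi_i-\psi\|^2 + 2/n$ from $\phi_i$, whence the first summand of the lower bound on the cost.
\<close>

lemma cost_finite_code:
  assumes m: "m \<in> M" and fin: "cost \<Phi> i m \<noteq> \<infinity>" and \<Phi>: "\<Phi> i \<in> l2_space \<nu>" and x: "0 \<le> x" "x \<le> 1"
  obtains l g where "(m, l, g) \<in> codes"
    "ereal (max 0 ((l2_dist2 \<nu> (\<Phi> i) (net_point m l) - 2 / real n) / 2)
       + ln (real (card (net m)) * real n / p m) / real n) \<le> cost \<Phi> i m"
    "\<bar>x - real g / real n\<bar> \<le> 1 / real n"
proof -
  have pm: "p m > 0" using fin p_le_1(1)[OF m] by (cases "p m = 0") (auto simp: cost_def)
  have Hm: "H m \<noteq> {}" using fin by (auto simp: cost_def top_ereal_def)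
  note fnet = net_finite[OF m]
  have ne: "net m \<noteq> {}" using net_card_pos[OF m Hm] by auto
  obtain \<psi> where \<psi>: "\<psi> \<in> net m"
    "\<And>\<psi>'. \<psi>' \<in> net m \<Longrightarrow> l2_norm \<nu> (\<lambda>x. \<Phi> i x - \<psi> x) \<le> l2_norm \<nu> (\<lambda>x. \<Phi> i x - \<psi>' x)"
  proof
    let ?f = "\<lambda>\<psi>. l2_norm \<nu> (\<lambda>x. \<Phi> i x - \<psi> x)"
    show "arg_min_on ?f (net m) \<in> net m" by (rule arg_min_if_finite(1)[OF fnet ne])
    show "?f (arg_min_on ?f (net m)) \<le> ?f \<psi>'" if "\<psi>' \<in> net m" for \<psi>'
      by (rule arg_min_least[OF fnet ne that])
  qed
  define d where "d = l2_dist2 \<nu> (\<Phi> i) \<psi>"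
  have d: "(d - 2 / real n) / 2 \<le> l2_dist2 \<nu> (\<Phi> i) \<theta>" if \<theta>: "\<theta> \<in> H m" for \<theta>
  proof -
    obtain \<psi>' where \<psi>': "\<psi>' \<in> net m" "l2_norm \<nu> (\<lambda>x. \<theta> x - \<psi>' x) \<le> 1 / sqrt (real n)"
      using net_approximates[OF m \<theta>] by blast
    have l: "\<theta> \<in> l2_space \<nu>" "\<psi>' \<in> l2_space \<nu>" using \<theta> \<psi>'(1) net_subset[OF m] H_l2[OF m] by auto
    have "l2_dist2 \<nu> \<theta> \<psi>' \<le> (1 / sqrt (real n))\<^sup>2" using \<psi>'(2) by (intro power_mono) auto
    also have "\<dots> = 1 / real n" by (simp add: power_divide)
    finally have q: "l2_dist2 \<nu> \<theta> \<psi>' \<le> 1 / real n" .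
    have "d \<le> l2_dist2 \<nu> (\<Phi> i) \<psi>'"
      unfolding d_def using \<psi>(2)[OF \<psi>'(1)] by (intro power_mono) auto
    also have "\<dots> \<le> 2 * l2_dist2 \<nu> (\<Phi> i) \<theta> + 2 * l2_dist2 \<nu> \<theta> \<psi>'"
      by (rule l2_norm_diff_squared_le[OF \<Phi> l])
    finally show ?thesis using q by (simp add: field_simps)
  qed
  have "\<psi> \<in> net_point m ` {0..<card (net m)}"
    using net_point[OF m] \<psi>(1) unfolding bij_betw_def by simp
  then obtain l where l: "l < card (net m)" "net_point m l = \<psi>" by auto
  define g where "g = nat \<lfloor>x * real n\<rfloor>"
  have g0: "real g = of_int \<lfloor>x * real n\<rfloor>" using x by (simp add: g_def)
  have xn: "x * real n \<le> real n" using x by (simp add: mult_left_le_one_le)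
  have g1: "real g \<le> x * real n" "x * real n \<le> real g + 1" unfolding g0 by linarith+
  then have "g \<le> n" using xn by simp
  show ?thesis
  proof
    show "(m, l, g) \<in> codes" using m pm Hm l \<open>g \<le> n\<close> by (simp add: codes_def)
    have "\<bar>x * real n - real g\<bar> \<le> 1" using g1 by simp
    then have "\<bar>x * real n - real g\<bar> / real n \<le> 1 / real n" by (intro divide_right_mono) auto
    moreover have "\<bar>x * real n - real g\<bar> / real n = \<bar>x - real g / real n\<bar>"
    proof -
      have "x - real g / real n = (x * real n - real g) / real n" using n by (simp add: field_simps)
      then show ?thesis by (simp add: abs_divide)
    qed
    ultimately show "\<bar>x - real g / real n\<bar> \<le> 1 / real n" by simp
    have "ereal (max 0 ((d - 2 / real n) / 2)) \<le> (INF \<psi>\<in>H m. ereal (l2_dist2 \<nu> (\<Phi> i) \<psi>))"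
      by (rule INF_greatest) (use d in simp)
    then have "ereal (max 0 ((d - 2 / real n) / 2)) + ereal (1 / real n * ln (real (card (net m)) * real n / p m)) \<le> cost \<Phi> i m"
      unfolding cost_def using pm by (intro add_mono) auto
    moreover have "1 / real n * y = y / real n" for y by simp
    ultimately show "ereal (max 0 ((l2_dist2 \<nu> (\<Phi> i) (net_point m l) - 2 / real n) / 2)
       + ln (real (card (net m)) * real n / p m) / real n) \<le> cost \<Phi> i m"
      unfolding l(2) d_def by (simp only: plus_ereal.simps)
  qed
qed

end

context oracle_setting
begin

section \<open>The oracle inequality\<close>

text \<open>
  If there is no orthonormal sequence or no code, the right-hand side of the oracle inequality is infinite, and any
  density will do.
\<close>

definition estimator :: "(nat \<Rightarrow> 'a set) \<Rightarrow> 'a set \<Rightarrow> real" where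
  "estimator \<omega> = (if orthonormal_seqs \<nu> = {} \<or> code_indices = {} then indicator {{}}
     else candidate (from_nat (density_selection.best n code_indices (\<lambda>k. candidate (from_nat k))
       (\<lambda>k. prod_list (map code_weight (from_nat k))) \<omega>)))"

lemma estimator_is_density_estimator: "density_estimator \<mu> n estimator"
proof (cases "orthonormal_seqs \<nu> = {} \<or> code_indices = {}")
  case True
  then have e: "estimator = (\<lambda>_. indicator {{}})" by (simp add: estimator_def fun_eq_iff)
  have "(\<lambda>z. indicator {{}} (snd z) :: real) \<in> borel_measurable ((\<Pi>\<^sub>M _\<in>{1..n}. L) \<Otimes>\<^sub>M L)"
    by (rule measurable_compose[OF measurable_snd is_densityD(1)[OF empty_density]])
  then show ?thesis unfolding density_estimator_def e using empty_density by (simp add: case_prod_beta')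
next
  case False
  interpret S: density_selection L n code_indices "\<lambda>k. candidate (from_nat k)" "\<lambda>k. prod_list (map code_weight (from_nat k))"
    using selection False by blast
  have e: "estimator = (\<lambda>\<omega>. candidate (from_nat (S.best \<omega>)))" using False by (simp add: estimator_def fun_eq_iff)
  show ?thesis unfolding density_estimator_def e
    using S.estimator_measurable S.t[OF S.best(1)] by blast
qed

text \<open>
  Each entry contributes $\log(|H_m[1/\sqrt n]|\,n/\pi(m)) + \log(2(n+1)/n)$, and the second logarithm is at most 2.
\<close>

lemma code_list_penalty:
  assumes "\<And>i. i \<in> {1..j} \<Longrightarrow> c i \<in> codes"
  shows "ln (1 / prod_list (map code_weight (map c [1..<Suc j])))
    \<le> (\<Sum>i=1..j. ln (real (card (net (fst (c i)))) * real n / p (fst (c i))) + 2)"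
proof -
  have pos: "code_weight (c i) > 0" if "i \<in> {1..j}" for i using assms[OF that] by (rule code_weight_pos)
  have "prod_list (map code_weight (map c [1..<Suc j])) = (\<Prod>i\<in>set [1..<Suc j]. code_weight (c i))"
    by (subst prod.distinct_set_conv_list) (simp_all add: comp_def)
  also have "set [1..<Suc j] = {1..j}" by auto
  finally have e: "prod_list (map code_weight (map c [1..<Suc j])) = (\<Prod>i\<in>{1..j}. code_weight (c i))" .
  have "ln (1 / (\<Prod>i\<in>{1..j}. code_weight (c i))) = - (\<Sum>i\<in>{1..j}. ln (code_weight (c i)))"
  proof -
    have "ln (\<Prod>i\<in>{1..j}. code_weight (c i)) = (\<Sum>i\<in>{1..j}. ln (code_weight (c i)))"
    proof (rule ln_prod)
      show "code_weight (c i) \<noteq> 0" if "i \<in> {1..j}" for i using pos[OF that] by simp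
    qed simp
    moreover have "0 < (\<Prod>i\<in>{1..j}. code_weight (c i))" by (rule prod_pos) (rule pos)
    ultimately show ?thesis by (simp only: ln_divide_pos zero_less_one ln_one diff_0)
  qed
  also have "\<dots> = (\<Sum>i\<in>{1..j}. - ln (code_weight (c i)))" by (simp add: sum_negf)
  also have "\<dots> \<le> (\<Sum>i=1..j. ln (real (card (net (fst (c i)))) * real n / p (fst (c i))) + 2)"
  proof (rule sum_mono)
    fix i assume i: "i \<in> {1..j}"
    obtain m l g where c: "c i = (m, l, g)" by (cases "c i")
    then have m: "m \<in> M" "p m > 0" "l < card (net m)" using assms[OF i] by (auto simp: codes_def)
    define N where "N = real (card (net m))"
    have N: "N > 0" using m(3) by (simp add: N_def)
    have w: "code_weight (c i) = p m / (N * (2 * (real n + 1)))" by (simp add: code_weight_def c N_def)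
    have n0: "real n > 0" using n by simp
    have r: "1 / code_weight (c i) = (N * real n / p m) * (2 * (real n + 1) / real n)"
      unfolding w using N m(2) n0 by simp
    have "- ln (code_weight (c i)) = ln (1 / code_weight (c i))" using pos[OF i] by (subst ln_divide_pos) auto
    also have "\<dots> = ln (N * real n / p m) + ln (2 * (real n + 1) / real n)"
      unfolding r using N m(2) n0 by (intro ln_mult_pos) auto
    also have "ln (2 * (real n + 1) / real n) \<le> 2 * (real n + 1) / real n - 1"
      using n0 by (intro ln_le_minus_one) auto
    also have "2 * (real n + 1) / real n - 1 \<le> 2" using n by (simp add: field_simps)
    finally show "- ln (code_weight (c i)) \<le> ln (real (card (net (fst (c i)))) * real n / p (fst (c i))) + 2"
      by (simp add: c N_def)
  qed
  finally show ?thesis unfolding e .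
qed

text \<open>
  If \<open>\<Psi>\<close> is the orthonormal sequence of the code and $\chi$ the coded functions, then
  $\sum_i\|\phi_i-\psi_i\|^2 \le 2\sum_i\|\phi_i-\chi_i\|^2 + 2\sum_i\|\psi_i-\chi_i\|^2$, and the second sum exceeds the first
  by at most $1/n$, because \<open>\<Phi>\<close> competes in the minimisation defining \<open>\<Psi>\<close>.
\<close>

lemma candidate_distance:
  assumes \<Phi>: "\<Phi> \<in> orthonormal_seqs \<nu>" and lam: "lam \<in> Lambda" and \<tau>: "set \<tau> \<subseteq> codes"
    and P: "is_density L P" and x: "hellinger2 L P (mixed_det_density \<iota> \<Phi> lam) = ennreal x" "x \<ge> 0"
    and level: "\<And>i. i \<in> {1..length \<tau>} \<Longrightarrow> \<bar>lam i - code_level \<tau> i\<bar> \<le> 1 / real n"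
  shows "hell L P (candidate \<tau>) \<le> 8 * x + 16 * (\<Sum>\<^sub>\<infinity>i\<in>{length \<tau><..}. (lam i)\<^sup>2)
    + 24 * real (length \<tau>) / real n + 64 * code_error \<tau> \<Phi> + 32 / real n"
proof -
  have ne: "orthonormal_seqs \<nu> \<noteq> {}" using \<Phi> by auto
  let ?j = "length \<tau>" and ?T = "\<Sum>\<^sub>\<infinity>i\<in>{length \<tau><..}. (lam i)\<^sup>2"
  let ?e = "\<lambda>i. l2_dist2 \<nu> (\<Phi> i) (code_basis \<tau> i)"
  note B = code_basis[OF ne, where \<tau> = \<tau>]
  note kap = code_level_Lambda[OF \<tau>]
  have T: "0 \<le> ?T" by (rule infsum_nonneg) simp
  have phi_l2: "\<Psi> i \<in> l2_space \<nu>" if "\<Psi> \<in> orthonormal_seqs \<nu>" "i \<in> {1..?j}" for \<Psi> i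
    using that by (auto simp: orthonormal_seqs_def)
  have "(\<Sum>i=1..?j. ?e i) \<le> (\<Sum>i=1..?j. 2 * l2_dist2 \<nu> (\<Phi> i) (code_function \<tau> i)
       + 2 * l2_dist2 \<nu> (code_basis \<tau> i) (code_function \<tau> i))"
  proof (rule sum_mono)
    fix i assume i: "i \<in> {1..?j}"
    show "?e i \<le> 2 * l2_dist2 \<nu> (\<Phi> i) (code_function \<tau> i)
       + 2 * l2_dist2 \<nu> (code_basis \<tau> i) (code_function \<tau> i)"
      using l2_norm_diff_squared_le[OF phi_l2[OF \<Phi> i] code_function_l2[OF \<tau> i] phi_l2[OF B(1) i]]
      by (simp only: l2_norm_diff_commute[of \<nu> "code_function \<tau> i"])
  qed
  also have "\<dots> = 2 * code_error \<tau> \<Phi> + 2 * code_error \<tau> (code_basis \<tau>)"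
    unfolding code_error_def by (simp only: sum.distrib sum_distrib_left)
  also have "\<dots> \<le> 4 * code_error \<tau> \<Phi> + 2 / real n" using B(2)[OF \<Phi>] by simp
  finally have E: "(\<Sum>i=1..?j. ?e i) \<le> 4 * code_error \<tau> \<Phi> + 2 / real n" .
  have lv: "(\<Sum>i=1..?j. \<bar>lam i - code_level \<tau> i\<bar>) \<le> real ?j / real n"
    using sum_mono[of "{1..?j}" "\<lambda>i. \<bar>lam i - code_level \<tau> i\<bar>" "\<lambda>_. 1 / real n", OF level] by simp
  define y where "y = (4 * ?T + (\<Sum>i=1..?j. 6 * \<bar>lam i - code_level \<tau> i\<bar> + 4 * ?e i)) / 2"
  have y0: "y \<ge> 0" unfolding y_def using T by (auto intro!: add_nonneg_nonneg sum_nonneg)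
  have yle: "y \<le> 2 * ?T + 3 * (real ?j / real n) + 2 * (4 * code_error \<tau> \<Phi> + 2 / real n)"
  proof -
    have "(\<Sum>i=1..?j. 6 * \<bar>lam i - code_level \<tau> i\<bar> + 4 * ?e i)
       = 6 * (\<Sum>i=1..?j. \<bar>lam i - code_level \<tau> i\<bar>) + 4 * (\<Sum>i=1..?j. ?e i)"
      by (simp only: sum.distrib sum_distrib_left)
    then show ?thesis unfolding y_def using E lv by argo
  qed
  have "hellinger2 L (mixed_det_density \<iota> \<Phi> lam) (code_mixture \<tau>)
     \<le> ennreal (1 / 2) * ennreal (4 * ?T + (\<Sum>i=1..?j. 6 * \<bar>lam i - code_level \<tau> i\<bar> + 4 * ?e i))"
    unfolding hellinger2_def code_mixture_def
    by (intro mult_left_mono mixture_distance \<Phi> B(1) lam kap) auto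
  also have "\<dots> = ennreal y" unfolding y_def by (subst ennreal_mult'[symmetric]) auto
  finally have 1: "hellinger2 L (mixed_det_density \<iota> \<Phi> lam) (code_mixture \<tau>) \<le> ennreal y" .
  have "hellinger2 L P (code_mixture \<tau>)
     \<le> 2 * hellinger2 L P (mixed_det_density \<iota> \<Phi> lam) + 2 * hellinger2 L (mixed_det_density \<iota> \<Phi> lam) (code_mixture \<tau>)"
    by (intro hellinger2_triangle is_densityD(1)[OF P] mixed_det_density_measurable \<Phi> lam code_mixture ne \<tau>)
  also have "\<dots> \<le> 2 * ennreal x + 2 * ennreal y"
    unfolding x by (intro add_mono mult_left_mono 1) auto
  also have "\<dots> = ennreal (2 * x + 2 * y)" using x(2) y0 by (simp add: ennreal_mult)
  finally have 2: "hellinger2 L P (code_mixture \<tau>) \<le> ennreal (2 * x + 2 * y)" .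
  have "ennreal (hell L P (candidate \<tau>)) = hellinger2 L P (candidate \<tau>)"
    by (rule hellinger2_hell(1)[OF P candidate(1)[OF ne \<tau>], symmetric])
  also have "\<dots> \<le> 4 * hellinger2 L P (code_mixture \<tau>)" by (rule candidate(2)[OF ne \<tau> P])
  also have "\<dots> \<le> 4 * ennreal (2 * x + 2 * y)" by (intro mult_left_mono 2) auto
  also have "\<dots> = ennreal (4 * (2 * x + 2 * y))" using x(2) y0 by (subst ennreal_mult) auto
  finally have "hell L P (candidate \<tau>) \<le> 4 * (2 * x + 2 * y)"
    using x(2) y0 by (subst (asm) ennreal_le_iff) auto
  also have "\<dots> \<le> 8 * x + 16 * ?T + 24 * real ?j / real n + 64 * code_error \<tau> \<Phi> + 32 / real n"
    using yle by argo
  finally show ?thesis .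
qed

lemma cost_nonneg: "m \<in> M \<Longrightarrow> cost \<Phi> i m \<ge> 0"
proof -
  assume m: "m \<in> M"
  have I: "0 \<le> (INF \<psi>\<in>H m. ereal (l2_dist2 \<nu> (\<Phi> i) \<psi>))" by (rule INF_greatest) simp
  consider "p m = 0" | "H m = {}" "p m \<noteq> 0" | "p m > 0" "H m \<noteq> {}" using p_le_1(1)[OF m] by fastforce
  then show ?thesis
  proof cases
    case 1
    then show ?thesis using I by (simp add: cost_def)
  next
    case 2
    then show ?thesis by (simp add: cost_def top_ereal_def)
  next
    case 3
    then have "0 \<le> 1 / real n * ln (real (card (net m)) * real n / p m)" using log_cost_ge[OF m 3] by simp
    then show ?thesis using I 3 by (simp add: cost_def)
  qed
qed

text \<open>
  Each of the $j \ge 1$ entries contributes a logarithm of at least $1/2$ to the right-hand side, and these pay for all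
  terms of order $j/n$ and $1/n$: from grid, net, orthonormalisation, penalties and selection.
  Together they amount to at most $44268\,j/n \le 88536\,B/n$, where $B$ is the sum of the logarithms; the penalties add $36\,B/n$, and
  all other factors are below $10^5$ as well.
\<close>

lemma risk_le_selected_cost:
  assumes \<Phi>: "\<Phi> \<in> orthonormal_seqs \<nu>" and lam: "lam \<in> Lambda" and j: "j \<ge> 1"
    and s: "\<And>i. i \<in> {1..j} \<Longrightarrow> s i \<in> M" and P: "is_density L P"
  shows "ereal (1 / 100000) * enn2ereal (hellinger_risk \<mu> n P estimator)
    \<le> (enn2ereal (hellinger2 L P (mixed_det_density \<iota> \<Phi> lam)) + ereal (\<Sum>\<^sub>\<infinity>i\<in>{j<..}. (lam i)\<^sup>2))
      + (\<Sum>i=1..j. cost \<Phi> i (s i))"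
proof (cases "hellinger2 L P (mixed_det_density \<iota> \<Phi> lam) = \<infinity> \<or> (\<exists>i\<in>{1..j}. cost \<Phi> i (s i) = \<infinity>)")
  case True
  let ?T = "\<Sum>\<^sub>\<infinity>i\<in>{j<..}. (lam i)\<^sup>2"
  have "0 \<le> (\<Sum>i=1..j. cost \<Phi> i (s i))" by (intro sum_nonneg cost_nonneg s)
  moreover have "0 \<le> enn2ereal (hellinger2 L P (mixed_det_density \<iota> \<Phi> lam))" by simp
  moreover from True have "enn2ereal (hellinger2 L P (mixed_det_density \<iota> \<Phi> lam)) = \<infinity> \<or> (\<Sum>i=1..j. cost \<Phi> i (s i)) = \<infinity>"
    by (auto simp: sum_Pinfty)
  ultimately have "(enn2ereal (hellinger2 L P (mixed_det_density \<iota> \<Phi> lam)) + ereal ?T) + (\<Sum>i=1..j. cost \<Phi> i (s i)) = \<infinity>"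
    by auto
  then show ?thesis by (simp only: ereal_less_eq)
next
  case False
  obtain x where x: "hellinger2 L P (mixed_det_density \<iota> \<Phi> lam) = ennreal x" "x \<ge> 0"
    using False by (cases "hellinger2 L P (mixed_det_density \<iota> \<Phi> lam)") auto
  let ?T = "\<Sum>\<^sub>\<infinity>i\<in>{j<..}. (lam i)\<^sup>2" and ?lc = "\<lambda>i. ln (real (card (net (s i))) * real n / p (s i))"
  have ne: "orthonormal_seqs \<nu> \<noteq> {}" using \<Phi> by auto
  have "\<forall>i\<in>{1..j}. \<exists>c. c \<in> codes \<and> fst c = s i \<and>
      ereal (max 0 (((l2_norm \<nu> (\<lambda>x. \<Phi> i x - net_point (s i) (fst (snd c)) x))\<^sup>2 - 2 / real n) / 2) + ?lc i / real n)
        \<le> cost \<Phi> i (s i) \<and> \<bar>lam i - real (snd (snd c)) / real n\<bar> \<le> 1 / real n"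
  proof
    fix i assume i: "i \<in> {1..j}"
    have a: "cost \<Phi> i (s i) \<noteq> \<infinity>" using False i by blast
    have b: "\<Phi> i \<in> l2_space \<nu>" using \<Phi> i by (auto simp: orthonormal_seqs_def)
    have d: "0 \<le> lam i" "lam i \<le> 1" using LambdaD[OF lam, of i] i by auto
    obtain l g where "(s i, l, g) \<in> codes"
      "ereal (max 0 (((l2_norm \<nu> (\<lambda>x. \<Phi> i x - net_point (s i) l x))\<^sup>2 - 2 / real n) / 2) + ?lc i / real n) \<le> cost \<Phi> i (s i)"
      "\<bar>lam i - real g / real n\<bar> \<le> 1 / real n"
      by (rule cost_finite_code[OF s[OF i] a b d])
    then show "\<exists>c. c \<in> codes \<and> fst c = s i \<and>
      ereal (max 0 (((l2_norm \<nu> (\<lambda>x. \<Phi> i x - net_point (s i) (fst (snd c)) x))\<^sup>2 - 2 / real n) / 2) + ?lc i / real n)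
        \<le> cost \<Phi> i (s i) \<and> \<bar>lam i - real (snd (snd c)) / real n\<bar> \<le> 1 / real n"
      by (intro exI[of _ "(s i, l, g)"]) simp
  qed
  from bchoice[OF this] obtain c where
    c: "\<And>i. i \<in> {1..j} \<Longrightarrow> c i \<in> codes" "\<And>i. i \<in> {1..j} \<Longrightarrow> fst (c i) = s i"
    and c_cost: "\<And>i. i \<in> {1..j} \<Longrightarrow>
      ereal (max 0 (((l2_norm \<nu> (\<lambda>x. \<Phi> i x - net_point (s i) (fst (snd (c i))) x))\<^sup>2 - 2 / real n) / 2) + ?lc i / real n)
        \<le> cost \<Phi> i (s i)"
    and c_level: "\<And>i. i \<in> {1..j} \<Longrightarrow> \<bar>lam i - real (snd (snd (c i))) / real n\<bar> \<le> 1 / real n"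
    by blast
  define \<tau> where "\<tau> = map c [1..<Suc j]"
  have len: "length \<tau> = j" by (simp add: \<tau>_def)
  have \<tau>: "set \<tau> \<subseteq> codes" "\<tau> \<noteq> []" using c(1) j by (auto simp: \<tau>_def)
  have nth: "\<tau> ! (i - 1) = c i" if "i \<in> {1..j}" for i using that by (auto simp: \<tau>_def simp del: upt_Suc)
  have fn: "code_function \<tau> i = net_point (s i) (fst (snd (c i)))" if "i \<in> {1..j}" for i
    unfolding code_function_def nth[OF that] using c(2)[OF that] by (auto simp: case_prod_beta')
  have lvl: "code_level \<tau> i = real (snd (snd (c i))) / real n" if "i \<in> {1..j}" for i
    unfolding code_level_def nth[OF that] using that by (auto simp: len case_prod_beta')
  define \<delta> where "\<delta> i = l2_dist2 \<nu> (\<Phi> i) (code_function \<tau> i)" for i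
  define a where "a i = max 0 ((\<delta> i - 2 / real n) / 2)" for i
  have n0: "real n > 0" using n by simp
  have hell_le: "hell L P (candidate \<tau>) \<le> 8 * x + 16 * ?T + 24 * real j / real n + 64 * code_error \<tau> \<Phi> + 32 / real n"
    using candidate_distance[OF \<Phi> lam \<tau>(1) P x] c_level lvl len by simp
  have err: "code_error \<tau> \<Phi> \<le> 2 * (\<Sum>i=1..j. a i) + 2 * real j / real n"
  proof -
    have "code_error \<tau> \<Phi> \<le> (\<Sum>i=1..j. 2 * a i + 2 / real n)"
      unfolding code_error_def len \<delta>_def[symmetric] by (intro sum_mono) (simp add: a_def max_def field_simps)
    also have "\<dots> = 2 * (\<Sum>i=1..j. a i) + 2 * real j / real n" by (simp add: sum.distrib sum_distrib_left)
    finally show ?thesis .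
  qed
  define k where "k = to_nat \<tau>"
  have k: "k \<in> code_indices" "from_nat k = \<tau>" using \<tau> by (auto simp: k_def code_indices_def)
  then have ci: "code_indices \<noteq> {}" by auto
  interpret S: density_selection L n code_indices "\<lambda>k. candidate (from_nat k)" "\<lambda>k. prod_list (map code_weight (from_nat k))"
    by (rule selection[OF ne ci])
  have est: "estimator = (\<lambda>\<omega>. candidate (from_nat (S.best \<omega>)))" using ne ci by (simp add: estimator_def fun_eq_iff)
  define B where "B = (\<Sum>i=1..j. ?lc i)"
  have pen: "S.pen k \<le> B + 2 * real j"
  proof -
    have "S.pen k \<le> (\<Sum>i=1..j. ln (real (card (net (fst (c i)))) * real n / p (fst (c i))) + 2)"
      unfolding S.pen_def k(2) \<tau>_def by (rule code_list_penalty[OF c(1)])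
    also have "\<dots> = (\<Sum>i=1..j. ?lc i + 2)" by (intro sum.cong refl) (simp only: c(2))
    also have "\<dots> = B + 2 * real j" by (simp add: sum.distrib B_def)
    finally show ?thesis .
  qed
  have Blow: "real j / 2 \<le> B"
  proof -
    have "(\<Sum>i=1..j. 1 / 2) \<le> B"
      unfolding B_def
    proof (rule sum_mono)
      fix i assume i: "i \<in> {1..j}"
      obtain m l g where e: "c i = (m, l, g)" by (cases "c i")
      then have "p (s i) > 0" "H (s i) \<noteq> {}" using c(1)[OF i] c(2)[OF i] by (auto simp: codes_def)
      then show "1 / 2 \<le> ?lc i" by (rule log_cost_ge[OF s[OF i]])
    qed
    then show ?thesis by simp
  qed
  define A where "A = (\<Sum>i=1..j. a i)"
  have A0: "A \<ge> 0" unfolding A_def a_def by (intro sum_nonneg) simp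
  have x0: "x \<ge> 0" by (rule x(2))
  have T0: "?T \<ge> 0" by (rule infsum_nonneg) simp
  have risk: "hellinger_risk \<mu> n P estimator \<le> ennreal (240 * hell L P (candidate \<tau>) + 36 * (S.pen k + 1) / real n)"
    unfolding hellinger_risk_def est using S.selection_risk[OF P k(1)] unfolding k(2) .
  have "240 * hell L P (candidate \<tau>) + 36 * (S.pen k + 1) / real n \<le> 100000 * (x + ?T + A + B / real n)"
  proof -
    have j1: "1 / real n \<le> real j / real n" using j n0 by (intro divide_right_mono) auto
    have Bn: "real j / real n \<le> 2 * (B / real n)" using Blow n0 by (simp add: field_simps)
    have pn: "36 * (S.pen k + 1) / real n \<le> 36 * (B / real n) + 72 * (real j / real n) + 36 * (1 / real n)"
    proof -
      have "36 * (S.pen k + 1) / real n \<le> 36 * (B + 2 * real j + 1) / real n" using pen n0 by (intro divide_right_mono) auto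
      then show ?thesis by (simp add: add_divide_distrib)
    qed
    have h2: "hell L P (candidate \<tau>) \<le> 8 * x + 16 * ?T + 24 * (real j / real n) + 64 * (2 * A + 2 * (real j / real n)) + 32 * (1 / real n)"
      using hell_le err unfolding A_def by simp
    have n1: "0 \<le> 1 / real n" by simp
    show ?thesis using h2 pn j1 n1 Bn A0 x0 T0 by argo
  qed
  then have "hellinger_risk \<mu> n P estimator \<le> ennreal (100000 * (x + ?T + A + B / real n))"
    using risk by (meson ennreal_leI order_trans)
  then have "enn2ereal (hellinger_risk \<mu> n P estimator) \<le> enn2ereal (ennreal (100000 * (x + ?T + A + B / real n)))"
    by (simp add: less_eq_ennreal.rep_eq)
  also have "\<dots> = ereal (100000 * (x + ?T + A + B / real n))"
    using x0 T0 A0 Blow n0 by (intro enn2ereal_ennreal) (auto intro!: add_nonneg_nonneg divide_nonneg_pos)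
  finally have "ereal (1 / 100000) * enn2ereal (hellinger_risk \<mu> n P estimator)
     \<le> ereal (1 / 100000) * ereal (100000 * (x + ?T + A + B / real n))"
    by (rule ereal_mult_left_mono) simp
  also have "\<dots> = (ereal x + ereal ?T) + (\<Sum>i=1..j. ereal (a i + ?lc i / real n))"
    by (simp add: A_def B_def sum.distrib sum_divide_distrib)
  also have "\<dots> \<le> (ereal x + ereal ?T) + (\<Sum>i=1..j. cost \<Phi> i (s i))"
  proof (intro add_left_mono sum_mono)
    fix i assume i: "i \<in> {1..j}"
    show "ereal (a i + ?lc i / real n) \<le> cost \<Phi> i (s i)"
      unfolding a_def \<delta>_def fn[OF i] by (rule c_cost[OF i])
  qed
  finally show ?thesis using x by (simp add: enn2ereal_ennreal)
qed

text \<open>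
  All infima of the bound are removed by choosing, for every number of functions, one model for each of them.
\<close>

lemma oracle_inequality:
  assumes P: "is_density L P"
  shows "ereal (1 / 100000) * enn2ereal (hellinger_risk \<mu> n P estimator) \<le> oracle_bound \<mu> \<nu> \<iota> n M H p P"
  unfolding oracle_bound_def
proof (intro INF_greatest)
  fix \<Phi> lam assume \<Phi>: "\<Phi> \<in> orthonormal_seqs \<nu>" and lam: "lam \<in> Lambda"
  have cost: "approx_cost \<nu> n M H p (\<Phi> i) = (INF m\<in>M. cost \<Phi> i m)" for i
    unfolding approx_cost_def cost_def ..
  have T: "0 \<le> ereal (\<Sum>\<^sub>\<infinity>i\<in>{j<..}. (lam i)\<^sup>2)" for j by (simp add: infsum_nonneg)
  show "ereal (1 / 100000) * enn2ereal (hellinger_risk \<mu> n P estimator)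
     \<le> enn2ereal (hellinger2 L P (mixed_det_density \<iota> \<Phi> lam)) +
       (INF j\<in>{1..}. (\<Sum>j'=1..j. approx_cost \<nu> n M H p (\<Phi> j')) + ereal (\<Sum>\<^sub>\<infinity>j'\<in>{j<..}. (lam j')\<^sup>2))"
  proof (rule le_add_INF)
    show "0 \<le> enn2ereal (hellinger2 L P (mixed_det_density \<iota> \<Phi> lam))" by simp
    fix j :: nat assume "j \<in> {1..}"
    then have j: "j \<ge> 1" by simp
    have c0: "0 \<le> (\<Sum>j'=1..j. approx_cost \<nu> n M H p (\<Phi> j'))"
      unfolding cost by (intro sum_nonneg INF_greatest cost_nonneg)
    then show "0 \<le> (\<Sum>j'=1..j. approx_cost \<nu> n M H p (\<Phi> j')) + ereal (\<Sum>\<^sub>\<infinity>j'\<in>{j<..}. (lam j')\<^sup>2)"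
      using T[of j] by (intro add_nonneg_nonneg)
    have "ereal (1 / 100000) * enn2ereal (hellinger_risk \<mu> n P estimator)
      \<le> (enn2ereal (hellinger2 L P (mixed_det_density \<iota> \<Phi> lam)) + ereal (\<Sum>\<^sub>\<infinity>i\<in>{j<..}. (lam i)\<^sup>2))
        + (\<Sum>i=1..j. INF m\<in>M. cost \<Phi> i m)"
    proof (rule le_add_sum_INF)
      show "0 \<le> enn2ereal (hellinger2 L P (mixed_det_density \<iota> \<Phi> lam)) + ereal (\<Sum>\<^sub>\<infinity>i\<in>{j<..}. (lam i)\<^sup>2)"
        using T[of j] by (intro add_nonneg_nonneg) simp_all
      fix s assume "\<And>i. i \<in> {1..j} \<Longrightarrow> s i \<in> M"
      then show "ereal (1 / 100000) * enn2ereal (hellinger_risk \<mu> n P estimator)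
        \<le> (enn2ereal (hellinger2 L P (mixed_det_density \<iota> \<Phi> lam)) + ereal (\<Sum>\<^sub>\<infinity>i\<in>{j<..}. (lam i)\<^sup>2))
          + (\<Sum>i=1..j. cost \<Phi> i (s i))"
        by (rule risk_le_selected_cost[OF \<Phi> lam j _ P])
    qed (auto intro: cost_nonneg)
    then show "ereal (1 / 100000) * enn2ereal (hellinger_risk \<mu> n P estimator)
      \<le> enn2ereal (hellinger2 L P (mixed_det_density \<iota> \<Phi> lam)) +
       ((\<Sum>j'=1..j. approx_cost \<nu> n M H p (\<Phi> j')) + ereal (\<Sum>\<^sub>\<infinity>j'\<in>{j<..}. (lam j')\<^sup>2))"
      unfolding cost by (simp only: add.assoc add.commute add.left_commute)
  qed
qed

end

lemma embedding_id:
  assumes "sigma_finite_measure \<mu>"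
  shows "embedding \<mu> \<mu> (\<lambda>x. x)"
  using assms by unfold_locales (auto simp: sigma_finite_measure_def)

lemma embedding_finite:
  assumes X: "finite X" and \<iota>: "bij_betw \<iota> X {1..card X}"
  shows "embedding (count_space X) (count_space {1::nat..}) \<iota>"
proof (rule embedding.intro)
  show "sigma_finite_measure (count_space X)"
    by (rule sigma_finite_measure_count_space_countable[OF countable_finite[OF X]])
  show "sigma_finite_measure (count_space {1::nat..})"
    by (rule sigma_finite_measure_count_space_countable) simp
  have img: "\<iota> ` X = {1..card X}" and inj: "inj_on \<iota> X" using \<iota> by (auto simp: bij_betw_def)
  then show "\<iota> \<in> measurable (count_space X) (count_space {1..})" by auto
  fix f :: "nat \<Rightarrow> ennreal"
  have "(\<integral>\<^sup>+x. f (\<iota> x) \<partial>count_space X) = (\<Sum>x\<in>X. f (\<iota> x))"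
    by (rule nn_integral_count_space_finite[OF X])
  also have "\<dots> = (\<Sum>y\<in>{1..card X}. f y)" by (rule sum.reindex_bij_betw[OF \<iota>])
  also have "\<dots> = (\<integral>\<^sup>+y. f y \<partial>count_space {1..card X})"
    by (rule nn_integral_count_space_finite[symmetric]) simp
  also have "\<dots> = (\<integral>\<^sup>+y. f y * indicator {1..card X} y \<partial>count_space {1..})"
    by (subst nn_integral_count_space_indicator, simp, subst (2) nn_integral_count_space_indicator, simp)
       (auto intro!: nn_integral_cong simp: indicator_def)
  also have "\<dots> \<le> (\<integral>\<^sup>+y. f y \<partial>count_space {1..})"
    by (intro nn_integral_mono) (auto simp: indicator_def)
  finally show "(\<integral>\<^sup>+x. f (\<iota> x) \<partial>count_space X) \<le> (\<integral>\<^sup>+y. f y \<partial>count_space {1..})" .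
qed

lemma (in embedding) oracle_estimator_exists:
  fixes M :: "nat set"
  assumes "n \<ge> 2" "\<forall>m\<in>M. compactin (l2_topology \<nu>) (H m)" "subprobability M p"
  shows "\<exists>est. density_estimator \<mu> n est \<and>
    (\<forall>P. is_density (config_measure \<mu>) P \<longrightarrow>
       ereal (1 / 100000) * enn2ereal (hellinger_risk \<mu> n P est) \<le> oracle_bound \<mu> \<nu> \<iota> n M H p P)"
proof -
  interpret oracle_setting \<mu> \<nu> \<iota> n M H p
    by unfold_locales (use assms in auto)
  show ?thesis using estimator_is_density_estimator oracle_inequality by blast
qed

theorem theorem1:
  shows "\<exists>C>0::real.
    (\<forall>(X::'a set) d \<mu> n (M::nat set) H p.
       Metric_space X d \<and> infinite X \<and>
       sigma_finite_measure \<mu> \<and> sets \<mu> = sets (metric_borel X d) \<and> n \<ge> 2 \<and>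
       (\<forall>m\<in>M. compactin (l2_topology \<mu>) (H m)) \<and> subprobability M p \<longrightarrow>
       (\<exists>est. density_estimator \<mu> n est \<and>
          (\<forall>P. is_density (config_measure \<mu>) P \<longrightarrow>
             ereal C * enn2ereal (hellinger_risk \<mu> n P est)
               \<le> oracle_bound \<mu> \<mu> (\<lambda>x. x) n M H p P))) \<and>
    (\<forall>(X::'a set) d \<iota> n (M::nat set) H p.
       Metric_space X d \<and> finite X \<and> bij_betw \<iota> X {1..card X} \<and> n \<ge> 2 \<and>
       (\<forall>m\<in>M. compactin (l2_topology (count_space {1..})) (H m)) \<and> subprobability M p \<longrightarrow>
       (\<exists>est. density_estimator (count_space X) n est \<and>
          (\<forall>P. is_density (config_measure (count_space X)) P \<longrightarrow>
             ereal C * enn2ereal (hellinger_risk (count_space X) n P est)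
               \<le> oracle_bound (count_space X) (count_space {1::nat..}) \<iota> n M H p P)))"
  \<comment> \<open>The witness is the constant of \<open>oracle_inequality\<close>, which depends neither on the state space nor on the sample size.\<close>
  apply (intro exI[of _ "1 / 100000"] conjI allI impI)
  subgoal by simp
  subgoal by (elim conjE, rule embedding.oracle_estimator_exists[OF embedding_id]; assumption)
  subgoal by (elim conjE, rule embedding.oracle_estimator_exists[OF embedding_finite]; assumption)
  done

end
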